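(* Let $K$ be a field of characteristic $0$, $H$ a Hopf algebra over $K$, and $(R,\xi)$ a pre-bialgebra with cocycle in ${}_H^H\mathcal{YD}$ with multiplication $m_R:R\otimes R\to R$. If $R$ is connected, then the following are equivalent. (i) $m_R$ is associative. (ii) $\xi(z)t=\varepsilon(z)t$ for every $z\in R\otimes R$ and $t\in R$, where $\varepsilon=\varepsilon_R\otimes\varepsilon_R$. (iii) $\Phi(\xi)=\mathrm{Id}_{R\otimes R\otimes R}$, where $\Phi(\xi)\in\mathrm{End}(R\otimes R\otimes R)$ is defined by $\Phi(\xi)(z\otimes t)=z^{(1)}\otimes \xi(z^{(2)})t$ for $z\in R\otimes R$, $t\in R$, with $z^{(1)}\otimes z^{(2)}=\Delta_{R\otimes R}(z)$.
   Context: Yetter-Drinfeld conventions. ${}_H^H\mathcal{YD}$ is the category of left-left Yetter-Drinfeld modules over $H$: left $H$-modules (action written $hv$) and left $H$-comodules ($\rho(v)=v_{\langle -1\rangle}\otimes v_{\langle 0\rangle}$) with $\rho(hv)=h_{(1)}v_{\langle -1\rangle}S(h_{(3)})\otimes h_{(2)}v_{\langle 0\rangle}$. Tensor products carry the diagonal action and codiagonal coaction; the braiding is $c_{V,W}(v\otimes w)=v_{\langle -1\rangle}w\otimes v_{\langle 0\rangle}$. For a coalgebra $C$ in ${}_H^H\mathcal{YD}$ write $\Delta_C(x)=x^{(1)}\otimes x^{(2)}$. For coalgebras $C,D$ in ${}_H^H\mathcal{YD}$, $C\otimes D$ is a coalgebra in ${}_H^H\mathcal{YD}$ with counit $\varepsilon_C\otimes\varepsilon_D$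 and $\Delta_{C\otimes D}(x\otimes y)=(x^{(1)}\otimes x^{(2)}_{\langle -1\rangle}y^{(1)})\otimes(x^{(2)}_{\langle 0\rangle}\otimes y^{(2)})$. A coaugmented coalgebra in ${}_H^H\mathcal{YD}$ is one with a map $u_C:K\to C$ such that $1_C=u_C(1)$ is grouplike, $h1_C=\varepsilon_H(h)1_C$ and $\rho(1_C)=1_H\otimes 1_C$. It is connected if its coradical is $K1_C$. Pre-bialgebra with cocycle. A pre-bialgebra $R=(R,m_R,u_R,\Delta_R,\varepsilon_R)$ in ${}_H^H\mathcal{YD}$ is a coaugmented coalgebra in ${}_H^H\mathcal{YD}$ with a left $H$-linear map $m_R:R\otimes R\to R$ that is a coalgebra homomorphism, $\Delta_Rm_R=(m_R\otimes m_R)\Delta_{R\otimes R}$, $\varepsilon_Rm_R=\varepsilon_R\otimes\varepsilon_R$, and for which $1_R$ is a two-sided unit ($m_R$ need be neither associative nor $H$-colinear). A pre-bialgebra with cocycle $(R,\xi)$ is a pre-bialgebra $R$ with a linear map $\xi:R\otimes R\to H$ such that, for all $h\in H$, $r,s,t\in R$, and $z\in R\otimes R$ (with $\Delta_{R\otimes R}(z)=z^{(1)}\otimes z^{(2)}$): (1) $\xi(z)_{(1)}\otimes\xi(z)_{(2)}=\xi(z^{(1)})z^{(2)}_{\langle -1\rangle}\otimes\xi(z^{(2)}_{\langle 0\rangle})$ and $\varepsilon_H\xi=\varepsilon_R\otimes\varepsilon_R$; (2) $\xi(hz)=h_{(1)}\xi(z)S(h_{(2)})$; (3) $m_R(z^{(1)})_{\langle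 -1\rangle}\,\xi(z^{(2)})\otimes m_R(z^{(1)})_{\langle 0\rangle}=\xi(z^{(1)})z^{(2)}_{\langle -1\rangle}\otimes m_R(z^{(2)}_{\langle 0\rangle})$; (4) $m_R(r\otimes m_R(s\otimes t))=m_R\big(m_R(z^{(1)})\otimes\xi(z^{(2)})t\big)$ with $z=r\otimes s$; (5) $\xi(r\otimes m_R(w^{(1)}))\,\xi(w^{(2)})=\xi\big(m_R(z^{(1)})\otimes\xi(z^{(2)})_{(1)}t\big)\,\xi(z^{(2)})_{(2)}$ with $w=s\otimes t$, $z=r\otimes s$; (6) $\xi(r\otimes 1_R)=\xi(1_R\otimes r)=\varepsilon_R(r)1_H$. *)

theory Defs
  imports Complex_Main "HOL-Library.Function_Algebras"
begin

text \<open>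
  A vector space over the field \<open>'k\<close> is a subspace of a type that carries a
  \<^term>\<open>vector_space\<close> structure: tensor products depend on the scalar multiplications of their
  factors, so they can only be carved out of an ambient type.
\<close>

record ('k, 'v) space =
  vecs :: "'v set"
  scl :: "'k \<Rightarrow> 'v \<Rightarrow> 'v"

definition vspace :: "('k::field, 'v::ab_group_add, 'a) space_scheme \<Rightarrow> bool" where
  "vspace V \<longleftrightarrow> vector_space (scl V) \<and> module.subspace (scl V) (vecs V)"

definition linear_on ::
  "('k::field, 'v::ab_group_add, 'a) space_scheme \<Rightarrow> ('k, 'w::ab_group_add, 'b) space_scheme
    \<Rightarrow> ('v \<Rightarrow> 'w) \<Rightarrow> bool" where
  "linear_on V W f \<longleftrightarrow>
    f ` vecs V \<subseteq> vecs W \<and>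
    (\<forall>x\<in>vecs V. \<forall>y\<in>vecs V. f (x + y) = f x + f y) \<and>
    (\<forall>c. \<forall>x\<in>vecs V. f (scl V c x) = scl W c (f x))"

definition bilinear_on ::
  "('k::field, 'v::ab_group_add, 'a) space_scheme \<Rightarrow> ('k, 'w::ab_group_add, 'b) space_scheme
    \<Rightarrow> ('k, 'u::ab_group_add, 'c) space_scheme \<Rightarrow> ('v \<Rightarrow> 'w \<Rightarrow> 'u) \<Rightarrow> bool" where
  "bilinear_on V W U f \<longleftrightarrow>
    (\<forall>v\<in>vecs V. linear_on W U (f v)) \<and> (\<forall>w\<in>vecs W. linear_on V U (\<lambda>v. f v w))"

definition ground :: "('k::field, 'k) space" where
  "ground = \<lparr>vecs = UNIV, scl = (*)\<rparr>"

text \<open>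
  The tensor product of \<open>V\<close> and \<open>W\<close> is realised inside the dual of the space of bilinear forms
  on \<open>V \<times> W\<close>: the pure tensor of \<open>v\<close> and \<open>w\<close> is evaluation at \<open>(v, w)\<close>, and the tensor product
  is the span of the pure tensors. Lemma \<open>sweedler_sum_list\<close> below is its universal property.
\<close>

type_synonym ('k, 'v, 'w) tensor = "('v \<Rightarrow> 'w \<Rightarrow> 'k) \<Rightarrow> 'k"

definition pure ::
  "('k::field, 'v::ab_group_add, 'a) space_scheme \<Rightarrow> ('k, 'w::ab_group_add, 'b) space_scheme
    \<Rightarrow> 'v \<Rightarrow> 'w \<Rightarrow> ('k, 'v, 'w) tensor" where
  "pure V W v w = (\<lambda>B. if bilinear_on V W ground B then B v w else 0)"

abbreviation pure_syntax
  ("(_ \<otimes>\<^bsub>_,_\<^esub> _)" [71, 0, 0, 71] 70) where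
  "v \<otimes>\<^bsub>V,W\<^esub> w \<equiv> pure V W v w"

definition tensor_scale :: "'k::field \<Rightarrow> ('k, 'v, 'w) tensor \<Rightarrow> ('k, 'v, 'w) tensor" where
  "tensor_scale c x = (\<lambda>B. c * x B)"

definition tensor_space ::
  "('k::field, 'v::ab_group_add, 'a) space_scheme \<Rightarrow> ('k, 'w::ab_group_add, 'b) space_scheme
    \<Rightarrow> ('k, ('k, 'v, 'w) tensor) space" (infixr "\<Otimes>" 75) where
  "V \<Otimes> W =
    \<lparr>vecs = module.span tensor_scale {v \<otimes>\<^bsub>V,W\<^esub> w | v w. v \<in> vecs V \<and> w \<in> vecs W},
     scl = tensor_scale\<rparr>"

text \<open>
  Sweedler summation: \<open>sweedler V W x f\<close> is the sum of the \<open>f v\<^sub>i w\<^sub>i\<close> for \<open>x\<close> the sum of the pure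
  tensors of \<open>v\<^sub>i\<close> and \<open>w\<^sub>i\<close>. For bilinear \<open>f\<close> the choice of this expression for \<open>x\<close> is immaterial.
\<close>

definition tensor_rep ::
  "('k::field, 'v::ab_group_add, 'a) space_scheme \<Rightarrow> ('k, 'w::ab_group_add, 'b) space_scheme
    \<Rightarrow> ('k, 'v, 'w) tensor \<Rightarrow> ('v \<times> 'w) list" where
  "tensor_rep V W x =
    (SOME ps. set ps \<subseteq> vecs V \<times> vecs W \<and> x = (\<Sum>(v, w)\<leftarrow>ps. v \<otimes>\<^bsub>V,W\<^esub> w))"

definition sweedler ::
  "('k::field, 'v::ab_group_add, 'a) space_scheme \<Rightarrow> ('k, 'w::ab_group_add, 'b) space_scheme
    \<Rightarrow> ('k, 'v, 'w) tensor \<Rightarrow> ('v \<Rightarrow> 'w \<Rightarrow> 'u::ab_group_add) \<Rightarrow> 'u" where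
  "sweedler V W x f = (\<Sum>(v, w)\<leftarrow>tensor_rep V W x. f v w)"

lemma vector_space_tensor_scale: "vector_space (tensor_scale :: 'k::field \<Rightarrow> ('k, 'v, 'w) tensor \<Rightarrow> _)"
  by unfold_locales (auto simp: tensor_scale_def fun_eq_iff algebra_simps)

lemma vspace_tensor_space:
  fixes V :: "('k::field, 'v::ab_group_add, 'a) space_scheme"
    and W :: "('k, 'w::ab_group_add, 'b) space_scheme"
  shows "vspace (V \<Otimes> W)"
proof -
  interpret T: vector_space "tensor_scale :: 'k \<Rightarrow> ('k, 'v, 'w) tensor \<Rightarrow> _"
    by (rule vector_space_tensor_scale)
  show ?thesis
    by (simp add: vspace_def tensor_space_def vector_space_tensor_scale T.subspace_span)
qed

lemma pure_in_tensor_space: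
  fixes V :: "('k::field, 'v::ab_group_add, 'a) space_scheme"
    and W :: "('k, 'w::ab_group_add, 'b) space_scheme"
  shows "v \<in> vecs V \<Longrightarrow> w \<in> vecs W \<Longrightarrow> v \<otimes>\<^bsub>V,W\<^esub> w \<in> vecs (V \<Otimes> W)"
proof -
  interpret T: vector_space "tensor_scale :: 'k \<Rightarrow> ('k, 'v, 'w) tensor \<Rightarrow> _"
    by (rule vector_space_tensor_scale)
  show "v \<in> vecs V \<Longrightarrow> w \<in> vecs W \<Longrightarrow> v \<otimes>\<^bsub>V,W\<^esub> w \<in> vecs (V \<Otimes> W)"
    by (auto simp: tensor_space_def intro: T.span_base)
qed

lemma bilinear_on_pure: "bilinear_on V W (V \<Otimes> W) (pure V W)"
  unfolding bilinear_on_def linear_on_def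
  by (auto simp: pure_in_tensor_space)
     (auto simp: pure_def fun_eq_iff tensor_space_def tensor_scale_def bilinear_on_def linear_on_def
        ground_def)

lemma tensor_rep_exists:
  fixes V :: "('k::field, 'v::ab_group_add, 'a) space_scheme"
    and W :: "('k, 'w::ab_group_add, 'b) space_scheme"
  assumes V: "vspace V" and x: "x \<in> vecs (V \<Otimes> W)"
  shows "\<exists>ps. set ps \<subseteq> vecs V \<times> vecs W \<and> x = (\<Sum>(v, w)\<leftarrow>ps. v \<otimes>\<^bsub>V,W\<^esub> w)"
proof -
  interpret T: vector_space "tensor_scale :: 'k \<Rightarrow> ('k, 'v, 'w) tensor \<Rightarrow> _"
    by (rule vector_space_tensor_scale)
  interpret V: vector_space "scl V"
    using V by (simp add: vspace_def)
  have V': "V.subspace (vecs V)"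
    using V by (simp add: vspace_def)
  have "x \<in> T.span {v \<otimes>\<^bsub>V,W\<^esub> w | v w. v \<in> vecs V \<and> w \<in> vecs W}"
    using x by (simp add: tensor_space_def)
  then show ?thesis
  proof (induction rule: T.span_induct_alt)
    case base
    show ?case by (rule exI[of _ "[]"]) simp
  next
    case (step c p y)
    then obtain v w ps where *: "p = v \<otimes>\<^bsub>V,W\<^esub> w" "v \<in> vecs V" "w \<in> vecs W"
      "set ps \<subseteq> vecs V \<times> vecs W" "y = (\<Sum>(v, w)\<leftarrow>ps. v \<otimes>\<^bsub>V,W\<^esub> w)"
      by auto
    have "tensor_scale c p = scl V c v \<otimes>\<^bsub>V,W\<^esub> w"
      using bilinear_on_pure[of V W] * unfolding bilinear_on_def linear_on_def
      by (auto simp: tensor_space_def)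
    moreover have "scl V c v \<in> vecs V"
      using V' * by (simp add: V.subspace_def)
    ultimately show ?case
      using * by (intro exI[of _ "(scl V c v, w) # ps"]) auto
  qed
qed

lemma separating_form:
  fixes U :: "('k::field, 'u::ab_group_add, 'a) space_scheme"
  assumes U: "vspace U" and x: "x \<noteq> 0"
  shows "\<exists>g. linear_on U ground g \<and> g x \<noteq> 0 \<and> Vector_Spaces.linear (scl U) (*) g"
proof -
  interpret U: vector_space "scl U" using U by (simp add: vspace_def)
  interpret P: vector_space_pair "scl U" "(*) :: 'k \<Rightarrow> 'k \<Rightarrow> 'k"
    by unfold_locales (auto simp: algebra_simps)
  have "U.independent {x}" using x by simp
  from P.linear_independent_extend[OF this, of "\<lambda>_. 1"] obtain g
    where g: "Vector_Spaces.linear (scl U) (*) g" "g x = 1" by auto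
  interpret g: Vector_Spaces.linear "scl U" "(*)" g by (rule g)
  show ?thesis
    using g by (intro exI[of _ g]) (auto simp: linear_on_def ground_def g.add g.scale)
qed

lemma sweedler_sum_list:
  assumes V: "vspace V" and U: "vspace U" and f: "bilinear_on V W U f"
    and ps: "set ps \<subseteq> vecs V \<times> vecs W"
  shows "sweedler V W (\<Sum>(v, w)\<leftarrow>ps. v \<otimes>\<^bsub>V,W\<^esub> w) f = (\<Sum>(v, w)\<leftarrow>ps. f v w)"
proof (rule ccontr)
  define x where "x = (\<Sum>(v, w)\<leftarrow>ps. v \<otimes>\<^bsub>V,W\<^esub> w)"
  define qs where "qs = tensor_rep V W x"
  have "set qs \<subseteq> vecs V \<times> vecs W \<and> x = (\<Sum>(v, w)\<leftarrow>qs. v \<otimes>\<^bsub>V,W\<^esub> w)"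
    unfolding qs_def tensor_rep_def by (rule someI[of _ ps]) (simp add: x_def ps)
  then have qs: "set qs \<subseteq> vecs V \<times> vecs W" "x = (\<Sum>(v, w)\<leftarrow>qs. v \<otimes>\<^bsub>V,W\<^esub> w)" by auto
  assume "sweedler V W (\<Sum>(v, w)\<leftarrow>ps. v \<otimes>\<^bsub>V,W\<^esub> w) f \<noteq> (\<Sum>(v, w)\<leftarrow>ps. f v w)"
  then have ne: "(\<Sum>(v, w)\<leftarrow>qs. f v w) - (\<Sum>(v, w)\<leftarrow>ps. f v w) \<noteq> 0"
    by (simp add: sweedler_def x_def[symmetric] qs_def[symmetric])
  obtain g where g: "linear_on U ground g"
    and gne: "g ((\<Sum>(v, w)\<leftarrow>qs. f v w) - (\<Sum>(v, w)\<leftarrow>ps. f v w)) \<noteq> 0"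
    and gl: "Vector_Spaces.linear (scl U) (*) g"
    using separating_form[OF U ne] by auto
  interpret g: Vector_Spaces.linear "scl U" "(*)" g by (rule gl)
  define B where "B = (\<lambda>v w. g (f v w))"
  have B: "bilinear_on V W ground B"
    using f unfolding bilinear_on_def linear_on_def B_def
    by (auto simp: g.add g.scale ground_def)
  have app: "(\<Sum>(v, w)\<leftarrow>rs. v \<otimes>\<^bsub>V,W\<^esub> w) B = g (\<Sum>(v, w)\<leftarrow>rs. f v w)" for rs
    using B by (induction rs) (auto simp: pure_def B_def g.add g.zero)
  from app[of ps] app[of qs] qs(2) gne show False
    by (simp add: x_def g.diff)
qed

definition coalgebra ::
  "('k::field, 'v::ab_group_add, 'a) space_scheme \<Rightarrow> ('v \<Rightarrow> ('k, 'v, 'v) tensor) \<Rightarrow> ('v \<Rightarrow> 'k)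
    \<Rightarrow> bool" where
  "coalgebra C \<Delta> \<epsilon> \<longleftrightarrow>
    vspace C \<and> linear_on C (C \<Otimes> C) \<Delta> \<and> linear_on C ground \<epsilon> \<and>
    (\<forall>x\<in>vecs C.
      sweedler C C (\<Delta> x) (\<lambda>y z. sweedler C C (\<Delta> y) (\<lambda>a b. (a \<otimes>\<^bsub>C,C\<^esub> b) \<otimes>\<^bsub>C \<Otimes> C,C\<^esub> z)) =
      sweedler C C (\<Delta> x) (\<lambda>y z. sweedler C C (\<Delta> z) (\<lambda>a b. (y \<otimes>\<^bsub>C,C\<^esub> a) \<otimes>\<^bsub>C \<Otimes> C,C\<^esub> b))) \<and>
    (\<forall>x\<in>vecs C.
      sweedler C C (\<Delta> x) (\<lambda>y z. scl C (\<epsilon> y) z) = x \<and>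
      sweedler C C (\<Delta> x) (\<lambda>y z. scl C (\<epsilon> z) y) = x)"

definition subcoalgebra ::
  "('k::field, 'v::ab_group_add, 'a) space_scheme \<Rightarrow> ('v \<Rightarrow> ('k, 'v, 'v) tensor) \<Rightarrow> 'v set
    \<Rightarrow> bool" where
  "subcoalgebra C \<Delta> D \<longleftrightarrow>
    D \<subseteq> vecs C \<and> module.subspace (scl C) D \<and>
    \<Delta> ` D \<subseteq> module.span tensor_scale {x \<otimes>\<^bsub>C,C\<^esub> y | x y. x \<in> D \<and> y \<in> D}"

definition simple_subcoalgebra ::
  "('k::field, 'v::ab_group_add, 'a) space_scheme \<Rightarrow> ('v \<Rightarrow> ('k, 'v, 'v) tensor) \<Rightarrow> 'v set
    \<Rightarrow> bool" where
  "simple_subcoalgebra C \<Delta> D \<longleftrightarrow>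
    subcoalgebra C \<Delta> D \<and> D \<noteq> {0} \<and> (\<forall>E\<subseteq>D. subcoalgebra C \<Delta> E \<longrightarrow> E = {0} \<or> E = D)"

definition coradical ::
  "('k::field, 'v::ab_group_add, 'a) space_scheme \<Rightarrow> ('v \<Rightarrow> ('k, 'v, 'v) tensor) \<Rightarrow> 'v set" where
  "coradical C \<Delta> = module.span (scl C) (\<Union>{D. simple_subcoalgebra C \<Delta> D})"

definition connected_coalgebra ::
  "('k::field, 'v::ab_group_add, 'a) space_scheme \<Rightarrow> ('v \<Rightarrow> ('k, 'v, 'v) tensor)
    \<Rightarrow> ('k \<Rightarrow> 'v) \<Rightarrow> bool" where
  "connected_coalgebra C \<Delta> u \<longleftrightarrow> coradical C \<Delta> = module.span (scl C) {u 1}"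

text \<open>
  The underlying space of \<open>H\<close> is the whole type \<open>'h\<close>, whose \<^class>\<open>ring_1\<close> structure
  provides multiplication and unit.
\<close>

record ('k, 'h) hopf = "('k, 'h) space" +
  hcomult :: "'h \<Rightarrow> ('k, 'h, 'h) tensor"
  hcounit :: "'h \<Rightarrow> 'k"
  antipode :: "'h \<Rightarrow> 'h"

definition hopf_algebra :: "('k::field, 'h::ring_1) hopf \<Rightarrow> bool" where
  "hopf_algebra H \<longleftrightarrow>
    vecs H = UNIV \<and>
    coalgebra H (hcomult H) (hcounit H) \<and>
    bilinear_on H H H (*) \<and>
    (\<forall>g h. hcomult H (g * h) =
      sweedler H H (hcomult H g) (\<lambda>g1 g2. sweedler H H (hcomult H h) (\<lambda>h1 h2.
        (g1 * h1) \<otimes>\<^bsub>H,H\<^esub> (g2 * h2)))) \<and>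
    hcomult H 1 = 1 \<otimes>\<^bsub>H,H\<^esub> 1 \<and>
    (\<forall>g h. hcounit H (g * h) = hcounit H g * hcounit H h) \<and>
    hcounit H 1 = 1 \<and>
    linear_on H H (antipode H) \<and>
    (\<forall>h. sweedler H H (hcomult H h) (\<lambda>h1 h2. antipode H h1 * h2) = scl H (hcounit H h) 1 \<and>
         sweedler H H (hcomult H h) (\<lambda>h1 h2. h1 * antipode H h2) = scl H (hcounit H h) 1)"

record ('k, 'h, 'v) yd = "('k, 'v) space" +
  act :: "'h \<Rightarrow> 'v \<Rightarrow> 'v"
  coact :: "'v \<Rightarrow> ('k, 'h, 'v) tensor"

definition left_module ::
  "('k::field, 'h::ring_1) hopf \<Rightarrow> ('k, 'h, 'v::ab_group_add, 'a) yd_scheme \<Rightarrow> bool" where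
  "left_module H V \<longleftrightarrow>
    vspace V \<and> bilinear_on H V V (act V) \<and>
    (\<forall>v\<in>vecs V. act V 1 v = v) \<and>
    (\<forall>g h. \<forall>v\<in>vecs V. act V (g * h) v = act V g (act V h v))"

definition left_comodule ::
  "('k::field, 'h::ring_1) hopf \<Rightarrow> ('k, 'h, 'v::ab_group_add, 'a) yd_scheme \<Rightarrow> bool" where
  "left_comodule H V \<longleftrightarrow>
    vspace V \<and> linear_on V (H \<Otimes> V) (coact V) \<and>
    (\<forall>v\<in>vecs V.
      sweedler H V (coact V v) (\<lambda>a w. sweedler H H (hcomult H a) (\<lambda>a1 a2.
        (a1 \<otimes>\<^bsub>H,H\<^esub> a2) \<otimes>\<^bsub>H \<Otimes> H,V\<^esub> w)) =
      sweedler H V (coact V v) (\<lambda>a w. sweedler H V (coact V w) (\<lambda>b w'.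
        (a \<otimes>\<^bsub>H,H\<^esub> b) \<otimes>\<^bsub>H \<Otimes> H,V\<^esub> w'))) \<and>
    (\<forall>v\<in>vecs V. sweedler H V (coact V v) (\<lambda>a w. scl V (hcounit H a) w) = v)"

definition yd_module ::
  "('k::field, 'h::ring_1) hopf \<Rightarrow> ('k, 'h, 'v::ab_group_add, 'a) yd_scheme \<Rightarrow> bool" where
  "yd_module H V \<longleftrightarrow>
    left_module H V \<and> left_comodule H V \<and>
    (\<forall>h. \<forall>v\<in>vecs V. coact V (act V h v) =
      sweedler H H (hcomult H h) (\<lambda>h1 h'. sweedler H H (hcomult H h') (\<lambda>h2 h3.
        sweedler H V (coact V v) (\<lambda>a w.
          (h1 * a * antipode H h3) \<otimes>\<^bsub>H,V\<^esub> act V h2 w))))"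

definition yd_tensor ::
  "('k::field, 'h::ring_1) hopf \<Rightarrow> ('k, 'h, 'v::ab_group_add, 'a) yd_scheme
    \<Rightarrow> ('k, 'h, 'w::ab_group_add, 'b) yd_scheme \<Rightarrow> ('k, 'h, ('k, 'v, 'w) tensor) yd" where
  "yd_tensor H V W =
    \<lparr>vecs = vecs (V \<Otimes> W), scl = scl (V \<Otimes> W),
     act = (\<lambda>h z. sweedler V W z (\<lambda>v w. sweedler H H (hcomult H h) (\<lambda>h1 h2.
       act V h1 v \<otimes>\<^bsub>V,W\<^esub> act W h2 w))),
     coact = (\<lambda>z. sweedler V W z (\<lambda>v w.
       sweedler H V (coact V v) (\<lambda>a v'. sweedler H W (coact W w) (\<lambda>b w'.
         (a * b) \<otimes>\<^bsub>H,V \<Otimes> W\<^esub> (v' \<otimes>\<^bsub>V,W\<^esub> w')))))\<rparr>"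

text \<open>
  Coalgebras in the category of Yetter-Drinfeld modules: comultiplication and counit are
  \<open>H\<close>-linear and \<open>H\<close>-colinear, the ground field being the trivial Yetter-Drinfeld module.
\<close>

record ('k, 'h, 'v) yd_coalg = "('k, 'h, 'v) yd" +
  comult :: "'v \<Rightarrow> ('k, 'v, 'v) tensor"
  counit :: "'v \<Rightarrow> 'k"

definition yd_coalgebra ::
  "('k::field, 'h::ring_1) hopf \<Rightarrow> ('k, 'h, 'v::ab_group_add) yd_coalg \<Rightarrow> bool" where
  "yd_coalgebra H C \<longleftrightarrow>
    yd_module H C \<and> coalgebra C (comult C) (counit C) \<and>
    (\<forall>h. \<forall>x\<in>vecs C. comult C (act C h x) = act (yd_tensor H C C) h (comult C x)) \<and>
    (\<forall>x\<in>vecs C. coact (yd_tensor H C C) (comult C x) =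
      sweedler H C (coact C x) (\<lambda>a y. a \<otimes>\<^bsub>H,C \<Otimes> C\<^esub> comult C y)) \<and>
    (\<forall>h. \<forall>x\<in>vecs C. counit C (act C h x) = hcounit H h * counit C x) \<and>
    (\<forall>x\<in>vecs C. sweedler H C (coact C x) (\<lambda>a y. scl H (counit C y) a) = scl H (counit C x) 1)"

text \<open>
  The comultiplication of the tensor product coalgebra sends the pure tensor of \<open>x\<close> and \<open>y\<close> to
  \<open>(x1 \<otimes> a y1) \<otimes> (x2' \<otimes> y2)\<close>, where \<open>a \<otimes> x2'\<close> is the coaction of \<open>x2\<close>.
\<close>

definition yd_tensor_coalg ::
  "('k::field, 'h::ring_1) hopf \<Rightarrow> ('k, 'h, 'v::ab_group_add) yd_coalg
    \<Rightarrow> ('k, 'h, 'w::ab_group_add) yd_coalg \<Rightarrow> ('k, 'h, ('k, 'v, 'w) tensor) yd_coalg" where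
  "yd_tensor_coalg H C D =
    \<lparr>vecs = vecs (C \<Otimes> D), scl = scl (C \<Otimes> D),
     act = act (yd_tensor H C D), coact = coact (yd_tensor H C D),
     comult = (\<lambda>z. sweedler C D z (\<lambda>x y.
       sweedler C C (comult C x) (\<lambda>x1 x2. sweedler H C (coact C x2) (\<lambda>a x2'.
         sweedler D D (comult D y) (\<lambda>y1 y2.
           (x1 \<otimes>\<^bsub>C,D\<^esub> act D a y1) \<otimes>\<^bsub>C \<Otimes> D,C \<Otimes> D\<^esub> (x2' \<otimes>\<^bsub>C,D\<^esub> y2)))))),
     counit = (\<lambda>z. sweedler C D z (\<lambda>x y. counit C x * counit D y))\<rparr>"

definition coaugmented ::
  "('k::field, 'h::ring_1) hopf \<Rightarrow> ('k, 'h, 'v::ab_group_add) yd_coalg \<Rightarrow> ('k \<Rightarrow> 'v) \<Rightarrow> bool" where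
  "coaugmented H C u \<longleftrightarrow>
    yd_coalgebra H C \<and> linear_on ground C u \<and>
    comult C (u 1) = u 1 \<otimes>\<^bsub>C,C\<^esub> u 1 \<and> counit C (u 1) = 1 \<and>
    (\<forall>h. act C h (u 1) = scl C (hcounit H h) (u 1)) \<and>
    coact C (u 1) = 1 \<otimes>\<^bsub>H,C\<^esub> u 1"

definition pre_bialgebra ::
  "('k::field, 'h::ring_1) hopf \<Rightarrow> ('k, 'h, 'r::ab_group_add) yd_coalg
    \<Rightarrow> (('k, 'r, 'r) tensor \<Rightarrow> 'r) \<Rightarrow> ('k \<Rightarrow> 'r) \<Rightarrow> bool" where
  "pre_bialgebra H R m u \<longleftrightarrow> (let RR = yd_tensor_coalg H R R in
    coaugmented H R u \<and> linear_on RR R m \<and>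
    (\<forall>h. \<forall>z\<in>vecs RR. m (act RR h z) = act R h (m z)) \<and>
    (\<forall>z\<in>vecs RR. comult R (m z) =
      sweedler RR RR (comult RR z) (\<lambda>z1 z2. m z1 \<otimes>\<^bsub>R,R\<^esub> m z2)) \<and>
    (\<forall>z\<in>vecs RR. counit R (m z) = counit RR z) \<and>
    (\<forall>r\<in>vecs R. m (u 1 \<otimes>\<^bsub>R,R\<^esub> r) = r \<and> m (r \<otimes>\<^bsub>R,R\<^esub> u 1) = r))"

definition pre_bialgebra_with_cocycle ::
  "('k::field, 'h::ring_1) hopf \<Rightarrow> ('k, 'h, 'r::ab_group_add) yd_coalg
    \<Rightarrow> (('k, 'r, 'r) tensor \<Rightarrow> 'r) \<Rightarrow> ('k \<Rightarrow> 'r) \<Rightarrow> (('k, 'r, 'r) tensor \<Rightarrow> 'h) \<Rightarrow> bool" where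
  "pre_bialgebra_with_cocycle H R m u \<xi> \<longleftrightarrow> (let RR = yd_tensor_coalg H R R in
    pre_bialgebra H R m u \<and> linear_on RR H \<xi> \<and>
    (\<forall>z\<in>vecs RR. hcomult H (\<xi> z) =
      sweedler RR RR (comult RR z) (\<lambda>z1 z2. sweedler H RR (coact RR z2) (\<lambda>a z2'.
        (\<xi> z1 * a) \<otimes>\<^bsub>H,H\<^esub> \<xi> z2'))) \<and>
    (\<forall>z\<in>vecs RR. hcounit H (\<xi> z) = counit RR z) \<and>
    (\<forall>h. \<forall>z\<in>vecs RR. \<xi> (act RR h z) =
      sweedler H H (hcomult H h) (\<lambda>h1 h2. h1 * \<xi> z * antipode H h2)) \<and>
    (\<forall>z\<in>vecs RR.
      sweedler RR RR (comult RR z) (\<lambda>z1 z2. sweedler H R (coact R (m z1)) (\<lambda>a r.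
        (a * \<xi> z2) \<otimes>\<^bsub>H,R\<^esub> r)) =
      sweedler RR RR (comult RR z) (\<lambda>z1 z2. sweedler H RR (coact RR z2) (\<lambda>a z2'.
        (\<xi> z1 * a) \<otimes>\<^bsub>H,R\<^esub> m z2'))) \<and>
    (\<forall>r\<in>vecs R. \<forall>s\<in>vecs R. \<forall>t\<in>vecs R.
      m (r \<otimes>\<^bsub>R,R\<^esub> m (s \<otimes>\<^bsub>R,R\<^esub> t)) =
      sweedler RR RR (comult RR (r \<otimes>\<^bsub>R,R\<^esub> s)) (\<lambda>z1 z2.
        m (m z1 \<otimes>\<^bsub>R,R\<^esub> act R (\<xi> z2) t))) \<and>
    (\<forall>r\<in>vecs R. \<forall>s\<in>vecs R. \<forall>t\<in>vecs R.
      sweedler RR RR (comult RR (s \<otimes>\<^bsub>R,R\<^esub> t)) (\<lambda>w1 w2. \<xi> (r \<otimes>\<^bsub>R,R\<^esub> m w1) * \<xi> w2) =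
      sweedler RR RR (comult RR (r \<otimes>\<^bsub>R,R\<^esub> s)) (\<lambda>z1 z2.
        sweedler H H (hcomult H (\<xi> z2)) (\<lambda>a b. \<xi> (m z1 \<otimes>\<^bsub>R,R\<^esub> act R a t) * b))) \<and>
    (\<forall>r\<in>vecs R. \<xi> (r \<otimes>\<^bsub>R,R\<^esub> u 1) = scl H (counit R r) 1 \<and>
                 \<xi> (u 1 \<otimes>\<^bsub>R,R\<^esub> r) = scl H (counit R r) 1))"

definition associative_mult ::
  "('k::field, 'h::ring_1, 'r::ab_group_add) yd_coalg \<Rightarrow> (('k, 'r, 'r) tensor \<Rightarrow> 'r) \<Rightarrow> bool" where
  "associative_mult R m \<longleftrightarrow>
    (\<forall>r\<in>vecs R. \<forall>s\<in>vecs R. \<forall>t\<in>vecs R.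
      m (m (r \<otimes>\<^bsub>R,R\<^esub> s) \<otimes>\<^bsub>R,R\<^esub> t) = m (r \<otimes>\<^bsub>R,R\<^esub> m (s \<otimes>\<^bsub>R,R\<^esub> t)))"

definition Phi ::
  "('k::field, 'h::ring_1) hopf \<Rightarrow> ('k, 'h, 'r::ab_group_add) yd_coalg
    \<Rightarrow> (('k, 'r, 'r) tensor \<Rightarrow> 'h) \<Rightarrow> ('k, ('k, 'r, 'r) tensor, 'r) tensor
    \<Rightarrow> ('k, ('k, 'r, 'r) tensor, 'r) tensor" where
  "Phi H R \<xi> x = (let RR = yd_tensor_coalg H R R in
    sweedler RR R x (\<lambda>z t. sweedler RR RR (comult RR z) (\<lambda>z1 z2.
      z1 \<otimes>\<^bsub>RR,R\<^esub> act R (\<xi> z2) t)))"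

end

theory Submission
  imports Defs
begin

text \<open>
  Write \<open>z1 \<otimes> z2\<close> for the comultiplication of \<open>z\<close>. If \<open>m\<close> is associative, cocycle condition (4)
  says that \<open>g(z) = \<xi>(z)t - \<epsilon>(z)t\<close> satisfies \<open>g(z) = f(m(z1))(g(z2))\<close>, where \<open>f(x)(v) = \<epsilon>(x)v - m(x \<otimes> v)\<close>
  vanishes at \<open>x = 1\<close>. In a connected coalgebra a subspace \<open>Q\<close> is everything as soon as it contains
  every \<open>w\<close> whose comultiplication lies in \<open>1 \<otimes> w + R \<otimes> Q\<close>; this induction principle, applied
  to the two tensor factors of \<open>z\<close> in turn, gives \<open>g = 0\<close>. The remaining implications only use
  that \<open>R \<otimes> R\<close> is counital.
\<close>

section \<open>Linear maps and Sweedler summation\<close>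

text \<open>The function \<open>f\<close> comes from \<open>quasi_assoc\<close>: under associativity
  that identity says that m(m(z1) \<otimes> \<xi>(z2)t) equals m(m(z) \<otimes> t), which is also
  \<epsilon>(z2) m(m(z1) \<otimes> t) by the counit law. Hence m(m(z1) \<otimes> g(z2)) = 0, and
  subtracting this zero from g(z) = \<epsilon>(z1) g(z2) produces \<open>f\<close>, because
  \<epsilon> m = \<epsilon>. Two obstacles shape the proof. The coradical is given by simple
  subcoalgebras and not by a filtration, so the induction principle has to be extracted from simple
  comodules; comodules appear as subspaces stable under functionals, and quotients as functionals
  vanishing on a subspace. Moreover connectedness is given for R and not for R \<otimes> R, whose
  comultiplication lets the first factor act on the second through the coaction. The vanishing of
  g(r \<otimes> s) alone is therefore not inductive. What is propagated is the coaction of r with g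
  applied to its R-part and s, from which the counit of H recovers g(r \<otimes> s).\<close>

named_theorems linear_intros

lemma linear_onI:
  assumes "\<And>x. x \<in> vecs V \<Longrightarrow> f x \<in> vecs W"
    and "\<And>x y. x \<in> vecs V \<Longrightarrow> y \<in> vecs V \<Longrightarrow> f (x + y) = f x + f y"
    and "\<And>c x. x \<in> vecs V \<Longrightarrow> f (scl V c x) = scl W c (f x)"
  shows "linear_on V W f"
  using assms by (auto simp: linear_on_def)

lemma linear_on_mem: "linear_on V W f \<Longrightarrow> x \<in> vecs V \<Longrightarrow> f x \<in> vecs W"
  and linear_on_add: "linear_on V W f \<Longrightarrow> x \<in> vecs V \<Longrightarrow> y \<in> vecs V \<Longrightarrow> f (x + y) = f x + f y"
  and linear_on_scale: "linear_on V W f \<Longrightarrow> x \<in> vecs V \<Longrightarrow> f (scl V c x) = scl W c (f x)"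
  by (auto simp: linear_on_def)

lemma vspace_add: "vspace V \<Longrightarrow> x \<in> vecs V \<Longrightarrow> y \<in> vecs V \<Longrightarrow> x + y \<in> vecs V"
  and vspace_scale: "vspace V \<Longrightarrow> x \<in> vecs V \<Longrightarrow> scl V c x \<in> vecs V"
  and vspace_zero: "vspace V \<Longrightarrow> 0 \<in> vecs V"
proof -
  assume V: "vspace V"
  interpret V: vector_space "scl V" using V by (simp add: vspace_def)
  have "V.subspace (vecs V)" using V by (simp add: vspace_def)
  then show "x \<in> vecs V \<Longrightarrow> y \<in> vecs V \<Longrightarrow> x + y \<in> vecs V"
    "x \<in> vecs V \<Longrightarrow> scl V c x \<in> vecs V" "0 \<in> vecs V"
    by (auto simp: V.subspace_def)
qed

lemma vspace_scale_distribs: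
  assumes "vspace V"
  shows "scl V c (x + y) = scl V c x + scl V c y" "scl V (c + d) x = scl V c x + scl V d x"
    "scl V c (scl V d x) = scl V (c * d) x" "scl V 1 x = x" "scl V 0 x = 0" "scl V c 0 = 0"
    "scl V c (- x) = - scl V c x" "scl V c (x - y) = scl V c x - scl V c y" "scl V (-1) x = - x"
proof -
  interpret V: vector_space "scl V" using assms by (simp add: vspace_def)
  show "scl V c (x + y) = scl V c x + scl V c y" "scl V (c + d) x = scl V c x + scl V d x"
    "scl V c (scl V d x) = scl V (c * d) x" "scl V 1 x = x" "scl V 0 x = 0" "scl V c 0 = 0"
    "scl V c (- x) = - scl V c x" "scl V c (x - y) = scl V c x - scl V c y" "scl V (-1) x = - x"
    by (simp_all add: algebra_simps)
qed

lemma vspace_minus: "vspace V \<Longrightarrow> x \<in> vecs V \<Longrightarrow> - x \<in> vecs V"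
  using vspace_scale[of V x "-1"] by (simp add: vspace_scale_distribs)

lemma vspace_diff: "vspace V \<Longrightarrow> x \<in> vecs V \<Longrightarrow> y \<in> vecs V \<Longrightarrow> x - y \<in> vecs V"
  using vspace_add[of V x "- y"] by (simp add: vspace_minus)

lemma vspace_sum_list: "vspace V \<Longrightarrow> (\<And>x. x \<in> set xs \<Longrightarrow> f x \<in> vecs V) \<Longrightarrow> (\<Sum>x\<leftarrow>xs. f x) \<in> vecs V"
  by (induction xs) (auto simp: vspace_zero vspace_add)

lemma vspace_ground: "vspace (ground :: ('k::field, 'k) space)"
proof -
  interpret vector_space "(*) :: 'k \<Rightarrow> 'k \<Rightarrow> 'k" by unfold_locales (auto simp: algebra_simps)
  show ?thesis by (simp add: vspace_def ground_def vector_space_axioms)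
qed

lemma ground_simps [simp]: "vecs ground = UNIV" "scl ground = (*)"
  by (simp_all add: ground_def)

lemma linear_on_zero: "vspace V \<Longrightarrow> linear_on V W f \<Longrightarrow> f 0 = 0"
  using linear_on_add[of V W f 0 0] by (simp add: vspace_zero)

lemma linear_on_minus: "vspace V \<Longrightarrow> linear_on V W f \<Longrightarrow> x \<in> vecs V \<Longrightarrow> f (- x) = - f x"
  using linear_on_add[of V W f x "- x"]
  by (simp add: vspace_minus linear_on_zero eq_neg_iff_add_eq_0 add.commute)

lemma linear_on_diff:
  "vspace V \<Longrightarrow> linear_on V W f \<Longrightarrow> x \<in> vecs V \<Longrightarrow> y \<in> vecs V \<Longrightarrow> f (x - y) = f x - f y"
  using linear_on_add[of V W f x "- y"] by (simp add: vspace_minus linear_on_minus)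

lemma linear_on_sum_list:
  assumes "vspace V" "linear_on V W f" "\<And>x. x \<in> set xs \<Longrightarrow> g x \<in> vecs V"
  shows "f (\<Sum>x\<leftarrow>xs. g x) = (\<Sum>x\<leftarrow>xs. f (g x))"
  using assms(3)
  by (induction xs) (simp_all add: linear_on_zero[OF assms(1,2)] linear_on_add[OF assms(2)]
      vspace_sum_list[OF assms(1)])

lemma linear_on_compose: "linear_on W U g \<Longrightarrow> linear_on V W f \<Longrightarrow> linear_on V U (\<lambda>x. g (f x))"
  by (rule linear_onI) (auto simp: linear_on_mem linear_on_add linear_on_scale)

lemma linear_on_id [linear_intros]: "linear_on V V (\<lambda>x. x)"
  by (simp add: linear_on_def)

lemma linear_on_plus [linear_intros]:
  "vspace W \<Longrightarrow> linear_on V W f \<Longrightarrow> linear_on V W g \<Longrightarrow> linear_on V W (\<lambda>x. f x + g x)"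
  by (rule linear_onI) (auto simp: linear_on_mem linear_on_add linear_on_scale vspace_add
      vspace_scale_distribs algebra_simps)

lemma linear_on_minus_fun [linear_intros]:
  "vspace W \<Longrightarrow> linear_on V W f \<Longrightarrow> linear_on V W g \<Longrightarrow> linear_on V W (\<lambda>x. f x - g x)"
  by (rule linear_onI) (auto simp: linear_on_mem linear_on_add linear_on_scale vspace_diff
      vspace_scale_distribs algebra_simps)

lemma linear_on_scl_vec [linear_intros]:
  "vspace W \<Longrightarrow> linear_on V W f \<Longrightarrow> linear_on V W (\<lambda>x. scl W c (f x))"
  by (rule linear_onI) (auto simp: linear_on_mem linear_on_add linear_on_scale vspace_scale
      vspace_scale_distribs algebra_simps)

lemma linear_on_scl_scalar [linear_intros]:
  "vspace W \<Longrightarrow> w \<in> vecs W \<Longrightarrow> linear_on V ground f \<Longrightarrow> linear_on V W (\<lambda>x. scl W (f x) w)"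
  by (rule linear_onI) (auto simp: linear_on_add linear_on_scale vspace_scale
      vspace_scale_distribs algebra_simps)

lemma linear_on_times_left [linear_intros]:
  "linear_on V ground f \<Longrightarrow> linear_on V ground (\<lambda>x. f x * c)"
  by (rule linear_onI) (auto simp: linear_on_add linear_on_scale algebra_simps)

lemma linear_on_times_right [linear_intros]:
  "linear_on V ground f \<Longrightarrow> linear_on V ground (\<lambda>x. c * f x)"
  by (rule linear_onI) (auto simp: linear_on_add linear_on_scale algebra_simps)

lemma bilinear_onI [linear_intros]:
  assumes "\<And>v. v \<in> vecs V \<Longrightarrow> linear_on W U (\<lambda>w. f v w)"
    and "\<And>w. w \<in> vecs W \<Longrightarrow> linear_on V U (\<lambda>v. f v w)"
  shows "bilinear_on V W U f"
  using assms by (auto simp: bilinear_on_def)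

text \<open>The inner linear map \<open>g\<close> is part of the statement so that repeated
  resolution descends through a nested expression to the place of the variable.\<close>

lemma bilinear_on_left:
  "bilinear_on V W U f \<Longrightarrow> w \<in> vecs W \<Longrightarrow> linear_on X V g \<Longrightarrow> linear_on X U (\<lambda>x. f (g x) w)"
  using linear_on_compose[of V U "\<lambda>v. f v w" X g] by (simp add: bilinear_on_def)

lemma bilinear_on_right:
  "bilinear_on V W U f \<Longrightarrow> v \<in> vecs V \<Longrightarrow> linear_on X W g \<Longrightarrow> linear_on X U (\<lambda>x. f v (g x))"
  using linear_on_compose[of W U "f v" X g] by (simp add: bilinear_on_def)

lemma bilinear_on_mem:
  "bilinear_on V W U f \<Longrightarrow> v \<in> vecs V \<Longrightarrow> w \<in> vecs W \<Longrightarrow> f v w \<in> vecs U"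
  by (auto simp: bilinear_on_def intro: linear_on_mem)

lemma bilinear_on_zero_right:
  "bilinear_on V W U f \<Longrightarrow> vspace W \<Longrightarrow> v \<in> vecs V \<Longrightarrow> f v 0 = 0"
  using linear_on_zero[of W U "f v"] by (simp add: bilinear_on_def)

lemmas linear_on_pure_left [linear_intros] = bilinear_on_left[OF bilinear_on_pure]
lemmas linear_on_pure_right [linear_intros] = bilinear_on_right[OF bilinear_on_pure]

section \<open>Calculus of Sweedler sums\<close>

lemma tensor_rep:
  assumes "vspace V" "x \<in> vecs (V \<Otimes> W)"
  shows "set (tensor_rep V W x) \<subseteq> vecs V \<times> vecs W"
    and "x = (\<Sum>(v, w)\<leftarrow>tensor_rep V W x. v \<otimes>\<^bsub>V,W\<^esub> w)"
  using someI_ex[OF tensor_rep_exists[OF assms]] unfolding tensor_rep_def by auto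

lemma sweedler_alt: "sweedler V W x f = (\<Sum>p\<leftarrow>tensor_rep V W x. f (fst p) (snd p))"
  by (simp add: sweedler_def case_prod_unfold)

lemma sweedler_pure:
  assumes "vspace V" "vspace U" "bilinear_on V W U f" "v \<in> vecs V" "w \<in> vecs W"
  shows "sweedler V W (v \<otimes>\<^bsub>V,W\<^esub> w) f = f v w"
  using sweedler_sum_list[OF assms(1-3), of "[(v, w)]"] assms(4,5) by simp

lemma sweedler_mem:
  assumes "vspace V" "vspace U" "x \<in> vecs (V \<Otimes> W)"
    and "\<And>v w. v \<in> vecs V \<Longrightarrow> w \<in> vecs W \<Longrightarrow> f v w \<in> vecs U"
  shows "sweedler V W x f \<in> vecs U"
  unfolding sweedler_def using tensor_rep(1)[OF assms(1,3)] assms(4)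
  by (intro vspace_sum_list[OF assms(2)]) auto

lemma sweedler_cong:
  assumes "vspace V" "x \<in> vecs (V \<Otimes> W)"
    and "\<And>v w. v \<in> vecs V \<Longrightarrow> w \<in> vecs W \<Longrightarrow> f v w = g v w"
  shows "sweedler V W x f = sweedler V W x g"
  unfolding sweedler_def using tensor_rep(1)[OF assms(1,2)] assms(3)
  by (intro arg_cong[of _ _ sum_list] map_cong) auto

lemma sweedler_pure_id: "vspace V \<Longrightarrow> x \<in> vecs (V \<Otimes> W) \<Longrightarrow> sweedler V W x (pure V W) = x"
  unfolding sweedler_def using tensor_rep(2)[of V x W] by (simp add: case_prod_beta)

text \<open>The representation chosen for a multiple of \<open>x\<close> is unrelated to the one
  chosen for \<open>x\<close>. By \<open>sweedler_sum_list\<close> it may be replaced by the list in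
  which the scalar is absorbed into the left factors.\<close>

lemma sweedler_scale:
  assumes "vspace V" "vspace U" "bilinear_on V W U f" "x \<in> vecs (V \<Otimes> W)"
  shows "sweedler V W (tensor_scale c x) f = scl U c (sweedler V W x f)"
proof -
  define ps where "ps = tensor_rep V W x"
  have ps: "set ps \<subseteq> vecs V \<times> vecs W" "x = (\<Sum>(v, w)\<leftarrow>ps. v \<otimes>\<^bsub>V,W\<^esub> w)"
    using tensor_rep[OF assms(1,4)] by (simp_all add: ps_def)
  define qs where "qs = map (\<lambda>(v, w). (scl V c v, w)) ps"
  have qs: "set qs \<subseteq> vecs V \<times> vecs W"
    using ps(1) by (auto simp: qs_def vspace_scale[OF assms(1)])
  have "tensor_scale c x = (\<Sum>(v, w)\<leftarrow>ps. tensor_scale c (v \<otimes>\<^bsub>V,W\<^esub> w))"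
    unfolding ps(2) by (induction ps) (auto simp: tensor_scale_def fun_eq_iff algebra_simps)
  also have "\<dots> = (\<Sum>(v, w)\<leftarrow>qs. v \<otimes>\<^bsub>V,W\<^esub> w)"
    using ps(1) bilinear_on_pure[of V W]
    by (auto simp: qs_def o_def case_prod_beta bilinear_on_def linear_on_def tensor_space_def
        intro!: arg_cong[of _ _ sum_list] map_cong)
  finally have "sweedler V W (tensor_scale c x) f = (\<Sum>(v, w)\<leftarrow>qs. f v w)"
    using sweedler_sum_list[OF assms(1-3) qs] by simp
  also have "\<dots> = (\<Sum>(v, w)\<leftarrow>ps. scl U c (f v w))"
    using ps(1) assms(3)
    by (auto simp: qs_def o_def case_prod_beta bilinear_on_def linear_on_def
        intro!: arg_cong[of _ _ sum_list] map_cong)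
  also have "\<dots> = scl U c (\<Sum>(v, w)\<leftarrow>ps. f v w)"
    by (induction ps) (auto simp: vspace_scale_distribs[OF assms(2)])
  finally show ?thesis by (simp add: sweedler_def ps_def)
qed

lemma sweedler_add:
  assumes "vspace V" "vspace U" "bilinear_on V W U f" "x \<in> vecs (V \<Otimes> W)" "y \<in> vecs (V \<Otimes> W)"
  shows "sweedler V W (x + y) f = sweedler V W x f + sweedler V W y f"
proof -
  define ps where "ps = tensor_rep V W x @ tensor_rep V W y"
  have ps: "set ps \<subseteq> vecs V \<times> vecs W" "x + y = (\<Sum>(v, w)\<leftarrow>ps. v \<otimes>\<^bsub>V,W\<^esub> w)"
    using tensor_rep[OF assms(1,4)] tensor_rep[OF assms(1,5)] by (simp_all add: ps_def)
  show ?thesis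
    unfolding ps(2) sweedler_sum_list[OF assms(1-3) ps(1)] by (simp add: ps_def sweedler_def)
qed

text \<open>Together with \<open>linear_on_sweedler_fun\<close> this covers the two places where a
  variable can occur: here the tensor that is summed over, there the summand. Only here does the
  chosen representation change, so only here must the summand be bilinear.\<close>

lemma linear_on_sweedler_tensor [linear_intros]:
  assumes "linear_on X (V \<Otimes> W) g" "vspace V" "vspace U" "bilinear_on V W U f"
  shows "linear_on X U (\<lambda>x. sweedler V W (g x) f)"
proof (rule linear_on_compose[OF _ assms(1), where g = "\<lambda>x. sweedler V W x f"], rule linear_onI)
  show "sweedler V W x f \<in> vecs U" if "x \<in> vecs (V \<Otimes> W)" for x
    using sweedler_mem[OF assms(2,3) that, of f] bilinear_on_mem[OF assms(4)] by blast
  show "sweedler V W (scl (V \<Otimes> W) c x) f = scl U c (sweedler V W x f)" if "x \<in> vecs (V \<Otimes> W)" for c x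
    using sweedler_scale[OF assms(2-4) that] by (simp add: tensor_space_def)
qed (simp add: sweedler_add[OF assms(2-4)])

lemma linear_on_sum_list_fun:
  assumes "vspace U" "\<And>p. p \<in> set ps \<Longrightarrow> linear_on X U (\<lambda>x. f x p)"
  shows "linear_on X U (\<lambda>x. \<Sum>p\<leftarrow>ps. f x p)"
  using assms(2)
proof (induction ps)
  case Nil
  show ?case by (rule linear_onI) (auto simp: vspace_zero[OF assms(1)] vspace_scale_distribs[OF assms(1)])
next
  case (Cons p ps)
  have "linear_on X U (\<lambda>x. f x p + (\<Sum>p\<leftarrow>ps. f x p))"
    using Cons by (intro linear_on_plus[OF assms(1)]) auto
  then show ?case by simp
qed

lemma linear_on_sweedler_fun [linear_intros]:
  assumes "y \<in> vecs (V \<Otimes> W)" "vspace V" "vspace U"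
    and "\<And>v w. v \<in> vecs V \<Longrightarrow> w \<in> vecs W \<Longrightarrow> linear_on X U (\<lambda>x. f x v w)"
  shows "linear_on X U (\<lambda>x. sweedler V W y (f x))"
proof -
  have "linear_on X U (\<lambda>x. \<Sum>p\<leftarrow>tensor_rep V W y. f x (fst p) (snd p))"
    using tensor_rep(1)[OF assms(2,1)] assms(4) by (intro linear_on_sum_list_fun[OF assms(3)]) auto
  then show ?thesis by (simp add: sweedler_alt)
qed

lemma sweedler_push:
  assumes "vspace V" "vspace U" "linear_on U X g" "x \<in> vecs (V \<Otimes> W)"
    and "\<And>v w. v \<in> vecs V \<Longrightarrow> w \<in> vecs W \<Longrightarrow> f v w \<in> vecs U"
  shows "g (sweedler V W x f) = sweedler V W x (\<lambda>v w. g (f v w))"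
proof -
  have "g (\<Sum>p\<leftarrow>tensor_rep V W x. f (fst p) (snd p)) = (\<Sum>p\<leftarrow>tensor_rep V W x. g (f (fst p) (snd p)))"
    using tensor_rep(1)[OF assms(1,4)] assms(5) by (intro linear_on_sum_list[OF assms(2,3)]) auto
  then show ?thesis by (simp add: sweedler_alt)
qed

lemma sum_list_swap:
  fixes F :: "'a \<Rightarrow> 'b \<Rightarrow> 'c::comm_monoid_add"
  shows "(\<Sum>p\<leftarrow>ps. \<Sum>q\<leftarrow>qs. F p q) = (\<Sum>q\<leftarrow>qs. \<Sum>p\<leftarrow>ps. F p q)"
  by (induction ps) (auto simp: sum_list_addf)

lemma sweedler_swap:
  "sweedler V W x (\<lambda>v w. sweedler V' W' y (\<lambda>v' w'. f v w v' w'))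
    = sweedler V' W' y (\<lambda>v' w'. sweedler V W x (\<lambda>v w. f v w v' w'))"
  unfolding sweedler_alt by (rule sum_list_swap)

lemma sweedler_plus_fun:
  "sweedler V W x (\<lambda>v w. f v w + g v w) = sweedler V W x f + sweedler V W x g"
  by (simp add: sweedler_alt sum_list_addf)

lemma sweedler_diff_fun:
  "sweedler V W x (\<lambda>v w. f v w - g v w) = sweedler V W x f - sweedler V W x g"
  by (simp add: sweedler_alt sum_list_subtractf)

lemma sweedler_zero_fun: "sweedler V W x (\<lambda>v w. 0) = 0"
  by (simp add: sweedler_alt)

text \<open>Nested sums are flattened with this rule, after which \<open>sweedler_pure\<close>
  evaluates the innermost pure tensor. It is \<open>sweedler_push\<close> for summation against a
  fixed \<open>f\<close>.\<close>

lemma sweedler_sweedler: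
  assumes "vspace A" "vspace V" "vspace U" "bilinear_on V W U f" "x \<in> vecs (A \<Otimes> B)"
    and "\<And>a b. a \<in> vecs A \<Longrightarrow> b \<in> vecs B \<Longrightarrow> p a b \<in> vecs (V \<Otimes> W)"
  shows "sweedler V W (sweedler A B x p) f = sweedler A B x (\<lambda>a b. sweedler V W (p a b) f)"
  by (rule sweedler_push[OF assms(1) vspace_tensor_space linear_on_sweedler_tensor assms(5,6)])
     (auto intro: linear_intros assms)

lemma tensor_linear_ext:
  assumes "vspace V" "linear_on (V \<Otimes> W) U f" "linear_on (V \<Otimes> W) U g"
    and "\<And>v w. v \<in> vecs V \<Longrightarrow> w \<in> vecs W \<Longrightarrow> f (v \<otimes>\<^bsub>V,W\<^esub> w) = g (v \<otimes>\<^bsub>V,W\<^esub> w)"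
    and x: "x \<in> vecs (V \<Otimes> W)"
  shows "f x = g x"
proof -
  have "f x = sweedler V W x (\<lambda>v w. f (v \<otimes>\<^bsub>V,W\<^esub> w))" "g x = sweedler V W x (\<lambda>v w. g (v \<otimes>\<^bsub>V,W\<^esub> w))"
    using sweedler_push[OF assms(1) vspace_tensor_space assms(2) x, of "pure V W"]
      sweedler_push[OF assms(1) vspace_tensor_space assms(3) x, of "pure V W"]
    by (simp_all add: sweedler_pure_id[OF assms(1) x] pure_in_tensor_space)
  then show ?thesis
    using sweedler_cong[OF assms(1) x, of "\<lambda>v w. f (v \<otimes>\<^bsub>V,W\<^esub> w)"] assms(4) by metis
qed

text \<open>The record \<open>yd_tensor_coalg H R R\<close> and the space
  \<open>R \<Otimes> R\<close> have the same vectors and scalars but different types. Tensors and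
  Sweedler sums inspect nothing else, so this lemma and its three successors let the two be
  exchanged.\<close>

lemma bilinear_on_space_cong:
  assumes "vecs V = vecs V'" "scl V = scl V'" "vecs W = vecs W'" "scl W = scl W'"
    "vecs U = vecs U'" "scl U = scl U'"
  shows "bilinear_on V W U = bilinear_on V' W' U'"
  using assms by (auto simp: bilinear_on_def linear_on_def fun_eq_iff)

lemma pure_space_cong:
  assumes "vecs V = vecs V'" "scl V = scl V'" "vecs W = vecs W'" "scl W = scl W'"
  shows "pure V W = pure V' W'"
  using bilinear_on_space_cong[OF assms refl refl, of ground] by (auto simp: pure_def fun_eq_iff)

lemma sweedler_space_cong:
  assumes "vecs V = vecs V'" "scl V = scl V'" "vecs W = vecs W'" "scl W = scl W'"
  shows "sweedler V W = sweedler V' W'"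
  unfolding sweedler_def[abs_def] tensor_rep_def pure_space_cong[OF assms] assms(1,3) ..

lemma tensor_space_cong:
  assumes "vecs V = vecs V'" "scl V = scl V'" "vecs W = vecs W'" "scl W = scl W'"
  shows "V \<Otimes> W = V' \<Otimes> W'"
  using pure_space_cong[OF assms] assms by (simp add: tensor_space_def)

section \<open>Reduced representations of tensors\<close>

lemma linear_on_sum:
  assumes "vspace V" "linear_on V W f" "finite J" "\<And>j. j \<in> J \<Longrightarrow> g j \<in> vecs V"
  shows "f (\<Sum>j\<in>J. g j) = (\<Sum>j\<in>J. f (g j))"
proof -
  interpret V: vector_space "scl V" using assms(1) by (simp add: vspace_def)
  have sub: "V.subspace (vecs V)" using assms(1) by (simp add: vspace_def)
  show ?thesis using assms(3,4)
    by (induction J rule: finite_induct)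
      (simp_all add: linear_on_zero[OF assms(1,2)] linear_on_add[OF assms(2)] V.subspace_sum[OF sub])
qed

lemma sweedler_sum_pure:
  assumes "vspace V" "vspace U" "bilinear_on V W U f" "finite J"
    and "\<And>j. j \<in> J \<Longrightarrow> a j \<in> vecs V" "\<And>j. j \<in> J \<Longrightarrow> b j \<in> vecs W"
  shows "sweedler V W (\<Sum>j\<in>J. a j \<otimes>\<^bsub>V,W\<^esub> b j) f = (\<Sum>j\<in>J. f (a j) (b j))"
  by (simp add: linear_on_sum[OF vspace_tensor_space linear_on_sweedler_tensor[OF linear_on_id assms(1-3)] assms(4)]
      pure_in_tensor_space assms(5,6) sweedler_pure[OF assms(1-3)])

text \<open>As \<open>f\<close> is linear only on the carrier of \<open>V\<close>, the induction
  over the span has to carry membership in \<open>vecs V\<close> along.\<close>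

lemma linear_on_span:
  assumes "vspace V" "vspace W" "linear_on V W f" "G \<subseteq> vecs V"
    and "module.subspace (scl W) S" "f ` G \<subseteq> S" "x \<in> module.span (scl V) G"
  shows "f x \<in> S"
proof -
  interpret V: vector_space "scl V" using assms(1) by (simp add: vspace_def)
  interpret W: vector_space "scl W" using assms(2) by (simp add: vspace_def)
  have "f x \<in> S \<and> x \<in> vecs V"
    using assms(7)
  proof (induction rule: V.span_induct_alt)
    case base
    show ?case
      using W.subspace_0[OF assms(5)] by (simp add: linear_on_zero[OF assms(1,3)] vspace_zero[OF assms(1)])
  next
    case (step c x y)
    then have x: "x \<in> vecs V" "f x \<in> S" and y: "y \<in> vecs V" "f y \<in> S" using assms(4,6) by auto
    then have "f (scl V c x + y) = scl W c (f x) + f y"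
      by (simp add: linear_on_add[OF assms(3)] linear_on_scale[OF assms(3)] vspace_scale[OF assms(1)])
    then show ?case
      using x y W.subspace_add[OF assms(5) W.subspace_scale[OF assms(5)]]
      by (simp add: vspace_scale[OF assms(1)] vspace_add[OF assms(1)])
  qed
  then show ?thesis by simp
qed

text \<open>A basis of \<open>S\<close> stays independent when \<open>v\<close> is added, so values
  on it can be prescribed. The functionals obtained stand in for functionals on the quotient by
  \<open>S\<close>.\<close>

lemma separating_functional:
  assumes "vspace V" "module.subspace (scl V) S" "v \<notin> S"
  obtains \<phi> where "linear_on V ground \<phi>" "\<And>x. x \<in> S \<Longrightarrow> \<phi> x = 0" "\<phi> v = 1"
proof -
  interpret V: vector_space "scl V" using assms(1) by (simp add: vspace_def)
  interpret P: vector_space_pair "scl V" "(*) :: 'a \<Rightarrow> 'a \<Rightarrow> 'a"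
    by unfold_locales (auto simp: algebra_simps)
  obtain B where B: "B \<subseteq> S" "V.independent B" "S \<subseteq> V.span B"
    using V.maximal_independent_subset[of S] by metis
  have "V.span B \<subseteq> S" using B(1) assms(2) by (rule V.span_minimal)
  then have v: "v \<notin> V.span B" using assms(3) by auto
  then have "V.independent (insert v B)" using B(2) by (simp add: V.independent_insert)
  from P.linear_independent_extend[OF this, of "\<lambda>x. if x = v then 1 else 0"] obtain \<phi>
    where \<phi>: "Vector_Spaces.linear (scl V) (*) \<phi>" "\<forall>x\<in>insert v B. \<phi> x = (if x = v then 1 else 0)" by auto
  interpret \<phi>: Vector_Spaces.linear "scl V" "(*)" \<phi> by (rule \<phi>)
  have "\<phi> x = 0" if "x \<in> S" for x
  proof (rule P.linear_eq_0_on_span[OF \<phi>(1)])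
    show "x \<in> V.span B" using that B(3) by auto
    show "\<phi> b = 0" if "b \<in> B" for b using that \<phi>(2) v V.span_base[of v B] by auto
  qed
  moreover have "linear_on V ground \<phi>"
    by (rule linear_onI) (auto simp: \<phi>.add \<phi>.scale)
  ultimately show ?thesis using \<phi>(2) that by auto
qed

text \<open>Coefficients are indexed by \<open>J\<close> and not by the image, because
  \<open>a\<close> may repeat a vector.\<close>

lemma span_image_finite:
  assumes "vector_space s" "finite J" "y \<in> module.span s (a ` J)"
  shows "\<exists>c. y = (\<Sum>j\<in>J. s (c j) (a j))"
proof -
  interpret vector_space s by (rule assms(1))
  show ?thesis using assms(3)
  proof (induction rule: span_induct_alt)
    case base
    show ?case by (rule exI[of _ "\<lambda>_. 0"]) simp
  next
    case (step r x y)
    then obtain j c where j: "j \<in> J" "x = a j" and c: "y = (\<Sum>j\<in>J. s (c j) (a j))" by auto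
    have "(\<Sum>i\<in>J. s ((c(j := c j + r)) i) (a i)) = s r (a j) + (\<Sum>i\<in>J. s (c i) (a i))"
      using assms(2) j(1) by (simp add: sum.remove[of J j] scale_left_distrib add_ac)
    then show ?case using j c by metis
  qed
qed

text \<open>In a representation with the fewest terms the left factors are independent, and so are
  the right ones, since a linear relation would absorb one term into the others. Independence
  supplies the dual families \<open>\<alpha>\<close> and \<open>\<beta>\<close>, which read off
  single factors from \<open>x\<close>.\<close>

lemma tensor_reduced_rep:
  assumes V: "vspace V" and W: "vspace W" and x: "x \<in> vecs (V \<Otimes> W)"
  obtains J :: "nat set" and a b \<alpha> \<beta>
  where "finite J" "\<And>j. j \<in> J \<Longrightarrow> a j \<in> vecs V" "\<And>j. j \<in> J \<Longrightarrow> b j \<in> vecs W"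
    "\<And>j. j \<in> J \<Longrightarrow> linear_on V ground (\<alpha> j)" "\<And>j. j \<in> J \<Longrightarrow> linear_on W ground (\<beta> j)"
    "\<And>i j. i \<in> J \<Longrightarrow> j \<in> J \<Longrightarrow> \<alpha> i (a j) = (if i = j then 1 else 0)"
    "\<And>i j. i \<in> J \<Longrightarrow> j \<in> J \<Longrightarrow> \<beta> i (b j) = (if i = j then 1 else 0)"
    "x = (\<Sum>j\<in>J. a j \<otimes>\<^bsub>V,W\<^esub> b j)"
proof -
  interpret V: vector_space "scl V" using V by (simp add: vspace_def)
  interpret W: vector_space "scl W" using W by (simp add: vspace_def)
  \<comment> \<open>Any finite index set is allowed, so that deleting an index contradicts
    minimality without renumbering.\<close>
  define P where "P n \<longleftrightarrow> (\<exists>(J :: nat set) a b. finite J \<and> card J = n \<and> (\<forall>j\<in>J. a j \<in> vecs V \<and> b j \<in> vecs W)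
    \<and> x = (\<Sum>j\<in>J. a j \<otimes>\<^bsub>V,W\<^esub> b j))" for n
  have mem: "fst (tensor_rep V W x ! j) \<in> vecs V" "snd (tensor_rep V W x ! j) \<in> vecs W"
    if "j < length (tensor_rep V W x)" for j
    using subsetD[OF tensor_rep(1)[OF V x] nth_mem[OF that]] by auto
  have "P (length (tensor_rep V W x))"
    unfolding P_def
    using tensor_rep[OF V x]
    by (intro exI[of _ "{0..<length (tensor_rep V W x)}"] exI[of _ "\<lambda>i. fst (tensor_rep V W x ! i)"]
        exI[of _ "\<lambda>i. snd (tensor_rep V W x ! i)"])
      (auto simp: case_prod_beta sum_list_sum_nth intro: mem)
  then have "P (LEAST n. P n)" by (rule LeastI)
  then obtain J :: "nat set" and a b
    where J: "finite J" "card J = (LEAST n. P n)"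
      and ab: "\<And>j. j \<in> J \<Longrightarrow> a j \<in> vecs V" "\<And>j. j \<in> J \<Longrightarrow> b j \<in> vecs W"
      and xs: "x = (\<Sum>j\<in>J. a j \<otimes>\<^bsub>V,W\<^esub> b j)"
    unfolding P_def by auto
  have min: False
    if k: "k \<in> J" and ab': "\<And>j. j \<in> J - {k} \<Longrightarrow> a' j \<in> vecs V" "\<And>j. j \<in> J - {k} \<Longrightarrow> b' j \<in> vecs W"
      and x': "x = (\<Sum>j\<in>J - {k}. a' j \<otimes>\<^bsub>V,W\<^esub> b' j)" for k a' b'
  proof -
    have "P (card (J - {k}))"
      unfolding P_def using J(1) ab' x' by (intro exI[of _ "J - {k}"] exI[of _ a'] exI[of _ b']) auto
    then have "card J \<le> card (J - {k})" unfolding J(2) by (rule Least_le)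
    then show False using k J(1) by (metis card_Diff1_less leD)
  qed
  note pl = linear_on_pure_left[OF _ linear_on_id] and pr = linear_on_pure_right[OF _ linear_on_id]
  have scl_T: "scl (V \<Otimes> W) = tensor_scale" by (simp add: tensor_space_def)
  have pure_sum_left: "(\<Sum>j\<in>I. scl V (c j) (p j)) \<otimes>\<^bsub>V,W\<^esub> w = (\<Sum>j\<in>I. scl V (c j) (p j) \<otimes>\<^bsub>V,W\<^esub> w)"
    if "finite I" "w \<in> vecs W" "\<And>j. j \<in> I \<Longrightarrow> p j \<in> vecs V" for I :: "nat set" and c p w
    using that by (intro linear_on_sum[OF V pl]) (auto intro: vspace_scale[OF V])
  have pure_sum_right: "v \<otimes>\<^bsub>V,W\<^esub> (\<Sum>j\<in>I. scl W (c j) (p j)) = (\<Sum>j\<in>I. v \<otimes>\<^bsub>V,W\<^esub> scl W (c j) (p j))"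
    if "finite I" "v \<in> vecs V" "\<And>j. j \<in> I \<Longrightarrow> p j \<in> vecs W" for I :: "nat set" and c p v
    using that by (intro linear_on_sum[OF W pr]) (auto intro: vspace_scale[OF W])
  have move: "scl V c v \<otimes>\<^bsub>V,W\<^esub> w = v \<otimes>\<^bsub>V,W\<^esub> scl W c w" if "v \<in> vecs V" "w \<in> vecs W" for c v w
    using linear_on_scale[OF pl[OF that(2)] that(1)] linear_on_scale[OF pr[OF that(1)] that(2)] by metis
  have indep_a: "a k \<notin> V.span (a ` (J - {k}))" if k: "k \<in> J" for k
  proof
    assume "a k \<in> V.span (a ` (J - {k}))"
    then obtain c where c: "a k = (\<Sum>j\<in>J - {k}. scl V (c j) (a j))"
      using span_image_finite[OF V.vector_space_axioms, of "J - {k}" "a k" a] J(1) by auto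
    show False
    proof (rule min[OF k, of a "\<lambda>j. b j + scl W (c j) (b k)"])
      have "x = a k \<otimes>\<^bsub>V,W\<^esub> b k + (\<Sum>j\<in>J - {k}. a j \<otimes>\<^bsub>V,W\<^esub> b j)"
        unfolding xs using J(1) k by (rule sum.remove)
      \<comment> \<open>Substituting the relation for \<open>a k\<close> spreads its term over the
        remaining ones and changes only their right factors.\<close>
      also have "a k \<otimes>\<^bsub>V,W\<^esub> b k = (\<Sum>j\<in>J - {k}. a j \<otimes>\<^bsub>V,W\<^esub> scl W (c j) (b k))"
        by (subst c, subst pure_sum_left) (use J(1) ab k in \<open>auto intro!: sum.cong move\<close>)
      also have "\<dots> + (\<Sum>j\<in>J - {k}. a j \<otimes>\<^bsub>V,W\<^esub> b j) = (\<Sum>j\<in>J - {k}. a j \<otimes>\<^bsub>V,W\<^esub> (b j + scl W (c j) (b k)))"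
        unfolding sum.distrib[symmetric] using ab k
        by (intro sum.cong) (auto simp: linear_on_add[OF pr] vspace_scale[OF W] add_ac)
      finally show "x = (\<Sum>j\<in>J - {k}. a j \<otimes>\<^bsub>V,W\<^esub> (b j + scl W (c j) (b k)))" .
    qed (use ab k in \<open>auto intro: vspace_add[OF W] vspace_scale[OF W]\<close>)
  qed
  have indep_b: "b k \<notin> W.span (b ` (J - {k}))" if k: "k \<in> J" for k
  proof
    assume "b k \<in> W.span (b ` (J - {k}))"
    then obtain c where c: "b k = (\<Sum>j\<in>J - {k}. scl W (c j) (b j))"
      using span_image_finite[OF W.vector_space_axioms, of "J - {k}" "b k" b] J(1) by auto
    show False
    proof (rule min[OF k, of "\<lambda>j. a j + scl V (c j) (a k)" b])
      have "x = a k \<otimes>\<^bsub>V,W\<^esub> b k + (\<Sum>j\<in>J - {k}. a j \<otimes>\<^bsub>V,W\<^esub> b j)"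
        unfolding xs using J(1) k by (rule sum.remove)
      also have "a k \<otimes>\<^bsub>V,W\<^esub> b k = (\<Sum>j\<in>J - {k}. scl V (c j) (a k) \<otimes>\<^bsub>V,W\<^esub> b j)"
        by (subst c, subst pure_sum_right) (use J(1) ab k in \<open>auto intro!: sum.cong move[symmetric]\<close>)
      also have "\<dots> + (\<Sum>j\<in>J - {k}. a j \<otimes>\<^bsub>V,W\<^esub> b j) = (\<Sum>j\<in>J - {k}. (a j + scl V (c j) (a k)) \<otimes>\<^bsub>V,W\<^esub> b j)"
        unfolding sum.distrib[symmetric] using ab k
        by (intro sum.cong) (auto simp: linear_on_add[OF pl] vspace_scale[OF V] add_ac)
      finally show "x = (\<Sum>j\<in>J - {k}. (a j + scl V (c j) (a k)) \<otimes>\<^bsub>V,W\<^esub> b j)" .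
    qed (use ab k in \<open>auto intro: vspace_add[OF V] vspace_scale[OF V]\<close>)
  qed
  have "\<forall>k\<in>J. \<exists>\<phi>. linear_on V ground \<phi> \<and> (\<forall>j\<in>J. \<phi> (a j) = (if k = j then 1 else 0))"
  proof
    fix k assume "k \<in> J"
    obtain \<phi> where "linear_on V ground \<phi>" "\<And>v. v \<in> V.span (a ` (J - {k})) \<Longrightarrow> \<phi> v = 0" "\<phi> (a k) = 1"
      using separating_functional[OF V V.subspace_span indep_a[OF \<open>k \<in> J\<close>]] by metis
    then show "\<exists>\<phi>. linear_on V ground \<phi> \<and> (\<forall>j\<in>J. \<phi> (a j) = (if k = j then 1 else 0))"
      by (intro exI[of _ \<phi>]) (auto intro: V.span_base)
  qed
  then obtain \<alpha> where \<alpha>: "\<forall>k\<in>J. linear_on V ground (\<alpha> k) \<and> (\<forall>j\<in>J. \<alpha> k (a j) = (if k = j then 1 else 0))"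
    unfolding bchoice_iff by auto
  have "\<forall>k\<in>J. \<exists>\<phi>. linear_on W ground \<phi> \<and> (\<forall>j\<in>J. \<phi> (b j) = (if k = j then 1 else 0))"
  proof
    fix k assume "k \<in> J"
    obtain \<phi> where "linear_on W ground \<phi>" "\<And>v. v \<in> W.span (b ` (J - {k})) \<Longrightarrow> \<phi> v = 0" "\<phi> (b k) = 1"
      using separating_functional[OF W W.subspace_span indep_b[OF \<open>k \<in> J\<close>]] by metis
    then show "\<exists>\<phi>. linear_on W ground \<phi> \<and> (\<forall>j\<in>J. \<phi> (b j) = (if k = j then 1 else 0))"
      by (intro exI[of _ \<phi>]) (auto intro: W.span_base)
  qed
  then obtain \<beta> where \<beta>: "\<forall>k\<in>J. linear_on W ground (\<beta> k) \<and> (\<forall>j\<in>J. \<beta> k (b j) = (if k = j then 1 else 0))"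
    unfolding bchoice_iff by auto
  show ?thesis
    using that[of J a b \<alpha> \<beta>] J(1) ab \<alpha> \<beta> xs by auto
qed

text \<open>A basis of \<open>U\<close> enlarged by a vector of \<open>W\<close> outside
  \<open>U\<close> would be independent and too large. The finite \<open>F\<close> forces bases to
  be finite, so that \<open>dim\<close>, a cardinality that is 0 for infinite sets, really measures
  size.\<close>

lemma subspace_eq_of_dim_le:
  assumes "vector_space s" "finite F" "W \<subseteq> module.span s F"
    and "module.subspace s U" "U \<subseteq> W" "vector_space.dim s W \<le> vector_space.dim s U"
  shows "U = W"
proof (rule ccontr)
  interpret vector_space s by (rule assms(1))
  assume "U \<noteq> W"
  then obtain w where w: "w \<in> W" "w \<notin> U" using assms(5) by auto
  obtain B where B: "B \<subseteq> U" "independent B" "U \<subseteq> span B" "card B = dim U"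
    using basis_exists[of U] by metis
  have "span B \<subseteq> U" using B(1) assms(4) by (rule span_minimal)
  then have "independent (insert w B)" using w B(2) by (auto simp: independent_insert)
  then obtain B' where B': "insert w B \<subseteq> B'" "B' \<subseteq> W" "independent B'" "W \<subseteq> span B'"
    using maximal_independent_subset_extend[of "insert w B" W] B(1) assms(5) w(1) by auto
  have "finite B'" using independent_span_bound[OF assms(2) B'(3)] B'(2) assms(3) by auto
  then have "card (insert w B) \<le> card B'" "finite B" using B'(1) by (auto intro: card_mono finite_subset)
  moreover have "w \<notin> B" using w(2) B(1) by auto
  moreover have "card B' = dim W" using B' by (intro basis_card_eq_dim)
  ultimately show False using assms(6) B(4) by simp
qed

section \<open>Connected coalgebras\<close>

locale coalgebra_space =
  fixes C :: "('k::field, 'v::ab_group_add, 'a) space_scheme"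
    and \<Delta> :: "'v \<Rightarrow> ('k, 'v, 'v) tensor"
    and \<epsilon> :: "'v \<Rightarrow> 'k"
  assumes coalgebra: "coalgebra C \<Delta> \<epsilon>"
begin

lemma vspace: "vspace C"
  and linear_comult: "linear_on C (C \<Otimes> C) \<Delta>"
  and linear_counit: "linear_on C ground \<epsilon>"
  and coassoc: "x \<in> vecs C \<Longrightarrow>
      sweedler C C (\<Delta> x) (\<lambda>y z. sweedler C C (\<Delta> y) (\<lambda>a b. (a \<otimes>\<^bsub>C,C\<^esub> b) \<otimes>\<^bsub>C \<Otimes> C,C\<^esub> z)) =
      sweedler C C (\<Delta> x) (\<lambda>y z. sweedler C C (\<Delta> z) (\<lambda>a b. (y \<otimes>\<^bsub>C,C\<^esub> a) \<otimes>\<^bsub>C \<Otimes> C,C\<^esub> b))"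
  and counit_left: "x \<in> vecs C \<Longrightarrow> sweedler C C (\<Delta> x) (\<lambda>y z. scl C (\<epsilon> y) z) = x"
  and counit_right: "x \<in> vecs C \<Longrightarrow> sweedler C C (\<Delta> x) (\<lambda>y z. scl C (\<epsilon> z) y) = x"
  using coalgebra by (auto simp: coalgebra_def)

sublocale V: vector_space "scl C"
  using vspace by (simp add: vspace_def)

lemma subspace_vecs: "V.subspace (vecs C)"
  using vspace by (simp add: vspace_def)

lemma comult_mem: "x \<in> vecs C \<Longrightarrow> \<Delta> x \<in> vecs (C \<Otimes> C)"
  by (rule linear_on_mem[OF linear_comult])

lemmas linear_comult_compose = linear_on_compose[OF linear_comult]

text \<open>\<open>coassoc\<close> is an equation in the triple tensor product. The map
  \<open>G\<close> induced by a trilinear \<open>T\<close> is applied to both sides.\<close>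

lemma coassoc_apply:
  assumes "vspace U" "x \<in> vecs C"
    and "\<And>a b. a \<in> vecs C \<Longrightarrow> b \<in> vecs C \<Longrightarrow> linear_on C U (\<lambda>c. T a b c)"
    and "\<And>a c. a \<in> vecs C \<Longrightarrow> c \<in> vecs C \<Longrightarrow> linear_on C U (\<lambda>b. T a b c)"
    and "\<And>b c. b \<in> vecs C \<Longrightarrow> c \<in> vecs C \<Longrightarrow> linear_on C U (\<lambda>a. T a b c)"
  shows "sweedler C C (\<Delta> x) (\<lambda>y z. sweedler C C (\<Delta> y) (\<lambda>a b. T a b z)) =
    sweedler C C (\<Delta> x) (\<lambda>y z. sweedler C C (\<Delta> z) (\<lambda>a b. T y a b))"
proof -
  define G where "G p z = sweedler C C p (\<lambda>a b. T a b z)" for p z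
  have T: "bilinear_on C C U (\<lambda>a b. T a b z)" if "z \<in> vecs C" for z
    using that assms(4,5) by (intro bilinear_onI) auto
  have G: "bilinear_on (C \<Otimes> C) C U G"
    unfolding G_def
    by (intro bilinear_onI linear_on_sweedler_tensor linear_on_id vspace assms(1) T
        linear_on_sweedler_fun assms(3))
  have pure: "G (a \<otimes>\<^bsub>C,C\<^esub> b) c = T a b c" if "a \<in> vecs C" "b \<in> vecs C" "c \<in> vecs C" for a b c
    unfolding G_def by (rule sweedler_pure[OF vspace assms(1) T]) (use that in auto)
  note TT = vspace_tensor_space[of C C]
  have "sweedler (C \<Otimes> C) C (sweedler C C (\<Delta> x) (\<lambda>y z. sweedler C C (\<Delta> y) (\<lambda>a b. (a \<otimes>\<^bsub>C,C\<^esub> b) \<otimes>\<^bsub>C \<Otimes> C,C\<^esub> z))) G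
    = sweedler C C (\<Delta> x) (\<lambda>y z. sweedler C C (\<Delta> y) (\<lambda>a b. T a b z))"
    using assms(2)
    by (subst sweedler_sweedler[OF vspace TT assms(1) G comult_mem], simp)
      (auto intro!: sweedler_cong[OF vspace] comult_mem pure_in_tensor_space sweedler_mem[OF vspace vspace_tensor_space]
        simp: sweedler_sweedler[OF vspace TT assms(1) G comult_mem] pure_in_tensor_space
          sweedler_pure[OF TT assms(1) G] pure)
  moreover have "sweedler (C \<Otimes> C) C (sweedler C C (\<Delta> x) (\<lambda>y z. sweedler C C (\<Delta> z) (\<lambda>a b. (y \<otimes>\<^bsub>C,C\<^esub> a) \<otimes>\<^bsub>C \<Otimes> C,C\<^esub> b))) G
    = sweedler C C (\<Delta> x) (\<lambda>y z. sweedler C C (\<Delta> z) (\<lambda>a b. T y a b))"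
    using assms(2)
    by (subst sweedler_sweedler[OF vspace TT assms(1) G comult_mem], simp)
      (auto intro!: sweedler_cong[OF vspace] comult_mem pure_in_tensor_space sweedler_mem[OF vspace vspace_tensor_space]
        simp: sweedler_sweedler[OF vspace TT assms(1) G comult_mem] pure_in_tensor_space
          sweedler_pure[OF TT assms(1) G] pure)
  ultimately show ?thesis by (simp add: coassoc[OF assms(2)])
qed

section \<open>The coalgebra as a bimodule over its dual algebra\<close>

abbreviation functional :: "('v \<Rightarrow> 'k) \<Rightarrow> bool" where
  "functional \<equiv> linear_on C ground"

text \<open>In Sweedler notation this is \<phi>(x1) x2, while \<open>rhit\<close> is \<phi>(x2) x1:
  the two actions of the dual algebra, whose product is \<open>conv\<close>. Stability of a subspace
  under \<open>lhit\<close> means being a left subcomodule, so comodule theory is done with these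
  maps.\<close>

definition lhit :: "('v \<Rightarrow> 'k) \<Rightarrow> 'v \<Rightarrow> 'v" where
  "lhit \<phi> x = sweedler C C (\<Delta> x) (\<lambda>a b. scl C (\<phi> a) b)"

definition rhit :: "('v \<Rightarrow> 'k) \<Rightarrow> 'v \<Rightarrow> 'v" where
  "rhit \<phi> x = sweedler C C (\<Delta> x) (\<lambda>a b. scl C (\<phi> b) a)"

definition conv :: "('v \<Rightarrow> 'k) \<Rightarrow> ('v \<Rightarrow> 'k) \<Rightarrow> 'v \<Rightarrow> 'k" where
  "conv \<phi> \<psi> x = sweedler C C (\<Delta> x) (\<lambda>a b. \<phi> a * \<psi> b)"

lemma linear_lhit: "functional \<phi> \<Longrightarrow> linear_on C C (lhit \<phi>)"
  unfolding lhit_def[abs_def]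
  by (intro linear_on_sweedler_tensor linear_comult vspace linear_intros)

lemma linear_rhit: "functional \<phi> \<Longrightarrow> linear_on C C (rhit \<phi>)"
  unfolding rhit_def[abs_def]
  by (intro linear_on_sweedler_tensor linear_comult vspace linear_intros)

lemma functional_conv: "functional \<phi> \<Longrightarrow> functional \<psi> \<Longrightarrow> functional (conv \<phi> \<psi>)"
  unfolding conv_def[abs_def]
  by (intro linear_on_sweedler_tensor linear_comult vspace vspace_ground bilinear_onI
      linear_on_times_left linear_on_times_right)

lemma lhit_mem: "functional \<phi> \<Longrightarrow> x \<in> vecs C \<Longrightarrow> lhit \<phi> x \<in> vecs C"
  by (rule linear_on_mem[OF linear_lhit])

lemma rhit_mem: "functional \<phi> \<Longrightarrow> x \<in> vecs C \<Longrightarrow> rhit \<phi> x \<in> vecs C"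
  by (rule linear_on_mem[OF linear_rhit])

text \<open>Both values are \<phi>(x1) \<psi>(x2), so a functional can be moved from one side to the
  other. Taking the counit for one of them recovers the value of the other at \<open>x\<close> from
  a hit, as in \<open>counit_lhit\<close>.\<close>

lemma functional_lhit:
  assumes "functional \<phi>" "functional \<psi>" "x \<in> vecs C"
  shows "\<psi> (lhit \<phi> x) = conv \<phi> \<psi> x" "\<phi> (rhit \<psi> x) = conv \<phi> \<psi> x"
proof -
  show "\<psi> (lhit \<phi> x) = conv \<phi> \<psi> x"
    unfolding lhit_def conv_def
    by (subst sweedler_push[OF vspace vspace assms(2) comult_mem[OF assms(3)]])
      (auto intro!: sweedler_cong[OF vspace comult_mem[OF assms(3)]] vspace_scale[OF vspace]
        simp: linear_on_scale[OF assms(2)])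
  show "\<phi> (rhit \<psi> x) = conv \<phi> \<psi> x"
    unfolding rhit_def conv_def
    by (subst sweedler_push[OF vspace vspace assms(1) comult_mem[OF assms(3)]])
      (auto intro!: sweedler_cong[OF vspace comult_mem[OF assms(3)]] vspace_scale[OF vspace]
        simp: linear_on_scale[OF assms(1)])
qed

lemma lhit_counit: "x \<in> vecs C \<Longrightarrow> lhit \<epsilon> x = x"
  by (simp add: lhit_def counit_left)

lemma rhit_counit: "x \<in> vecs C \<Longrightarrow> rhit \<epsilon> x = x"
  by (simp add: rhit_def counit_right)

lemma counit_lhit: "functional \<phi> \<Longrightarrow> x \<in> vecs C \<Longrightarrow> \<epsilon> (lhit \<phi> x) = \<phi> x"
  using functional_lhit[of \<phi> \<epsilon> x] by (simp add: linear_counit rhit_counit)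

lemma counit_rhit: "functional \<phi> \<Longrightarrow> x \<in> vecs C \<Longrightarrow> \<epsilon> (rhit \<phi> x) = \<phi> x"
  using functional_lhit[of \<epsilon> \<phi> x] by (simp add: linear_counit lhit_counit)

text \<open>Coassociativity read through functionals: hits from opposite ends of x1 \<otimes> x2
  \<otimes> x3 commute, and hits from the same end combine by \<open>conv\<close>. The order of
  composition makes \<open>lhit\<close> a right action and \<open>rhit\<close> a left
  action.\<close>

lemma hit_hit:
  assumes "functional \<phi>" "functional \<psi>" "x \<in> vecs C"
  shows "lhit \<phi> (rhit \<psi> x) = rhit \<psi> (lhit \<phi> x)"
    and "lhit \<psi> (lhit \<phi> x) = lhit (conv \<phi> \<psi>) x"
    and "rhit \<phi> (rhit \<psi> x) = rhit (conv \<phi> \<psi>) x"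
proof -
  note push = sweedler_push[OF vspace vspace _ comult_mem] sweedler_push[OF vspace vspace_ground _ comult_mem]
  note D = comult_mem[OF assms(3)]
  have scl_lin: "linear_on C C (\<lambda>x. scl C c x)" for c
    by (intro linear_intros vspace)
  have scl_lin2: "linear_on ground C (\<lambda>c. scl C c x)" if "x \<in> vecs C" for x
    by (intro linear_on_scl_scalar linear_on_id that vspace)
  note cong = sweedler_cong[OF vspace D] sweedler_cong[OF vspace comult_mem]
  note mem = vspace_scale[OF vspace] lhit_mem[OF assms(1)] rhit_mem[OF assms(2)]
    lhit_mem[OF assms(2)] rhit_mem[OF assms(1)]
  have "lhit \<phi> (rhit \<psi> x) = sweedler C C (\<Delta> x) (\<lambda>y z. lhit \<phi> (scl C (\<psi> z) y))"
    unfolding rhit_def by (intro push(1)[OF linear_lhit] assms mem)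
  also have "\<dots> = sweedler C C (\<Delta> x) (\<lambda>y z. scl C (\<psi> z) (lhit \<phi> y))"
    by (intro cong) (simp add: linear_on_scale[OF linear_lhit[OF assms(1)]])
  also have "\<dots> = sweedler C C (\<Delta> x) (\<lambda>y z. sweedler C C (\<Delta> y) (\<lambda>a b. scl C (\<psi> z) (scl C (\<phi> a) b)))"
    unfolding lhit_def by (intro cong push(1)[OF scl_lin] mem)
  also have "\<dots> = sweedler C C (\<Delta> x) (\<lambda>y z. sweedler C C (\<Delta> z) (\<lambda>a b. scl C (\<psi> b) (scl C (\<phi> y) a)))"
    by (rule coassoc_apply[OF vspace assms(3)]) (intro linear_intros vspace assms mem; assumption)+
  also have "\<dots> = sweedler C C (\<Delta> x) (\<lambda>y z. scl C (\<phi> y) (rhit \<psi> z))"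
    unfolding rhit_def by (intro cong, subst push(1)[OF scl_lin]) (auto intro: mem simp: mult.commute)
  also have "\<dots> = sweedler C C (\<Delta> x) (\<lambda>y z. rhit \<psi> (scl C (\<phi> y) z))"
    by (intro cong) (simp add: linear_on_scale[OF linear_rhit[OF assms(2)]])
  also have "\<dots> = rhit \<psi> (lhit \<phi> x)"
    unfolding lhit_def by (intro push(1)[OF linear_rhit, symmetric] assms mem)
  finally show "lhit \<phi> (rhit \<psi> x) = rhit \<psi> (lhit \<phi> x)" .
  have "lhit \<psi> (lhit \<phi> x) = sweedler C C (\<Delta> x) (\<lambda>y z. lhit \<psi> (scl C (\<phi> y) z))"
    unfolding lhit_def[of \<phi>] by (intro push(1)[OF linear_lhit] assms mem)
  also have "\<dots> = sweedler C C (\<Delta> x) (\<lambda>y z. scl C (\<phi> y) (lhit \<psi> z))"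
    by (intro cong) (simp add: linear_on_scale[OF linear_lhit[OF assms(2)]])
  also have "\<dots> = sweedler C C (\<Delta> x) (\<lambda>y z. sweedler C C (\<Delta> z) (\<lambda>a b. scl C (\<phi> y) (scl C (\<psi> a) b)))"
    unfolding lhit_def by (intro cong push(1)[OF scl_lin] mem)
  also have "\<dots> = sweedler C C (\<Delta> x) (\<lambda>y z. sweedler C C (\<Delta> y) (\<lambda>a b. scl C (\<phi> a) (scl C (\<psi> b) z)))"
    by (rule coassoc_apply[OF vspace assms(3), symmetric]) (intro linear_intros vspace assms mem; assumption)+
  also have "\<dots> = sweedler C C (\<Delta> x) (\<lambda>y z. scl C (conv \<phi> \<psi> y) z)"
    unfolding conv_def by (intro cong, subst push(2)[OF scl_lin2]) auto
  finally show "lhit \<psi> (lhit \<phi> x) = lhit (conv \<phi> \<psi>) x" by (simp add: lhit_def)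
  have "rhit \<phi> (rhit \<psi> x) = sweedler C C (\<Delta> x) (\<lambda>y z. rhit \<phi> (scl C (\<psi> z) y))"
    unfolding rhit_def[of \<psi>] by (intro push(1)[OF linear_rhit] assms mem)
  also have "\<dots> = sweedler C C (\<Delta> x) (\<lambda>y z. scl C (\<psi> z) (rhit \<phi> y))"
    by (intro cong) (simp add: linear_on_scale[OF linear_rhit[OF assms(1)]])
  also have "\<dots> = sweedler C C (\<Delta> x) (\<lambda>y z. sweedler C C (\<Delta> y) (\<lambda>a b. scl C (\<psi> z) (scl C (\<phi> b) a)))"
    unfolding rhit_def by (intro cong push(1)[OF scl_lin] mem)
  also have "\<dots> = sweedler C C (\<Delta> x) (\<lambda>y z. sweedler C C (\<Delta> z) (\<lambda>a b. scl C (\<psi> b) (scl C (\<phi> a) y)))"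
    by (rule coassoc_apply[OF vspace assms(3)]) (intro linear_intros vspace assms mem; assumption)+
  also have "\<dots> = sweedler C C (\<Delta> x) (\<lambda>y z. scl C (conv \<phi> \<psi> z) y)"
    unfolding conv_def by (intro cong, subst push(2)[OF scl_lin2]) (auto simp: mult.commute)
  finally show "rhit \<phi> (rhit \<psi> x) = rhit (conv \<phi> \<psi>) x" by (simp add: rhit_def)
qed

text \<open>Pairing a reduced representation with its dual families shows that each factor of
  \<open>\<Delta> x\<close> is itself a hit of \<open>x\<close>. Stability under hits thus controls
  the factors, and finitely many factors span all hits.\<close>

lemma comult_reduced_rep:
  assumes x: "x \<in> vecs C"
  obtains J :: "nat set" and a b \<alpha> \<beta>
  where "finite J" "\<And>j. j \<in> J \<Longrightarrow> a j \<in> vecs C" "\<And>j. j \<in> J \<Longrightarrow> b j \<in> vecs C"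
    "\<And>j. j \<in> J \<Longrightarrow> functional (\<alpha> j)" "\<And>j. j \<in> J \<Longrightarrow> functional (\<beta> j)"
    "\<And>i j. i \<in> J \<Longrightarrow> j \<in> J \<Longrightarrow> \<beta> i (b j) = (if i = j then 1 else 0)"
    "\<And>j. j \<in> J \<Longrightarrow> lhit (\<alpha> j) x = b j" "\<And>j. j \<in> J \<Longrightarrow> rhit (\<beta> j) x = a j"
    "\<And>\<phi>. functional \<phi> \<Longrightarrow> lhit \<phi> x = (\<Sum>j\<in>J. scl C (\<phi> (a j)) (b j))"
    "\<And>\<phi>. functional \<phi> \<Longrightarrow> rhit \<phi> x = (\<Sum>j\<in>J. scl C (\<phi> (b j)) (a j))"
    "\<Delta> x = (\<Sum>j\<in>J. a j \<otimes>\<^bsub>C,C\<^esub> b j)"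
proof -
  obtain J :: "nat set" and a b \<alpha> \<beta> where *: "finite J" "\<And>j. j \<in> J \<Longrightarrow> a j \<in> vecs C" "\<And>j. j \<in> J \<Longrightarrow> b j \<in> vecs C"
    "\<And>j. j \<in> J \<Longrightarrow> functional (\<alpha> j)" "\<And>j. j \<in> J \<Longrightarrow> functional (\<beta> j)"
    "\<And>i j. i \<in> J \<Longrightarrow> j \<in> J \<Longrightarrow> \<alpha> i (a j) = (if i = j then 1 else 0)"
    "\<And>i j. i \<in> J \<Longrightarrow> j \<in> J \<Longrightarrow> \<beta> i (b j) = (if i = j then 1 else 0)"
    "\<Delta> x = (\<Sum>j\<in>J. a j \<otimes>\<^bsub>C,C\<^esub> b j)"
    by (rule tensor_reduced_rep[OF vspace vspace comult_mem[OF x]]) blast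
  have l: "lhit \<phi> x = (\<Sum>j\<in>J. scl C (\<phi> (a j)) (b j))" if "functional \<phi>" for \<phi>
    unfolding lhit_def *(8)
    by (rule sweedler_sum_pure[OF vspace vspace _ *(1-3)]) (auto intro!: linear_intros vspace that)
  have r: "rhit \<phi> x = (\<Sum>j\<in>J. scl C (\<phi> (b j)) (a j))" if "functional \<phi>" for \<phi>
    unfolding rhit_def *(8)
    by (rule sweedler_sum_pure[OF vspace vspace _ *(1-3)]) (auto intro!: linear_intros vspace that)
  have hits: "lhit (\<alpha> j) x = b j" "rhit (\<beta> j) x = a j" if "j \<in> J" for j
  proof -
    have "(\<Sum>i\<in>J. scl C (\<alpha> j (a i)) (b i)) = (\<Sum>i\<in>J. if j = i then b i else 0)"
      "(\<Sum>i\<in>J. scl C (\<beta> j (b i)) (a i)) = (\<Sum>i\<in>J. if j = i then a i else 0)"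
      using *(6,7) that by (auto intro!: sum.cong)
    then show "lhit (\<alpha> j) x = b j" "rhit (\<beta> j) x = a j"
      using that *(1,4,5) by (simp_all add: l r)
  qed
  show ?thesis by (rule that[OF *(1-5) *(7) hits l r *(8)])
qed

text \<open>Subcoalgebras are the sub-bimodules. For the converse direction, both factors in the
  reduced representation of \<open>\<Delta> x\<close> are hits of \<open>x\<close> and hence lie in
  \<open>S\<close>.\<close>

lemma subcoalgebra_iff:
  assumes "S \<subseteq> vecs C" "V.subspace S"
  shows "subcoalgebra C \<Delta> S \<longleftrightarrow>
    (\<forall>\<phi>. functional \<phi> \<longrightarrow> (\<forall>x\<in>S. lhit \<phi> x \<in> S \<and> rhit \<phi> x \<in> S))"
proof (intro iffI allI impI ballI)
  fix \<phi> x
  assume S: "subcoalgebra C \<Delta> S" and \<phi>: "functional \<phi>" and x: "x \<in> S"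
  have D: "\<Delta> x \<in> module.span (scl (C \<Otimes> C)) {x \<otimes>\<^bsub>C,C\<^esub> y | x y. x \<in> S \<and> y \<in> S}"
    using S x unfolding subcoalgebra_def by (auto simp: tensor_space_def)
  have sub: "{x \<otimes>\<^bsub>C,C\<^esub> y | x y. x \<in> S \<and> y \<in> S} \<subseteq> vecs (C \<Otimes> C)"
    using assms(1) by (auto intro: pure_in_tensor_space)
  have bl: "bilinear_on C C C (\<lambda>a b. scl C (\<phi> a) b)" and br: "bilinear_on C C C (\<lambda>a b. scl C (\<phi> b) a)"
    by (auto intro!: linear_intros vspace \<phi>)
  have "(\<lambda>t. sweedler C C t (\<lambda>a b. scl C (\<phi> a) b)) ` {x \<otimes>\<^bsub>C,C\<^esub> y | x y. x \<in> S \<and> y \<in> S} \<subseteq> S"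
    using assms(1) by (auto simp: sweedler_pure[OF vspace vspace bl] subset_iff intro: V.subspace_scale[OF assms(2)])
  moreover have "(\<lambda>t. sweedler C C t (\<lambda>a b. scl C (\<phi> b) a)) ` {x \<otimes>\<^bsub>C,C\<^esub> y | x y. x \<in> S \<and> y \<in> S} \<subseteq> S"
    using assms(1) by (auto simp: sweedler_pure[OF vspace vspace br] subset_iff intro: V.subspace_scale[OF assms(2)])
  ultimately show "lhit \<phi> x \<in> S \<and> rhit \<phi> x \<in> S"
    unfolding lhit_def rhit_def
    using linear_on_span[OF vspace_tensor_space vspace linear_on_sweedler_tensor[OF linear_on_id vspace vspace bl] sub assms(2) _ D]
      linear_on_span[OF vspace_tensor_space vspace linear_on_sweedler_tensor[OF linear_on_id vspace vspace br] sub assms(2) _ D]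
    by blast
next
  assume S: "\<forall>\<phi>. functional \<phi> \<longrightarrow> (\<forall>x\<in>S. lhit \<phi> x \<in> S \<and> rhit \<phi> x \<in> S)"
  interpret T: vector_space "tensor_scale :: 'k \<Rightarrow> ('k, 'v, 'v) tensor \<Rightarrow> _"
    by (rule vector_space_tensor_scale)
  have "\<Delta> x \<in> T.span {x \<otimes>\<^bsub>C,C\<^esub> y | x y. x \<in> S \<and> y \<in> S}" if x: "x \<in> S" for x
  proof -
    have "x \<in> vecs C" using x assms(1) by auto
    then obtain J :: "nat set" and a b \<alpha> \<beta> where *: "finite J" "\<And>j. j \<in> J \<Longrightarrow> a j \<in> vecs C" "\<And>j. j \<in> J \<Longrightarrow> b j \<in> vecs C"
    "\<And>j. j \<in> J \<Longrightarrow> functional (\<alpha> j)" "\<And>j. j \<in> J \<Longrightarrow> functional (\<beta> j)"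
    "\<And>i j. i \<in> J \<Longrightarrow> j \<in> J \<Longrightarrow> \<beta> i (b j) = (if i = j then 1 else 0)"
    "\<And>j. j \<in> J \<Longrightarrow> lhit (\<alpha> j) x = b j" "\<And>j. j \<in> J \<Longrightarrow> rhit (\<beta> j) x = a j"
    "\<And>\<phi>. functional \<phi> \<Longrightarrow> lhit \<phi> x = (\<Sum>j\<in>J. scl C (\<phi> (a j)) (b j))"
    "\<And>\<phi>. functional \<phi> \<Longrightarrow> rhit \<phi> x = (\<Sum>j\<in>J. scl C (\<phi> (b j)) (a j))"
    "\<Delta> x = (\<Sum>j\<in>J. a j \<otimes>\<^bsub>C,C\<^esub> b j)"
      by (rule comult_reduced_rep) blast
    have "a j \<in> S" "b j \<in> S" if "j \<in> J" for j
      using S x *(4,5,7,8)[OF that] by metis+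
    then show ?thesis
      unfolding *(11) by (intro T.span_sum T.span_base) auto
  qed
  then show "subcoalgebra C \<Delta> S"
    using assms by (auto simp: subcoalgebra_def)
qed

text \<open>By \<open>ann\<close> the map from \<open>lhit \<phi> e\<close> to
  \<open>lhit \<phi> m\<close> is well defined on the subcomodule generated by an arbitrary
  \<open>e\<close>; the lemma says that it is given by some \<open>rhit \<rho>\<close>, a form of
  the injectivity of C as a comodule. A functional that kills the left factors of
  \<open>\<Delta> e\<close> annihilates \<open>e\<close>, hence \<open>m\<close>, and so vanishes at
  \<open>m\<close>. Therefore \<open>m\<close> is a combination of these factors, and the dual
  family turns the coefficients into \<open>\<rho>\<close>.\<close>

lemma rhit_of_annihilator_subset:
  assumes "e \<in> vecs C" "m \<in> vecs C"
    and ann: "\<And>\<phi>. functional \<phi> \<Longrightarrow> lhit \<phi> e = 0 \<Longrightarrow> lhit \<phi> m = 0"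
  obtains \<rho> where "functional \<rho>" "m = rhit \<rho> e"
proof -
  obtain J :: "nat set" and a b \<alpha> \<beta> where *: "finite J" "\<And>j. j \<in> J \<Longrightarrow> a j \<in> vecs C" "\<And>j. j \<in> J \<Longrightarrow> b j \<in> vecs C"
    "\<And>j. j \<in> J \<Longrightarrow> functional (\<alpha> j)" "\<And>j. j \<in> J \<Longrightarrow> functional (\<beta> j)"
    "\<And>i j. i \<in> J \<Longrightarrow> j \<in> J \<Longrightarrow> \<beta> i (b j) = (if i = j then 1 else 0)"
    "\<And>j. j \<in> J \<Longrightarrow> lhit (\<alpha> j) e = b j" "\<And>j. j \<in> J \<Longrightarrow> rhit (\<beta> j) e = a j"
    "\<And>\<phi>. functional \<phi> \<Longrightarrow> lhit \<phi> e = (\<Sum>j\<in>J. scl C (\<phi> (a j)) (b j))"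
    "\<And>\<phi>. functional \<phi> \<Longrightarrow> rhit \<phi> e = (\<Sum>j\<in>J. scl C (\<phi> (b j)) (a j))"
    "\<Delta> e = (\<Sum>j\<in>J. a j \<otimes>\<^bsub>C,C\<^esub> b j)"
    by (rule comult_reduced_rep[OF assms(1)]) blast
  have "m \<in> V.span (a ` J)"
  proof (rule ccontr)
    assume "m \<notin> V.span (a ` J)"
    then obtain \<phi> where \<phi>: "functional \<phi>" "\<And>x. x \<in> V.span (a ` J) \<Longrightarrow> \<phi> x = 0" "\<phi> m = 1"
      using separating_functional[OF vspace V.subspace_span] by metis
    then have "lhit \<phi> e = 0" by (simp add: *(9) V.span_base)
    then have "lhit \<phi> m = 0" by (rule ann[OF \<phi>(1)])
    then show False
      using counit_lhit[OF \<phi>(1) assms(2)] \<phi>(3) by (simp add: linear_on_zero[OF vspace linear_counit])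
  qed
  then obtain c where c: "m = (\<Sum>j\<in>J. scl C (c j) (a j))"
    using span_image_finite[OF V.vector_space_axioms *(1)] by blast
  define \<rho> where "\<rho> y = (\<Sum>j\<in>J. c j * \<beta> j y)" for y
  have "functional \<rho>"
    unfolding \<rho>_def
    by (rule linear_onI)
      (auto simp: linear_on_add[OF *(5)] linear_on_scale[OF *(5)] sum.distrib sum_distrib_left algebra_simps)
  moreover have "\<rho> (b j) = c j" if "j \<in> J" for j
  proof -
    have "\<rho> (b j) = (\<Sum>i\<in>J. if j = i then c i else 0)"
      unfolding \<rho>_def using *(6) that by (intro sum.cong) auto
    then show ?thesis using *(1) that by simp
  qed
  ultimately show ?thesis
    using c by (intro that[of \<rho>]) (simp_all add: *(10))
qed

text \<open>The span is the sub-bimodule generated by \<open>n\<close>: \<open>hit_hit\<close>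
  absorbs any further hit into \<open>\<phi>\<close> or \<open>\<psi>\<close>, and the counit on
  both sides returns \<open>n\<close>.\<close>

lemma subcoalgebra_span_hits:
  assumes n: "n \<in> vecs C"
  defines "G \<equiv> {rhit \<psi> (lhit \<phi> n) | \<phi> \<psi>. functional \<phi> \<and> functional \<psi>}"
  shows "subcoalgebra C \<Delta> (V.span G)" and "n \<in> V.span G"
proof -
  have G: "G \<subseteq> vecs C" unfolding G_def using n by (auto intro: rhit_mem lhit_mem)
  have "lhit \<theta> ` G \<subseteq> V.span G \<and> rhit \<theta> ` G \<subseteq> V.span G" if \<theta>: "functional \<theta>" for \<theta>
  proof -
    have "lhit \<theta> (rhit \<psi> (lhit \<phi> n)) = rhit \<psi> (lhit (conv \<phi> \<theta>) n)"
      "rhit \<theta> (rhit \<psi> (lhit \<phi> n)) = rhit (conv \<theta> \<psi>) (lhit \<phi> n)"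
      if "functional \<phi>" "functional \<psi>" for \<phi> \<psi>
      using that \<theta> n by (simp_all add: hit_hit lhit_mem)
    then show ?thesis
      using \<theta> unfolding G_def by (auto intro!: V.span_base) (metis functional_conv)+
  qed
  then have "lhit \<theta> x \<in> V.span G \<and> rhit \<theta> x \<in> V.span G" if "functional \<theta>" "x \<in> V.span G" for \<theta> x
    using that linear_on_span[OF vspace vspace _ G V.subspace_span] linear_lhit linear_rhit by metis
  then show "subcoalgebra C \<Delta> (V.span G)"
    using V.span_minimal[OF G subspace_vecs] by (simp add: subcoalgebra_iff)
  have "rhit \<epsilon> (lhit \<epsilon> n) = n" using n by (simp add: lhit_counit rhit_counit)
  then show "n \<in> V.span G"
    unfolding G_def using linear_counit by (intro V.span_base) (auto intro!: exI[of _ \<epsilon>])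
qed

text \<open>
  The functionals act on \<open>C\<close> by \<open>lhit\<close>. If \<open>n\<close> generates a simple module, then every element of
  the span below generates a semisimple module of type \<open>n\<close>; stripping off summands one at a time
  recovers \<open>n\<close> inside any nonzero subcoalgebra.
\<close>

lemma simple_subcoalgebra_span_hits:
  assumes n: "n \<in> vecs C" "n \<noteq> 0"
    and simple: "\<And>\<phi>. functional \<phi> \<Longrightarrow> lhit \<phi> n \<noteq> 0 \<Longrightarrow> \<exists>\<chi>. functional \<chi> \<and> lhit \<chi> (lhit \<phi> n) = n"
  shows "simple_subcoalgebra C \<Delta> (V.span {rhit \<psi> (lhit \<phi> n) | \<phi> \<psi>. functional \<phi> \<and> functional \<psi>})"
    (is "simple_subcoalgebra C \<Delta> (V.span ?G)")
  unfolding simple_subcoalgebra_def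
proof (intro conjI allI impI)
  show "subcoalgebra C \<Delta> (V.span ?G)" by (rule subcoalgebra_span_hits[OF n(1)])
  show "V.span ?G \<noteq> {0}" using subcoalgebra_span_hits(2)[OF n(1)] n(2) by auto
  fix E assume E: "E \<subseteq> V.span ?G" "subcoalgebra C \<Delta> E"
  then have E': "E \<subseteq> vecs C" "V.subspace E" by (auto simp: subcoalgebra_def)
  have hitE: "lhit \<phi> e \<in> E" "rhit \<phi> e \<in> E" if "functional \<phi>" "e \<in> E" for \<phi> e
    using E(2) that unfolding subcoalgebra_iff[OF E'] by auto
  \<comment> \<open>Induction on the number of summands. For \<open>m\<close> the inner element of
    the first summand, either some functional kills \<open>m\<close> but not \<open>e\<close>, which
    shortens the sum, or \<open>e\<close> and \<open>m\<close> have the same annihilator and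
    \<open>m\<close> is recovered from \<open>e\<close> inside \<open>E\<close>.\<close>
  have strip: "n \<in> E"
    if "e \<in> E" "e \<noteq> 0" "e = (\<Sum>(\<psi>, \<phi>)\<leftarrow>ps. rhit \<psi> (lhit \<phi> n))" "\<forall>(\<psi>, \<phi>)\<in>set ps. functional \<psi> \<and> functional \<phi>"
    for e ps
    using that
  proof (induction "length ps" arbitrary: ps e)
    case 0
    then show ?case by simp
  next
    case (Suc k qs)
    then obtain p ps where qs: "qs = p # ps" "k = length ps" by (cases qs) auto
    note prems = Suc.prems[unfolded qs(1)]
    obtain \<psi> \<phi> where p: "p = (\<psi>, \<phi>)" by (cases p)
    define m where "m = lhit \<phi> n"
    have f: "functional \<psi>" "functional \<phi>" and fps: "\<forall>(\<psi>, \<phi>)\<in>set ps. functional \<psi> \<and> functional \<phi>"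
      using prems(4) by (auto simp: p)
    have m: "m \<in> vecs C" unfolding m_def by (rule lhit_mem[OF f(2) n(1)])
    have eC: "e \<in> vecs C" using prems(1) E' by auto
    have e: "e = rhit \<psi> m + (\<Sum>(\<psi>, \<phi>)\<leftarrow>ps. rhit \<psi> (lhit \<phi> n))"
      using prems(3) by (simp add: p m_def)
    \<comment> \<open>As \<open>lhit\<close> commutes with \<open>rhit\<close>, it alters only the
      inner functionals, so the number of summands does not grow.\<close>
    have lhit_e: "lhit \<theta> e = rhit \<psi> (lhit \<theta> m) + (\<Sum>(\<psi>, \<phi>)\<leftarrow>map (\<lambda>(\<psi>, \<phi>). (\<psi>, conv \<phi> \<theta>)) ps. rhit \<psi> (lhit \<phi> n))"
      if \<theta>: "functional \<theta>" for \<theta>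
    proof -
      have mem: "rhit (fst q) (lhit (snd q) n) \<in> vecs C" if "q \<in> set ps" for q
        using bspec[OF fps that] n(1) by (simp add: case_prod_unfold rhit_mem lhit_mem)
      have "lhit \<theta> e = lhit \<theta> (rhit \<psi> m) + (\<Sum>q\<leftarrow>ps. lhit \<theta> (rhit (fst q) (lhit (snd q) n)))"
        unfolding e using f \<theta> m mem
        by (simp add: case_prod_unfold linear_on_add[OF linear_lhit] rhit_mem vspace_sum_list[OF vspace]
            linear_on_sum_list[OF vspace linear_lhit])
      also have "(\<Sum>q\<leftarrow>ps. lhit \<theta> (rhit (fst q) (lhit (snd q) n))) = (\<Sum>q\<leftarrow>ps. rhit (fst q) (lhit (conv (snd q) \<theta>) n))"
        using fps \<theta> n(1)
        by (intro arg_cong[of _ _ sum_list] map_cong) (auto simp: hit_hit lhit_mem case_prod_unfold)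
      finally show ?thesis
        using f \<theta> m by (simp add: hit_hit case_prod_unfold o_def)
    qed
    show ?case
    proof (cases "\<exists>\<theta>. functional \<theta> \<and> lhit \<theta> m = 0 \<and> lhit \<theta> e \<noteq> 0")
      case True
      then obtain \<theta> where \<theta>: "functional \<theta>" "lhit \<theta> m = 0" "lhit \<theta> e \<noteq> 0" by auto
      show ?thesis
      proof (rule Suc.hyps(1)[of "map (\<lambda>(\<psi>, \<phi>). (\<psi>, conv \<phi> \<theta>)) ps" "lhit \<theta> e"])
        show "lhit \<theta> e = (\<Sum>(\<psi>, \<phi>)\<leftarrow>map (\<lambda>(\<psi>, \<phi>). (\<psi>, conv \<phi> \<theta>)) ps. rhit \<psi> (lhit \<phi> n))"
          using lhit_e[OF \<theta>(1)] by (simp add: \<theta>(2) linear_on_zero[OF vspace linear_rhit[OF f(1)]])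
      qed (use \<theta> hitE prems(1) fps functional_conv qs(2) in \<open>auto simp: case_prod_unfold\<close>)
    next
      case False
      then have ann: "lhit \<theta> e = 0" if "functional \<theta>" "lhit \<theta> m = 0" for \<theta>
        using that by blast
      have "m \<noteq> 0"
        using ann[of \<epsilon>] prems(2) linear_counit by (auto simp: lhit_counit eC vspace_zero[OF vspace])
      then obtain \<chi> where \<chi>: "functional \<chi>" "lhit \<chi> m = n"
        using simple[OF f(2)] unfolding m_def by auto
      have "lhit \<theta> m = 0" if \<theta>: "functional \<theta>" "lhit \<theta> e = 0" for \<theta>
      proof (rule ccontr)
        assume ne: "lhit \<theta> m \<noteq> 0"
        have "lhit \<theta> m = lhit (conv \<phi> \<theta>) n" unfolding m_def by (rule hit_hit[OF f(2) \<theta>(1) n(1)])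
        then obtain \<kappa> where \<kappa>: "functional \<kappa>" "lhit \<kappa> (lhit \<theta> m) = n"
          using simple[OF functional_conv[OF f(2) \<theta>(1)]] ne by metis
        \<comment> \<open>By \<open>\<kappa>\<close> the element \<open>lhit \<theta> m\<close>
          returns to \<open>n\<close>, and \<open>\<phi>\<close> takes \<open>n\<close> back to
          \<open>m\<close>. So \<open>\<tau>\<close> fixes \<open>m\<close> and kills
          \<open>e\<close>; then \<open>\<sigma>\<close> annihilates \<open>m\<close> but not
          \<open>e\<close>, contrary to \<open>ann\<close>.\<close>
        define \<tau> where "\<tau> = conv (conv \<theta> \<kappa>) \<phi>"
        have \<tau>: "functional \<tau>" "\<And>x. x \<in> vecs C \<Longrightarrow> lhit \<tau> x = lhit \<phi> (lhit \<kappa> (lhit \<theta> x))"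
          unfolding \<tau>_def using \<theta>(1) \<kappa>(1) f(2) by (simp_all add: functional_conv hit_hit lhit_mem)
        define \<sigma> where "\<sigma> y = \<tau> y - \<epsilon> y" for y
        have \<sigma>: "functional \<sigma>" unfolding \<sigma>_def by (intro linear_intros vspace_ground \<tau> linear_counit)
        have lhit_\<sigma>: "lhit \<sigma> x = lhit \<tau> x - x" if "x \<in> vecs C" for x
          using counit_left[OF that]
          by (simp add: lhit_def \<sigma>_def V.scale_left_diff_distrib sweedler_diff_fun)
        have "lhit \<sigma> m = 0"
          using m by (simp add: lhit_\<sigma> \<tau>(2) \<kappa>(2)) (simp add: m_def)
        then have "lhit \<sigma> e = 0" by (rule ann[OF \<sigma>])
        then have "e = lhit \<phi> (lhit \<kappa> (lhit \<theta> e))" using eC by (simp add: lhit_\<sigma> \<tau>(2))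
        then show False
          using prems(2) \<theta>(2) by (simp add: linear_on_zero[OF vspace linear_lhit] f(2) \<kappa>(1))
      qed
      then obtain \<rho> where "functional \<rho>" "m = rhit \<rho> e"
        using rhit_of_annihilator_subset[OF eC m] by metis
      then have "m \<in> E" using hitE prems(1) by auto
      then show ?thesis using hitE(1)[OF \<chi>(1)] \<chi>(2) by auto
    qed
  qed
  have rep: "\<exists>ps. e = (\<Sum>(\<psi>, \<phi>)\<leftarrow>ps. rhit \<psi> (lhit \<phi> n)) \<and> (\<forall>(\<psi>, \<phi>)\<in>set ps. functional \<psi> \<and> functional \<phi>)"
    if "e \<in> V.span ?G" for e
    using that
  proof (induction rule: V.span_induct_alt)
    case base
    show ?case by (rule exI[of _ "[]"]) simp
  next
    case (step c x y)
    then obtain \<phi> \<psi> ps where *: "x = rhit \<psi> (lhit \<phi> n)" "functional \<phi>" "functional \<psi>"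
      "y = (\<Sum>(\<psi>, \<phi>)\<leftarrow>ps. rhit \<psi> (lhit \<phi> n))" "\<forall>(\<psi>, \<phi>)\<in>set ps. functional \<psi> \<and> functional \<phi>"
      by blast
    \<comment> \<open>Scalars are absorbed into the outer functional, which makes linear
      combinations of hits plain sums.\<close>
    have "rhit (\<lambda>y. c * \<psi> y) (lhit \<phi> n) = scl C c x"
      unfolding * rhit_def
      by (subst sweedler_push[OF vspace vspace _ comult_mem, where g = "\<lambda>x. scl C c x"])
        (auto intro!: linear_intros vspace vspace_scale lhit_mem * n)
    then show ?case
      using * by (intro exI[of _ "(\<lambda>y. c * \<psi> y, \<phi>) # ps"]) (auto intro: linear_on_times_right)
  qed
  show "E = {0} \<or> E = V.span ?G"
  proof (cases "E \<subseteq> {0}")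
    case True
    then show ?thesis using V.subspace_0[OF E'(2)] by auto
  next
    case False
    then obtain e where "e \<in> E" "e \<noteq> 0" by auto
    then have "n \<in> E" using strip rep[of e] E(1) by blast
    then have "?G \<subseteq> E" using hitE by auto
    then have "V.span ?G \<subseteq> E" by (rule V.span_minimal[OF _ E'(2)])
    then show ?thesis using E(1) by blast
  qed
qed

text \<open>For \<open>c = \<phi> e\<close> at a point \<open>e\<close> of counit 1 the corrected
  functional vanishes at \<open>e\<close>. Every hit of \<open>x\<close> is thus a hit by such a
  functional plus a multiple of \<open>x\<close>.\<close>

lemma lhit_minus_counit:
  assumes "functional \<phi>" "x \<in> vecs C"
  shows "functional (\<lambda>y. \<phi> y - c * \<epsilon> y)" "lhit (\<lambda>y. \<phi> y - c * \<epsilon> y) x = lhit \<phi> x - scl C c x"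
proof -
  show "functional (\<lambda>y. \<phi> y - c * \<epsilon> y)"
    by (intro linear_intros vspace_ground assms linear_counit)
  have "lhit (\<lambda>y. \<phi> y - c * \<epsilon> y) x = lhit \<phi> x - sweedler C C (\<Delta> x) (\<lambda>a b. scl C c (scl C (\<epsilon> a) b))"
    by (simp add: lhit_def V.scale_left_diff_distrib sweedler_diff_fun)
  also have "sweedler C C (\<Delta> x) (\<lambda>a b. scl C c (scl C (\<epsilon> a) b)) = scl C c (lhit \<epsilon> x)"
    unfolding lhit_def
    by (rule sweedler_push[OF vspace vspace _ comult_mem[OF assms(2)], symmetric])
      (auto intro!: linear_intros vspace vspace_scale)
  finally show "lhit (\<lambda>y. \<phi> y - c * \<epsilon> y) x = lhit \<phi> x - scl C c x"
    by (simp add: lhit_counit assms(2))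
qed

text \<open>The orbit is the subcomodule generated by \<open>x\<close>, and the right factors of
  \<open>\<Delta> x\<close> span it. Its finite dimension is what \<open>connected_induct\<close>
  minimises.\<close>

lemma lhit_orbit:
  assumes x: "x \<in> vecs C"
  shows "V.subspace {lhit \<phi> x | \<phi>. functional \<phi>}"
    and "\<exists>F. finite F \<and> {lhit \<phi> x | \<phi>. functional \<phi>} \<subseteq> V.span F"
proof -
  have add: "lhit \<phi> x + lhit \<psi> x = lhit (\<lambda>y. \<phi> y + \<psi> y) x" for \<phi> \<psi>
    by (simp add: lhit_def V.scale_left_distrib sweedler_plus_fun)
  have scale: "scl C c (lhit \<phi> x) = lhit (\<lambda>y. c * \<phi> y) x" if "functional \<phi>" for c \<phi>
    unfolding lhit_def
    by (subst sweedler_push[OF vspace vspace _ comult_mem[OF x], where g = "\<lambda>x. scl C c x"])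
      (auto intro!: linear_intros vspace vspace_scale)
  have "functional (\<lambda>y. 0)" by (rule linear_onI) auto
  moreover have "lhit (\<lambda>y. 0) x = 0" by (simp add: lhit_def sweedler_zero_fun)
  ultimately have zero: "\<exists>\<phi>. 0 = lhit \<phi> x \<and> functional \<phi>" by metis
  show "V.subspace {lhit \<phi> x | \<phi>. functional \<phi>}"
  proof (rule V.subspaceI)
    show "0 \<in> {lhit \<phi> x | \<phi>. functional \<phi>}" using zero by blast
    show "y + z \<in> {lhit \<phi> x | \<phi>. functional \<phi>}"
      if "y \<in> {lhit \<phi> x | \<phi>. functional \<phi>}" "z \<in> {lhit \<phi> x | \<phi>. functional \<phi>}" for y z
      using that add linear_on_plus[OF vspace_ground] by blast
    show "scl C c y \<in> {lhit \<phi> x | \<phi>. functional \<phi>}" if "y \<in> {lhit \<phi> x | \<phi>. functional \<phi>}" for c y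
      using that scale linear_on_times_right by blast
  qed
  obtain J :: "nat set" and a b \<alpha> \<beta> where *: "finite J" "\<And>j. j \<in> J \<Longrightarrow> a j \<in> vecs C" "\<And>j. j \<in> J \<Longrightarrow> b j \<in> vecs C"
    "\<And>j. j \<in> J \<Longrightarrow> functional (\<alpha> j)" "\<And>j. j \<in> J \<Longrightarrow> functional (\<beta> j)"
    "\<And>i j. i \<in> J \<Longrightarrow> j \<in> J \<Longrightarrow> \<beta> i (b j) = (if i = j then 1 else 0)"
    "\<And>j. j \<in> J \<Longrightarrow> lhit (\<alpha> j) x = b j" "\<And>j. j \<in> J \<Longrightarrow> rhit (\<beta> j) x = a j"
    "\<And>\<phi>. functional \<phi> \<Longrightarrow> lhit \<phi> x = (\<Sum>j\<in>J. scl C (\<phi> (a j)) (b j))"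
    "\<And>\<phi>. functional \<phi> \<Longrightarrow> rhit \<phi> x = (\<Sum>j\<in>J. scl C (\<phi> (b j)) (a j))"
    "\<Delta> x = (\<Sum>j\<in>J. a j \<otimes>\<^bsub>C,C\<^esub> b j)"
    by (rule comult_reduced_rep[OF x]) blast
  have "{lhit \<phi> x | \<phi>. functional \<phi>} \<subseteq> V.span (b ` J)"
    using *(9) by (auto intro!: V.span_sum V.span_scale V.span_base[OF imageI])
  then show "\<exists>F. finite F \<and> {lhit \<phi> x | \<phi>. functional \<phi>} \<subseteq> V.span F"
    using *(1) by blast
qed

text \<open>
  If the conclusion failed, the quotient of \<open>C\<close> by the largest comodule inside \<open>Q\<close> would contain
  a simple comodule; its coefficients span a simple subcoalgebra, which is the line through \<open>e\<close>
  by connectedness, and this contradicts the induction step.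
\<close>

theorem connected_induct:
  assumes conn: "coradical C \<Delta> = V.span {e}"
    and e: "e \<in> vecs C" "\<Delta> e = e \<otimes>\<^bsub>C,C\<^esub> e" "\<epsilon> e = 1"
    and Q: "V.subspace Q"
    and step: "\<And>w. w \<in> vecs C \<Longrightarrow> (\<And>\<phi>. functional \<phi> \<Longrightarrow> \<phi> e = 0 \<Longrightarrow> lhit \<phi> w \<in> Q) \<Longrightarrow> w \<in> Q"
    and x: "x \<in> vecs C"
  shows "x \<in> Q"
proof -
  define P where "P = {x \<in> vecs C. \<forall>\<phi>. functional \<phi> \<longrightarrow> lhit \<phi> x \<in> Q}"
  define orb where "orb x = {lhit \<phi> x | \<phi>. functional \<phi>}" for x
  have PC: "P \<subseteq> vecs C" and PQ: "P \<subseteq> Q"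
    using linear_counit lhit_counit by (auto simp: P_def)
  have P_sub: "V.subspace P"
    by (rule V.subspaceI) (auto simp: P_def V.subspace_0[OF subspace_vecs] V.subspace_add[OF subspace_vecs]
        V.subspace_scale[OF subspace_vecs] linear_on_zero[OF vspace linear_lhit] linear_on_add[OF linear_lhit]
        linear_on_scale[OF linear_lhit] V.subspace_0[OF Q] V.subspace_add[OF Q] V.subspace_scale[OF Q])
  have P_lhit: "lhit \<phi> x \<in> P" if "functional \<phi>" "x \<in> P" for \<phi> x
    using that by (auto simp: P_def lhit_mem hit_hit functional_conv)
  \<comment> \<open>The induction step passes from \<open>Q\<close> to its stable part
    \<open>P\<close>, because each functional is a multiple of the counit plus one that vanishes at
    \<open>e\<close>.\<close>
  have P_step: "w \<in> P" if w: "w \<in> vecs C" "\<And>\<phi>. functional \<phi> \<Longrightarrow> \<phi> e = 0 \<Longrightarrow> lhit \<phi> w \<in> P" for w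
  proof -
    have wQ: "w \<in> Q" using step[OF w(1)] w(2) PQ by blast
    have "lhit \<phi> w \<in> Q" if \<phi>: "functional \<phi>" for \<phi>
    proof -
      have "lhit (\<lambda>y. \<phi> y - \<phi> e * \<epsilon> y) w \<in> Q"
        using w(2)[OF lhit_minus_counit(1)[OF \<phi> w(1)], of "\<phi> e"] e(3) PQ by auto
      from V.subspace_add[OF Q this V.subspace_scale[OF Q wQ, of "\<phi> e"]]
      show ?thesis by (simp add: lhit_minus_counit(2)[OF \<phi> w(1)])
    qed
    then show ?thesis using w(1) by (simp add: P_def)
  qed
  have "x \<in> P"
  proof (rule ccontr)
    assume "x \<notin> P"
    \<comment> \<open>Minimality makes the class of \<open>w\<close> modulo \<open>P\<close>
      generate a simple comodule: if \<open>lhit \<phi> w\<close> is outside \<open>P\<close>, its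
      orbit lies in that of \<open>w\<close> and cannot be smaller.\<close>
    then obtain w where w: "w \<in> vecs C" "w \<notin> P"
      and min: "\<And>v. v \<in> vecs C \<Longrightarrow> v \<notin> P \<Longrightarrow> V.dim (orb w) \<le> V.dim (orb v)"
      using ex_has_least_nat[of "\<lambda>v. v \<in> vecs C \<and> v \<notin> P" x "\<lambda>v. V.dim (orb v)"] x by blast
    \<comment> \<open>If \<open>p\<close> vanishes on \<open>P\<close>, then \<open>rhit p\<close>
      is a comodule map killing \<open>P\<close>, so the image \<open>n\<close> of \<open>w\<close>
      inherits simplicity. Since \<open>p w\<close> is the counit of \<open>n\<close>, the
      normalisation singles out \<open>e\<close> on its line.\<close>
    have trivial: "rhit p w = e" if p: "functional p" "\<And>v. v \<in> P \<Longrightarrow> p v = 0" "p w = 1" for p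
    proof -
      define n where "n = rhit p w"
      have n: "n \<in> vecs C" "\<epsilon> n = 1"
        unfolding n_def using p w(1) by (simp_all add: rhit_mem counit_rhit)
      then have n0: "n \<noteq> 0" using linear_on_zero[OF vspace linear_counit] by auto
      have killed: "rhit p v = 0" if v: "v \<in> P" for v
      proof (rule ccontr)
        assume "rhit p v \<noteq> 0"
        then obtain \<phi> where \<phi>: "functional \<phi>" "\<phi> (rhit p v) = 1"
          using separating_functional[OF vspace V.subspace_single_0] by blast
        have "\<phi> (rhit p v) = p (lhit \<phi> v)"
          using functional_lhit[OF \<phi>(1) p(1)] v PC by auto
        then show False using P_lhit[OF \<phi>(1) v] p(2) \<phi>(2) by simp
      qed
      have simple: "\<exists>\<chi>. functional \<chi> \<and> lhit \<chi> (lhit \<phi> n) = n" if \<phi>: "functional \<phi>" "lhit \<phi> n \<noteq> 0" for \<phi>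
      proof -
        have eq: "lhit \<phi> n = rhit p (lhit \<phi> w)"
          unfolding n_def by (rule hit_hit[OF \<phi>(1) p(1) w(1)])
        then have "lhit \<phi> w \<notin> P" using killed \<phi>(2) by auto
        then have dim: "V.dim (orb w) \<le> V.dim (orb (lhit \<phi> w))" using min lhit_mem[OF \<phi>(1) w(1)] by auto
        have sub: "orb (lhit \<phi> w) \<subseteq> orb w"
          unfolding orb_def using hit_hit(2)[OF \<phi>(1) _ w(1)] functional_conv[OF \<phi>(1)] by blast
        obtain F where F: "finite F" "orb w \<subseteq> V.span F"
          using lhit_orbit(2)[OF w(1)] unfolding orb_def by blast
        have "orb (lhit \<phi> w) = orb w"
          using lhit_orbit(1)[OF lhit_mem[OF \<phi>(1) w(1)]]
          by (intro subspace_eq_of_dim_le[OF V.vector_space_axioms F _ sub dim]) (simp add: orb_def)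
        moreover have "w \<in> orb w"
          unfolding orb_def using lhit_counit[OF w(1)] linear_counit by force
        ultimately obtain \<chi> where \<chi>: "functional \<chi>" "lhit \<chi> (lhit \<phi> w) = w"
          unfolding orb_def by force
        have "lhit \<chi> (lhit \<phi> n) = rhit p (lhit \<chi> (lhit \<phi> w))"
          unfolding eq by (rule hit_hit(1)[OF \<chi>(1) p(1) lhit_mem[OF \<phi>(1) w(1)]])
        then show ?thesis using \<chi> by (auto simp: n_def)
      qed
      have "n \<in> coradical C \<Delta>"
        unfolding coradical_def
        using simple_subcoalgebra_span_hits[OF n(1) n0 simple] subcoalgebra_span_hits(2)[OF n(1)]
        by (intro V.span_base) blast
      then obtain c where "n = scl C c e" unfolding conn V.span_singleton by auto
      then show ?thesis
        using n(2) e by (auto simp: n_def[symmetric] linear_on_scale[OF linear_counit])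
    qed
    obtain p0 where p0: "functional p0" "\<And>v. v \<in> P \<Longrightarrow> p0 v = 0" "p0 w = 1"
      using separating_functional[OF vspace P_sub w(2)] by metis
    have "lhit \<phi> w \<in> P" if \<phi>: "functional \<phi>" "\<phi> e = 0" for \<phi>
    proof (rule ccontr)
      have zero: "p (lhit \<phi> w) = 0" if "functional p" "\<And>v. v \<in> P \<Longrightarrow> p v = 0" "p w = 1" for p
        using functional_lhit[OF \<phi>(1) that(1) w(1)] trivial[OF that] \<phi>(2) by simp
      assume "lhit \<phi> w \<notin> P"
      then obtain q where q: "functional q" "\<And>v. v \<in> P \<Longrightarrow> q v = 0" "q (lhit \<phi> w) = 1"
        using separating_functional[OF vspace P_sub] by metis
      \<comment> \<open>\<open>zero\<close> needs value 1 at \<open>w\<close>. The multiple of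
        \<open>p0\<close> arranges this for \<open>q\<close> without changing the value at
        \<open>lhit \<phi> w\<close>, where \<open>p0\<close> is 0.\<close>
      define r where "r v = q v + (1 - q w) * p0 v" for v
      have "r (lhit \<phi> w) = 0"
      proof (rule zero)
        show "functional r" unfolding r_def by (intro linear_intros vspace_ground q p0)
      qed (use q p0 in \<open>auto simp: r_def\<close>)
      then show False using zero[OF p0] q(3) by (simp add: r_def)
    qed
    then have "w \<in> P" by (rule P_step[OF w(1)])
    then show False using w(2) by simp
  qed
  then show ?thesis using PQ by auto
qed

end

section \<open>Coalgebras in Yetter-Drinfeld modules\<close>

text \<open>Axioms such as coassociativity of a coaction equate doubly nested sums in a triple
  tensor product. This evaluates either side under the linear map induced by a trilinear
  \<open>T\<close>.\<close>

lemma sweedler_tensor3: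
  assumes "vspace V" "vspace V'" "vspace A" "vspace U" "x \<in> vecs (V \<Otimes> W)"
    and p: "\<And>v w. v \<in> vecs V \<Longrightarrow> w \<in> vecs W \<Longrightarrow> p v w \<in> vecs (V' \<Otimes> W')"
    and f: "\<And>v w a b. v \<in> vecs V \<Longrightarrow> w \<in> vecs W \<Longrightarrow> a \<in> vecs V' \<Longrightarrow> b \<in> vecs W' \<Longrightarrow>
      f v w a b \<in> vecs A \<and> g v w a b \<in> vecs B \<and> h v w a b \<in> vecs D"
    and T: "\<And>a b. a \<in> vecs A \<Longrightarrow> b \<in> vecs B \<Longrightarrow> linear_on D U (\<lambda>c. T a b c)"
      "\<And>a c. a \<in> vecs A \<Longrightarrow> c \<in> vecs D \<Longrightarrow> linear_on B U (\<lambda>b. T a b c)"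
      "\<And>b c. b \<in> vecs B \<Longrightarrow> c \<in> vecs D \<Longrightarrow> linear_on A U (\<lambda>a. T a b c)"
  shows "sweedler (A \<Otimes> B) D
      (sweedler V W x (\<lambda>v w. sweedler V' W' (p v w) (\<lambda>a b.
        (f v w a b \<otimes>\<^bsub>A,B\<^esub> g v w a b) \<otimes>\<^bsub>A \<Otimes> B,D\<^esub> h v w a b)))
      (\<lambda>q d. sweedler A B q (\<lambda>a b. T a b d))
    = sweedler V W x (\<lambda>v w. sweedler V' W' (p v w) (\<lambda>a b. T (f v w a b) (g v w a b) (h v w a b)))"
proof -
  define G where "G q d = sweedler A B q (\<lambda>a b. T a b d)" for q d
  have bil: "bilinear_on A B U (\<lambda>a b. T a b d)" if "d \<in> vecs D" for d
    using that T by (intro bilinear_onI) auto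
  have G: "bilinear_on (A \<Otimes> B) D U G"
    unfolding G_def
    by (intro bilinear_onI linear_on_sweedler_tensor linear_on_id assms(3,4) bil linear_on_sweedler_fun T(1))
  have G_pure: "G (a \<otimes>\<^bsub>A,B\<^esub> b) d = T a b d" if "a \<in> vecs A" "b \<in> vecs B" "d \<in> vecs D" for a b d
    unfolding G_def by (rule sweedler_pure[OF assms(3,4) bil that(1,2)]) (rule that(3))
  note TT = vspace_tensor_space[of A B]
  have mem: "(f v w a b \<otimes>\<^bsub>A,B\<^esub> g v w a b) \<otimes>\<^bsub>A \<Otimes> B,D\<^esub> h v w a b \<in> vecs ((A \<Otimes> B) \<Otimes> D)"
    if "v \<in> vecs V" "w \<in> vecs W" "a \<in> vecs V'" "b \<in> vecs W'" for v w a b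
    using f[OF that] by (intro pure_in_tensor_space) auto
  have "sweedler (A \<Otimes> B) D
      (sweedler V W x (\<lambda>v w. sweedler V' W' (p v w) (\<lambda>a b.
        (f v w a b \<otimes>\<^bsub>A,B\<^esub> g v w a b) \<otimes>\<^bsub>A \<Otimes> B,D\<^esub> h v w a b))) G
    = sweedler V W x (\<lambda>v w. sweedler (A \<Otimes> B) D (sweedler V' W' (p v w) (\<lambda>a b.
        (f v w a b \<otimes>\<^bsub>A,B\<^esub> g v w a b) \<otimes>\<^bsub>A \<Otimes> B,D\<^esub> h v w a b)) G)"
    by (intro sweedler_sweedler[OF assms(1) TT assms(4) G assms(5)]
        sweedler_mem[OF assms(2) vspace_tensor_space] p mem)
  also have "\<dots> = sweedler V W x (\<lambda>v w. sweedler V' W' (p v w) (\<lambda>a b. sweedler (A \<Otimes> B) D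
        ((f v w a b \<otimes>\<^bsub>A,B\<^esub> g v w a b) \<otimes>\<^bsub>A \<Otimes> B,D\<^esub> h v w a b) G))"
    by (intro sweedler_cong[OF assms(1,5)] sweedler_sweedler[OF assms(2) TT assms(4) G] p mem)
  also have "\<dots> = sweedler V W x (\<lambda>v w. sweedler V' W' (p v w) (\<lambda>a b. T (f v w a b) (g v w a b) (h v w a b)))"
    using f by (intro sweedler_cong[OF assms(1,5)] sweedler_cong[OF assms(2)] p)
      (auto simp: sweedler_pure[OF TT assms(4) G] pure_in_tensor_space G_pure)
  finally show ?thesis by (simp add: G_def[abs_def])
qed

locale yd_coalgebra_space =
  fixes H :: "('k::field, 'h::ring_1) hopf"
    and R :: "('k, 'h, 'r::ab_group_add) yd_coalg"
  assumes hopf: "hopf_algebra H" and yd: "yd_coalgebra H R"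
begin

sublocale H: coalgebra_space H "hcomult H" "hcounit H"
  using hopf by unfold_locales (simp add: hopf_algebra_def)

sublocale R: coalgebra_space R "comult R" "counit R"
  using yd by unfold_locales (simp add: yd_coalgebra_def)

lemma mem_H: "h \<in> vecs H"
  and bilinear_mult: "bilinear_on H H H (*)"
  using hopf by (simp_all add: hopf_algebra_def)

lemma bilinear_act: "bilinear_on H R R (act R)"
  and act_one: "v \<in> vecs R \<Longrightarrow> act R 1 v = v"
  and linear_coact: "linear_on R (H \<Otimes> R) (coact R)"
  and coact_coassoc: "v \<in> vecs R \<Longrightarrow>
      sweedler H R (coact R v) (\<lambda>a w. sweedler H H (hcomult H a) (\<lambda>a1 a2.
        (a1 \<otimes>\<^bsub>H,H\<^esub> a2) \<otimes>\<^bsub>H \<Otimes> H,R\<^esub> w)) =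
      sweedler H R (coact R v) (\<lambda>a w. sweedler H R (coact R w) (\<lambda>b w'.
        (a \<otimes>\<^bsub>H,H\<^esub> b) \<otimes>\<^bsub>H \<Otimes> H,R\<^esub> w'))"
  and coact_counit: "v \<in> vecs R \<Longrightarrow> sweedler H R (coact R v) (\<lambda>a w. scl R (hcounit H a) w) = v"
  and coact_comult: "v \<in> vecs R \<Longrightarrow> coact (yd_tensor H R R) (comult R v) =
      sweedler H R (coact R v) (\<lambda>a y. a \<otimes>\<^bsub>H,R \<Otimes> R\<^esub> comult R y)"
  and counit_act: "v \<in> vecs R \<Longrightarrow> counit R (act R h v) = hcounit H h * counit R v"
  and counit_coact: "v \<in> vecs R \<Longrightarrow>
      sweedler H R (coact R v) (\<lambda>a y. scl H (counit R y) a) = scl H (counit R v) 1"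
  using yd by (simp_all add: yd_coalgebra_def yd_module_def left_module_def left_comodule_def)

lemma coact_mem: "v \<in> vecs R \<Longrightarrow> coact R v \<in> vecs (H \<Otimes> R)"
  by (rule linear_on_mem[OF linear_coact])

lemma act_mem: "v \<in> vecs R \<Longrightarrow> act R h v \<in> vecs R"
  by (rule bilinear_on_mem[OF bilinear_act mem_H])

lemmas yd_intros = linear_intros
  bilinear_on_left[OF bilinear_mult mem_H] bilinear_on_right[OF bilinear_mult mem_H]
  bilinear_on_left[OF bilinear_act] bilinear_on_right[OF bilinear_act mem_H]
  linear_on_compose[OF linear_coact] R.linear_comult_compose H.linear_comult_compose
  linear_on_compose[OF R.linear_counit] linear_on_compose[OF H.linear_counit]
  R.vspace H.vspace vspace_tensor_space vspace_ground
  mem_H act_mem coact_mem R.comult_mem H.comult_mem pure_in_tensor_space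
  vspace_scale[OF R.vspace]

text \<open>This and its three successors are counit laws under a linear map. The target
  \<open>U\<close> is arbitrary because they are applied inside sums with values in tensor
  products.\<close>

lemma counit_left_apply:
  assumes "vspace U" "linear_on R U g" "x \<in> vecs R"
  shows "sweedler R R (comult R x) (\<lambda>a b. scl U (counit R a) (g b)) = g x"
proof -
  have "g x = g (sweedler R R (comult R x) (\<lambda>a b. scl R (counit R a) b))"
    by (simp add: R.counit_left assms(3))
  also have "\<dots> = sweedler R R (comult R x) (\<lambda>a b. g (scl R (counit R a) b))"
    by (intro sweedler_push[OF R.vspace R.vspace assms(2)] yd_intros assms)
  also have "\<dots> = sweedler R R (comult R x) (\<lambda>a b. scl U (counit R a) (g b))"
    by (intro sweedler_cong[OF R.vspace] linear_on_scale[OF assms(2)] yd_intros assms)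
  finally show ?thesis ..
qed

lemma counit_right_apply:
  assumes "vspace U" "linear_on R U g" "x \<in> vecs R"
  shows "sweedler R R (comult R x) (\<lambda>a b. scl U (counit R b) (g a)) = g x"
proof -
  have "g x = g (sweedler R R (comult R x) (\<lambda>a b. scl R (counit R b) a))"
    by (simp add: R.counit_right assms(3))
  also have "\<dots> = sweedler R R (comult R x) (\<lambda>a b. g (scl R (counit R b) a))"
    by (intro sweedler_push[OF R.vspace R.vspace assms(2)] yd_intros assms)
  also have "\<dots> = sweedler R R (comult R x) (\<lambda>a b. scl U (counit R b) (g a))"
    by (intro sweedler_cong[OF R.vspace] linear_on_scale[OF assms(2)] yd_intros assms)
  finally show ?thesis ..
qed

lemma coact_counit_apply:
  assumes "vspace U" "linear_on R U g" "x \<in> vecs R"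
  shows "sweedler H R (coact R x) (\<lambda>a y. scl U (hcounit H a) (g y)) = g x"
proof -
  have "g x = g (sweedler H R (coact R x) (\<lambda>a y. scl R (hcounit H a) y))"
    by (simp add: coact_counit assms(3))
  also have "\<dots> = sweedler H R (coact R x) (\<lambda>a y. g (scl R (hcounit H a) y))"
    by (intro sweedler_push[OF H.vspace R.vspace assms(2)] yd_intros assms)
  also have "\<dots> = sweedler H R (coact R x) (\<lambda>a y. scl U (hcounit H a) (g y))"
    by (intro sweedler_cong[OF H.vspace] linear_on_scale[OF assms(2)] yd_intros assms)
  finally show ?thesis ..
qed

lemma counit_coact_apply:
  assumes "vspace U" "linear_on H U g" "x \<in> vecs R"
  shows "sweedler H R (coact R x) (\<lambda>a y. scl U (counit R y) (g a)) = scl U (counit R x) (g 1)"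
proof -
  have "scl U (counit R x) (g 1) = g (scl H (counit R x) 1)"
    by (intro linear_on_scale[OF assms(2), symmetric] mem_H)
  also have "\<dots> = g (sweedler H R (coact R x) (\<lambda>a y. scl H (counit R y) a))"
    by (simp add: counit_coact assms(3))
  also have "\<dots> = sweedler H R (coact R x) (\<lambda>a y. g (scl H (counit R y) a))"
    by (intro sweedler_push[OF H.vspace H.vspace assms(2)] yd_intros assms)
  also have "\<dots> = sweedler H R (coact R x) (\<lambda>a y. scl U (counit R y) (g a))"
    by (intro sweedler_cong[OF H.vspace] linear_on_scale[OF assms(2)] yd_intros assms)
  finally show ?thesis ..
qed

lemma coact_coassoc_apply:
  assumes "vspace U" "v \<in> vecs R"
    and T: "\<And>a b. linear_on R U (\<lambda>c. T a b c)"
      "\<And>a c. c \<in> vecs R \<Longrightarrow> linear_on H U (\<lambda>b. T a b c)"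
      "\<And>b c. c \<in> vecs R \<Longrightarrow> linear_on H U (\<lambda>a. T a b c)"
  shows "sweedler H R (coact R v) (\<lambda>a w. sweedler H R (coact R w) (\<lambda>b w'. T a b w')) =
    sweedler H R (coact R v) (\<lambda>a w. sweedler H H (hcomult H a) (\<lambda>a1 a2. T a1 a2 w))"
  using sweedler_tensor3[where V = H and W = R and x = "coact R v" and V' = H and W' = H and A = H and B = H
      and D = R and U = U and p = "\<lambda>a w. hcomult H a" and f = "\<lambda>a w a1 a2. a1" and g = "\<lambda>a w a1 a2. a2"
      and h = "\<lambda>a w a1 a2. w" and T = T]
    sweedler_tensor3[where V = H and W = R and x = "coact R v" and V' = H and W' = R and A = H and B = H
      and D = R and U = U and p = "\<lambda>a w. coact R w" and f = "\<lambda>a w a1 a2. a" and g = "\<lambda>a w b y. b"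
      and h = "\<lambda>a w b y. y" and T = T]
  by (simp add: H.vspace assms coact_mem H.comult_mem mem_H coact_coassoc)

text \<open>Colinearity of the comultiplication, paired with the map that \<open>T\<close> induces.
  It serves to move a coaction past a comultiplication when the coaction is carried through an
  induction.\<close>

lemma coact_comult_apply:
  assumes "vspace U" "v \<in> vecs R"
    and T: "\<And>b c. b \<in> vecs R \<Longrightarrow> c \<in> vecs R \<Longrightarrow> linear_on H U (\<lambda>a. T a b c)"
      "\<And>a c. c \<in> vecs R \<Longrightarrow> linear_on R U (\<lambda>b. T a b c)"
      "\<And>a b. b \<in> vecs R \<Longrightarrow> linear_on R U (\<lambda>c. T a b c)"
  shows "sweedler H R (coact R v) (\<lambda>a w. sweedler R R (comult R w) (\<lambda>x y. T a x y)) =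
    sweedler R R (comult R v) (\<lambda>x y. sweedler H R (coact R x) (\<lambda>a x'. sweedler H R (coact R y) (\<lambda>b y'.
      T (a * b) x' y')))"
proof -
  define G where "G a q = sweedler R R q (\<lambda>x y. T a x y)" for a q
  have bil: "bilinear_on R R U (\<lambda>x y. T a x y)" for a
    using T by (intro bilinear_onI) auto
  have G: "bilinear_on H (R \<Otimes> R) U G"
    unfolding G_def by (intro yd_intros bil assms)
  have G_pure: "G a (x \<otimes>\<^bsub>R,R\<^esub> y) = T a x y" if "x \<in> vecs R" "y \<in> vecs R" for a x y
    unfolding G_def by (rule sweedler_pure[OF R.vspace assms(1) bil that])
  have mem: "a \<otimes>\<^bsub>H,R \<Otimes> R\<^esub> (x \<otimes>\<^bsub>R,R\<^esub> y) \<in> vecs (H \<Otimes> (R \<Otimes> R))" if "x \<in> vecs R" "y \<in> vecs R" for a x y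
    by (intro yd_intros that)
  note push = sweedler_sweedler[OF R.vspace H.vspace assms(1) G] sweedler_sweedler[OF H.vspace H.vspace assms(1) G]
  note cong = sweedler_cong[OF R.vspace R.comult_mem] sweedler_cong[OF H.vspace coact_mem]
  have "sweedler H (R \<Otimes> R) (sweedler H R (coact R v) (\<lambda>a y. a \<otimes>\<^bsub>H,R \<Otimes> R\<^esub> comult R y)) G
    = sweedler H R (coact R v) (\<lambda>a w. sweedler R R (comult R w) (\<lambda>x y. T a x y))"
    using assms(2)
    by (subst push(2)) (auto intro!: cong yd_intros simp: sweedler_pure[OF H.vspace assms(1) G] mem_H R.comult_mem G_def)
  moreover have "sweedler H (R \<Otimes> R) (coact (yd_tensor H R R) (comult R v)) G
    = sweedler R R (comult R v) (\<lambda>x y. sweedler H R (coact R x) (\<lambda>a x'. sweedler H R (coact R y) (\<lambda>b y'.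
      sweedler H (R \<Otimes> R) ((a * b) \<otimes>\<^bsub>H,R \<Otimes> R\<^esub> (x' \<otimes>\<^bsub>R,R\<^esub> y')) G)))"
    unfolding yd_tensor_def yd.simps using assms(2)
    by (subst push(1), simp_all add: R.comult_mem)
      (auto intro!: cong sweedler_mem[OF H.vspace vspace_tensor_space] coact_mem mem simp: push(2) coact_mem mem
        sweedler_mem[OF H.vspace vspace_tensor_space])
  moreover have "\<dots> = sweedler R R (comult R v) (\<lambda>x y. sweedler H R (coact R x) (\<lambda>a x'. sweedler H R (coact R y) (\<lambda>b y'.
      T (a * b) x' y')))"
    using assms(2)
    by (intro cong) (simp_all add: sweedler_pure[OF H.vspace assms(1) G] mem_H pure_in_tensor_space G_pure)
  ultimately show ?thesis
    using coact_comult[OF assms(2)] by simp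
qed

end

text \<open>The form in which the hypothesis of the step in \<open>connected_induct\<close> is used:
  it places the right factors of \<open>d\<close> in \<open>Q\<close>, where \<open>B\<close>
  vanishes, so only e \<otimes> x contributes.\<close>

lemma (in coalgebra_space) sweedler_comult_trivial_part:
  assumes "vspace U" "bilinear_on C C U B" and e: "e \<in> vecs C" "\<epsilon> e = 1" and x: "x \<in> vecs C"
    and Q: "\<And>\<phi>. functional \<phi> \<Longrightarrow> \<phi> e = 0 \<Longrightarrow> lhit \<phi> x \<in> Q"
    and B: "\<And>a b. a \<in> vecs C \<Longrightarrow> b \<in> vecs C \<Longrightarrow> b \<in> Q \<Longrightarrow> B a b = 0"
  shows "sweedler C C (\<Delta> x) B = B e x"
proof -
  define d where "d = \<Delta> x - e \<otimes>\<^bsub>C,C\<^esub> x"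
  have d: "d \<in> vecs (C \<Otimes> C)"
    unfolding d_def by (intro vspace_diff[OF vspace_tensor_space] comult_mem pure_in_tensor_space e x)
  have sweedler_d: "sweedler C C d F = sweedler C C (\<Delta> x) F - F e x"
    if "vspace W" "bilinear_on C C W F" for W :: "('k, 'z::ab_group_add, 'y) space_scheme" and F
    unfolding d_def
    by (subst linear_on_diff[OF vspace_tensor_space linear_on_sweedler_tensor[OF linear_on_id vspace that]])
      (simp_all add: comult_mem pure_in_tensor_space e x sweedler_pure[OF vspace that])
  obtain J :: "nat set" and a b \<alpha> \<beta> where *: "finite J" "\<And>j. j \<in> J \<Longrightarrow> a j \<in> vecs C" "\<And>j. j \<in> J \<Longrightarrow> b j \<in> vecs C"
    "\<And>j. j \<in> J \<Longrightarrow> functional (\<alpha> j)" "\<And>j. j \<in> J \<Longrightarrow> functional (\<beta> j)"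
    "\<And>i j. i \<in> J \<Longrightarrow> j \<in> J \<Longrightarrow> \<alpha> i (a j) = (if i = j then 1 else 0)"
    "\<And>i j. i \<in> J \<Longrightarrow> j \<in> J \<Longrightarrow> \<beta> i (b j) = (if i = j then 1 else 0)"
    "d = (\<Sum>j\<in>J. a j \<otimes>\<^bsub>C,C\<^esub> b j)"
    by (rule tensor_reduced_rep[OF vspace vspace d]) blast
  have "b j \<in> Q" if j: "j \<in> J" for j
  proof -
    have bil: "bilinear_on C C C (\<lambda>y z. scl C (\<alpha> j y) z)"
      by (intro linear_intros vspace *(4)[OF j])
    have "(\<Sum>i\<in>J. scl C (\<alpha> j (a i)) (b i)) = (\<Sum>i\<in>J. if j = i then b i else 0)"
      using *(6)[OF j] by (intro sum.cong) auto
    then have "b j = sweedler C C d (\<lambda>y z. scl C (\<alpha> j y) z)"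
      using *(1) j by (subst *(8), subst sweedler_sum_pure[OF vspace vspace bil *(1-3)]) simp_all
    \<comment> \<open>Pairing \<open>d\<close> with \<open>\<alpha> j\<close> isolates
      \<open>b j\<close>; the subtracted e \<otimes> x is exactly the correction that makes the
      functional vanish at \<open>e\<close>.\<close>
    also have "\<dots> = lhit (\<lambda>y. \<alpha> j y - \<alpha> j e * \<epsilon> y) x"
      using lhit_minus_counit(2)[OF *(4)[OF j] x] by (simp add: sweedler_d[OF vspace bil] lhit_def)
    also have "\<dots> \<in> Q"
      using e(2) by (intro Q lhit_minus_counit(1)[OF *(4)[OF j] x]) simp
    finally show ?thesis .
  qed
  then have "sweedler C C d B = 0"
    using *(2,3) B by (subst *(8), subst sweedler_sum_pure[OF vspace assms(1,2) *(1-3)]) simp_all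
  then show ?thesis by (simp add: sweedler_d[OF assms(1,2)])
qed

context yd_coalgebra_space
begin

text \<open>
  The equation \<open>eq\<close> says that \<open>G\<close> equals its convolution with \<open>T\<close>, and \<open>T\<close> vanishes at the
  grouplike element, so that \<open>G\<close> dies along the coradical filtration in both arguments. In the
  induction on \<open>r\<close> the coaction has to be carried along because \<open>eq\<close> twists \<open>s\<close> by \<open>r\<close>.
\<close>

lemma twisted_convolution_fixed_point_zero:
  assumes conn: "coradical R (comult R) = R.V.span {e}"
    and e: "e \<in> vecs R" "comult R e = e \<otimes>\<^bsub>R,R\<^esub> e" "counit R e = 1"
      "\<And>h. act R h e = scl R (hcounit H h) e" "coact R e = 1 \<otimes>\<^bsub>H,R\<^esub> e"
    and G: "bilinear_on R R R G"
    and T: "\<And>a b. a \<in> vecs R \<Longrightarrow> b \<in> vecs R \<Longrightarrow> linear_on R R (\<lambda>c. T a b c)"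
      "\<And>a c. a \<in> vecs R \<Longrightarrow> c \<in> vecs R \<Longrightarrow> linear_on R R (\<lambda>b. T a b c)"
      "\<And>b c. b \<in> vecs R \<Longrightarrow> c \<in> vecs R \<Longrightarrow> linear_on R R (\<lambda>a. T a b c)"
    and T_e: "\<And>v. v \<in> vecs R \<Longrightarrow> T e e v = 0"
    and eq: "\<And>r s. r \<in> vecs R \<Longrightarrow> s \<in> vecs R \<Longrightarrow> G r s =
      sweedler R R (comult R r) (\<lambda>r1 r2. sweedler H R (coact R r2) (\<lambda>a r2'.
        sweedler R R (comult R s) (\<lambda>s1 s2. T r1 (act R a s1) (G r2' s2))))"
    and r: "r \<in> vecs R" and s: "s \<in> vecs R"
  shows "G r s = 0"
proof -
  have G_mem: "G x y \<in> vecs R" if "x \<in> vecs R" "y \<in> vecs R" for x y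
    by (rule bilinear_on_mem[OF G that])
  have T_mem: "T x y z \<in> vecs R" if "x \<in> vecs R" "y \<in> vecs R" "z \<in> vecs R" for x y z
    by (rule linear_on_mem[OF T(1) that(3)]) (fact that)+
  note lin = yd_intros G_mem T_mem bilinear_on_left[OF G] bilinear_on_right[OF G]
    linear_on_compose[OF T(1)] linear_on_compose[OF T(2)] linear_on_compose[OF T(3)]
  note cong = sweedler_cong[OF R.vspace R.comult_mem] sweedler_cong[OF H.vspace coact_mem]
  \<comment> \<open>In \<open>eq\<close> the function \<open>G\<close> meets only the coacted part
    of \<open>r2\<close>, while the other part acts on \<open>s1\<close>; \<open>X\<close> keeps
    both together.\<close>
  define X where "X r s = sweedler H R (coact R r) (\<lambda>a r'. a \<otimes>\<^bsub>H,R\<^esub> G r' s)" for r s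
  define Q1 where "Q1 = {r \<in> vecs R. \<forall>s\<in>vecs R. X r s = 0}"
  define Q2 where "Q2 r = {s \<in> vecs R. X r s = 0}" for r
  have X_left: "linear_on R (H \<Otimes> R) (\<lambda>r. X r s)" if "s \<in> vecs R" for s
    unfolding X_def using that by - (assumption | rule lin)+
  have X_right: "linear_on R (H \<Otimes> R) (\<lambda>s. X r s)" if "r \<in> vecs R" for r
    unfolding X_def using that by - (assumption | rule lin)+
  have scl_zero: "scl (H \<Otimes> R) c 0 = 0" for c
    by (simp add: vspace_scale_distribs[OF vspace_tensor_space])
  have Q1: "R.V.subspace Q1"
    by (rule R.V.subspaceI) (auto simp: Q1_def R.V.subspace_0[OF R.subspace_vecs] R.V.subspace_add[OF R.subspace_vecs]
        R.V.subspace_scale[OF R.subspace_vecs] linear_on_zero[OF R.vspace X_left] linear_on_add[OF X_left]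
        linear_on_scale[OF X_left] scl_zero)
  have Q2: "R.V.subspace (Q2 r)" if "r \<in> vecs R" for r
    by (rule R.V.subspaceI) (auto simp: Q2_def that R.V.subspace_0[OF R.subspace_vecs] R.V.subspace_add[OF R.subspace_vecs]
        R.V.subspace_scale[OF R.subspace_vecs] linear_on_zero[OF R.vspace X_right] linear_on_add[OF X_right]
        linear_on_scale[OF X_right] scl_zero)
  \<comment> \<open>The map sends c \<otimes> v to a c1 \<otimes> T(x, c2 y, v). Through it
    \<open>Z\<close> depends on \<open>w\<close> and \<open>z\<close> only by way of
    \<open>X w z\<close>, which is how vanishing at earlier arguments is used.\<close>
  define \<Omega> where "\<Omega> a x y c v = sweedler H H (hcomult H c) (\<lambda>c1 c2. (a * c1) \<otimes>\<^bsub>H,R\<^esub> T x (act R c2 y) v)"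
    for a x y c v
  have bil_\<Omega>: "bilinear_on H R (H \<Otimes> R) (\<Omega> a x y)" if "x \<in> vecs R" "y \<in> vecs R" for a x y
    unfolding \<Omega>_def using that by - (assumption | rule lin)+
  define Z where "Z a x w y z = sweedler H R (coact R w) (\<lambda>c w'. \<Omega> a x y c (G w' z))" for a x w y z
  have Z_zero: "Z a x w y z = 0"
    if "x \<in> vecs R" "w \<in> vecs R" "y \<in> vecs R" "z \<in> vecs R" "X w z = 0" for a x w y z
  proof -
    have "Z a x w y z = sweedler H R (X w z) (\<Omega> a x y)"
      unfolding Z_def X_def using that(1-4)
      by (subst sweedler_sweedler[OF H.vspace H.vspace vspace_tensor_space bil_\<Omega>])
        (auto intro!: cong lin simp: sweedler_pure[OF H.vspace vspace_tensor_space bil_\<Omega>] mem_H G_mem)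
    also have "\<dots> = 0"
      unfolding that(5)
      by (rule linear_on_zero[OF vspace_tensor_space linear_on_sweedler_tensor[OF linear_on_id H.vspace vspace_tensor_space bil_\<Omega>[OF that(1,3)]]])
    finally show ?thesis .
  qed
  \<comment> \<open>The right-hand side of \<open>eq\<close> with the two factors of the
    comultiplication of \<open>r\<close> frozen as \<open>x\<close> and \<open>w\<close>.\<close>
  define J where "J s x w = sweedler H R (coact R w) (\<lambda>b y. sweedler R R (comult R s) (\<lambda>s1 s2. T x (act R b s1) (G y s2)))" for s x w
  define Y where "Y s a x w = sweedler H R (coact R w) (\<lambda>c w'. (a * c) \<otimes>\<^bsub>H,R\<^esub> J s x w')" for s a x w
  have J_left: "linear_on R R (\<lambda>x. J s x y)" if "s \<in> vecs R" "y \<in> vecs R" for s y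
    unfolding J_def using that by - (assumption | rule lin)+
  have J_right: "linear_on R R (\<lambda>y. J s x y)" if "s \<in> vecs R" "x \<in> vecs R" for s x
    unfolding J_def using that by - (assumption | rule lin)+
  have J_mem: "J s x y \<in> vecs R" if "s \<in> vecs R" "x \<in> vecs R" "y \<in> vecs R" for s x y
    by (rule linear_on_mem[OF J_left[OF that(1,3)] that(2)])
  have pure_lin: "linear_on R (H \<Otimes> R) (\<lambda>v. h \<otimes>\<^bsub>H,R\<^esub> v)" for h
    by (rule lin)+
  have Y_lin: "linear_on R (H \<Otimes> R) (\<lambda>w. Y s a x w)" "linear_on H (H \<Otimes> R) (\<lambda>a. Y s a x w)"
      "linear_on R (H \<Otimes> R) (\<lambda>x. Y s a x w)"
    if "s \<in> vecs R" "x \<in> vecs R" "w \<in> vecs R" for s a x w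
    unfolding Y_def using that by - (assumption | rule lin J_mem J_left J_right)+
  \<comment> \<open>\<open>Y\<close> coacts on \<open>w\<close> twice, once visibly and once inside
    \<open>J\<close>. Coassociativity trades this for a comultiplication in H, which is the shape of
    \<open>\<Omega>\<close>.\<close>
  have Y_eq: "Y s a x w = sweedler R R (comult R s) (\<lambda>s1 s2. Z a x w s1 s2)"
    if "s \<in> vecs R" "x \<in> vecs R" "w \<in> vecs R" for s a x w
  proof -
    define S where "S c b y = sweedler R R (comult R s) (\<lambda>s1 s2. (a * c) \<otimes>\<^bsub>H,R\<^esub> T x (act R b s1) (G y s2))" for c b y
    have S: "linear_on R (H \<Otimes> R) (\<lambda>y. S c b y)" "\<And>y. y \<in> vecs R \<Longrightarrow> linear_on H (H \<Otimes> R) (\<lambda>b. S c b y)" for c b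
      unfolding S_def using that by - (assumption | rule lin)+
    have S': "linear_on H (H \<Otimes> R) (\<lambda>c. S c b y)" if "y \<in> vecs R" for b y
      unfolding S_def using that \<open>s \<in> vecs R\<close> \<open>x \<in> vecs R\<close> by - (assumption | rule lin)+
    have "(a * c) \<otimes>\<^bsub>H,R\<^esub> J s x w' = sweedler H R (coact R w') (\<lambda>b y. S c b y)" if w': "w' \<in> vecs R" for c w'
    proof -
      have "(a * c) \<otimes>\<^bsub>H,R\<^esub> J s x w' = sweedler H R (coact R w') (\<lambda>b y.
          (a * c) \<otimes>\<^bsub>H,R\<^esub> sweedler R R (comult R s) (\<lambda>s1 s2. T x (act R b s1) (G y s2)))"
        unfolding J_def using w' \<open>s \<in> vecs R\<close> \<open>x \<in> vecs R\<close>
        by (intro sweedler_push[OF H.vspace R.vspace pure_lin coact_mem] sweedler_mem[OF R.vspace R.vspace] lin)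
      also have "\<dots> = sweedler H R (coact R w') (\<lambda>b y. S c b y)"
        unfolding S_def using w' \<open>s \<in> vecs R\<close> \<open>x \<in> vecs R\<close>
        by (intro cong sweedler_push[OF R.vspace R.vspace pure_lin R.comult_mem] lin)
      finally show ?thesis .
    qed
    then have "Y s a x w = sweedler H R (coact R w) (\<lambda>c w'. sweedler H R (coact R w') (\<lambda>b y. S c b y))"
      unfolding Y_def using that by (intro cong) auto
    also have "\<dots> = sweedler H R (coact R w) (\<lambda>c y. sweedler H H (hcomult H c) (\<lambda>c1 c2. S c1 c2 y))"
      by (rule coact_coassoc_apply[OF vspace_tensor_space that(3) S S'])
    also have "\<dots> = sweedler R R (comult R s) (\<lambda>s1 s2. Z a x w s1 s2)"
      unfolding S_def Z_def \<Omega>_def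
      by (subst (2) sweedler_swap, subst (1) sweedler_swap) simp
    finally show ?thesis .
  qed
  have X_eq: "X w s = sweedler R R (comult R w) (\<lambda>x y. sweedler H R (coact R x) (\<lambda>a x'. Y s a x' y))"
    if "w \<in> vecs R" "s \<in> vecs R" for w s
  proof -
    have "X w s = sweedler H R (coact R w) (\<lambda>a w'. a \<otimes>\<^bsub>H,R\<^esub> sweedler R R (comult R w') (\<lambda>x y. J s x y))"
      unfolding X_def J_def using that eq by (intro cong) simp_all
    also have "\<dots> = sweedler H R (coact R w) (\<lambda>a w'. sweedler R R (comult R w') (\<lambda>x y. a \<otimes>\<^bsub>H,R\<^esub> J s x y))"
      using that by (intro cong) (simp_all add: sweedler_push[OF R.vspace R.vspace pure_lin R.comult_mem] J_mem)
    also have "\<dots> = sweedler R R (comult R w) (\<lambda>x y. sweedler H R (coact R x) (\<lambda>a x'. Y s a x' y))"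
      unfolding Y_def
      by (rule coact_comult_apply[OF vspace_tensor_space that(1)])
        (assumption | rule lin that(2) J_mem J_left J_right)+
    finally show ?thesis .
  qed
  \<comment> \<open>The outer induction runs over the first argument, the inner one over the second
    with \<open>w\<close> fixed. Each reduces a comultiplication to its trivial part, leaving
    \<open>Z 1 e w e s\<close>.\<close>
  have "w \<in> Q1"
    if w: "w \<in> vecs R" and w_step: "\<And>\<phi>. R.functional \<phi> \<Longrightarrow> \<phi> e = 0 \<Longrightarrow> R.lhit \<phi> w \<in> Q1" for w
  proof -
    have "s \<in> Q2 w"
      if s: "s \<in> vecs R" and s_step: "\<And>\<phi>. R.functional \<phi> \<Longrightarrow> \<phi> e = 0 \<Longrightarrow> R.lhit \<phi> s \<in> Q2 w" for s
    proof -
      have bil_Y: "bilinear_on H R (H \<Otimes> R) (\<lambda>a x. Y s a x y)" if "y \<in> vecs R" for y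
        using that s by (intro bilinear_onI Y_lin)
      have "X w s = sweedler H R (coact R e) (\<lambda>a x'. Y s a x' w)"
        unfolding X_eq[OF w s]
      proof (rule R.sweedler_comult_trivial_part[OF vspace_tensor_space _ e(1,3) w w_step])
        show "bilinear_on R R (H \<Otimes> R) (\<lambda>x y. sweedler H R (coact R x) (\<lambda>a x'. Y s a x' y))"
          using s by - (assumption | rule lin Y_lin bil_Y)+
        show "sweedler H R (coact R x) (\<lambda>a x'. Y s a x' y) = 0"
          if "x \<in> vecs R" "y \<in> vecs R" "y \<in> Q1" for x y
        proof -
          have "Y s a x' y = 0" if "x' \<in> vecs R" for a x'
          proof -
            have "Y s a x' y = sweedler R R (comult R s) (\<lambda>s1 s2. 0)"
              unfolding Y_eq[OF s that \<open>y \<in> vecs R\<close>] using \<open>y \<in> Q1\<close> that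
              by (intro cong s Z_zero) (auto simp: Q1_def)
            then show ?thesis by (simp add: sweedler_zero_fun)
          qed
          then have "sweedler H R (coact R x) (\<lambda>a x'. Y s a x' y) = sweedler H R (coact R x) (\<lambda>a x'. 0)"
            using that by (intro cong) auto
          then show ?thesis by (simp add: sweedler_zero_fun)
        qed
      qed
      also have "\<dots> = Y s 1 e w"
        unfolding e(5) by (rule sweedler_pure[OF H.vspace vspace_tensor_space bil_Y[OF w] mem_H e(1)])
      also have "\<dots> = sweedler R R (comult R s) (\<lambda>s1 s2. Z 1 e w s1 s2)"
        by (rule Y_eq[OF s e(1) w])
      also have "\<dots> = Z 1 e w e s"
      proof (rule R.sweedler_comult_trivial_part[OF vspace_tensor_space _ e(1,3) s s_step])
        show "bilinear_on R R (H \<Otimes> R) (\<lambda>s1 s2. Z 1 e w s1 s2)"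
          unfolding Z_def \<Omega>_def using w e(1) by - (assumption | rule lin)+
        show "Z 1 e w a b = 0" if "a \<in> vecs R" "b \<in> vecs R" "b \<in> Q2 w" for a b
          using that w e(1) by (intro Z_zero) (auto simp: Q2_def)
      qed
      also have "\<dots> = 0"
      proof -
        \<comment> \<open>H acts on \<open>e\<close> by scalars, so the twist leaves a multiple of
          \<open>e\<close> and \<open>T_e\<close> still applies.\<close>
        have "\<Omega> 1 e e c v = 0" if v: "v \<in> vecs R" for c v
        proof -
          have "T e (act R c2 e) v = 0" for c2
            using linear_on_scale[OF T(2)[OF e(1) v] e(1)] T_e[OF v]
            by (simp add: e(4) vspace_scale_distribs[OF R.vspace])
          moreover have "h \<otimes>\<^bsub>H,R\<^esub> 0 = 0" for h
            by (rule bilinear_on_zero_right[OF bilinear_on_pure R.vspace mem_H])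
          ultimately show ?thesis by (simp add: \<Omega>_def sweedler_zero_fun)
        qed
        then have "Z 1 e w e s = sweedler H R (coact R w) (\<lambda>c w'. 0)"
          unfolding Z_def using w s by (intro cong) (auto simp: G_mem)
        then show ?thesis by (simp add: sweedler_zero_fun)
      qed
      finally show ?thesis using s by (simp add: Q2_def)
    qed
    then have "s \<in> Q2 w" if "s \<in> vecs R" for s
      by (rule R.connected_induct[OF conn e(1-3) Q2[OF w] _ that])
    then show ?thesis using w by (simp add: Q1_def Q2_def)
  qed
  then have "r \<in> Q1"
    by (rule R.connected_induct[OF conn e(1-3) Q1 _ r])
  then have X0: "X r s = 0" using s by (simp add: Q1_def)
  have bil: "bilinear_on H R R (\<lambda>a v. scl R (hcounit H a) v)"
    by (rule lin | assumption)+
  have "G r s = sweedler H R (coact R r) (\<lambda>a r'. scl R (hcounit H a) (G r' s))"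
    using s by (intro coact_counit_apply[symmetric] r) (auto intro: lin)
  also have "\<dots> = sweedler H R (X r s) (\<lambda>a v. scl R (hcounit H a) v)"
    unfolding X_def using r s
    by (subst sweedler_sweedler[OF H.vspace H.vspace R.vspace bil])
      (auto intro!: cong lin simp: sweedler_pure[OF H.vspace R.vspace bil] mem_H G_mem)
  also have "\<dots> = 0"
    unfolding X0
    by (rule linear_on_zero[OF vspace_tensor_space linear_on_sweedler_tensor[OF linear_on_id H.vspace R.vspace bil]])
  finally show ?thesis .
qed

section \<open>The tensor square as a counital coalgebra\<close>

abbreviation RR :: "('k, 'h, ('k, 'r, 'r) tensor) yd_coalg" where
  "RR \<equiv> yd_tensor_coalg H R R"

lemma RR_space: "vecs RR = vecs (R \<Otimes> R)" "scl RR = scl (R \<Otimes> R)"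
  by (simp_all add: yd_tensor_coalg_def)

lemma sweedler_RR: "sweedler RR RR = sweedler (R \<Otimes> R) (R \<Otimes> R)" "sweedler RR R = sweedler (R \<Otimes> R) R"
  by (rule sweedler_space_cong; simp add: RR_space)+

lemma pure_RR: "pure RR R = pure (R \<Otimes> R) R" and tensor_space_RR: "RR \<Otimes> R = (R \<Otimes> R) \<Otimes> R"
  by (rule pure_space_cong tensor_space_cong; simp add: RR_space)+

lemma linear_on_RR: "linear_on RR U f = linear_on (R \<Otimes> R) U f"
  by (simp add: linear_on_def RR_space)

lemma linear_counit_RR: "linear_on (R \<Otimes> R) ground (counit RR)"
  and counit_RR_pure: "x \<in> vecs R \<Longrightarrow> y \<in> vecs R \<Longrightarrow> counit RR (x \<otimes>\<^bsub>R,R\<^esub> y) = counit R x * counit R y"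
proof -
  have bil: "bilinear_on R R ground (\<lambda>x y. counit R x * counit R y)"
    by (rule yd_intros | assumption)+
  show "linear_on (R \<Otimes> R) ground (counit RR)"
    unfolding yd_tensor_coalg_def yd_coalg.simps
    by (rule linear_on_sweedler_tensor[OF linear_on_id R.vspace vspace_ground bil])
  show "x \<in> vecs R \<Longrightarrow> y \<in> vecs R \<Longrightarrow> counit RR (x \<otimes>\<^bsub>R,R\<^esub> y) = counit R x * counit R y"
    by (simp add: yd_tensor_coalg_def sweedler_pure[OF R.vspace vspace_ground bil])
qed

text \<open>\<open>comult RR\<close> is itself a sum over a chosen representation. Bilinearity
  removes the choice on pure tensors, and the explicit formula is what computations rely on.\<close>

lemma linear_comult_RR: "linear_on (R \<Otimes> R) ((R \<Otimes> R) \<Otimes> (R \<Otimes> R)) (comult RR)"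
  and sweedler_comult_RR_pure:
    "vspace U \<Longrightarrow> bilinear_on (R \<Otimes> R) (R \<Otimes> R) U F \<Longrightarrow> x \<in> vecs R \<Longrightarrow> y \<in> vecs R \<Longrightarrow>
      sweedler (R \<Otimes> R) (R \<Otimes> R) (comult RR (x \<otimes>\<^bsub>R,R\<^esub> y)) F =
      sweedler R R (comult R x) (\<lambda>x1 x2. sweedler H R (coact R x2) (\<lambda>a x2'.
        sweedler R R (comult R y) (\<lambda>y1 y2. F (x1 \<otimes>\<^bsub>R,R\<^esub> act R a y1) (x2' \<otimes>\<^bsub>R,R\<^esub> y2))))"
proof -
  define P where "P x1 a x2 y1 y2 =
    (x1 \<otimes>\<^bsub>R,R\<^esub> act R a y1) \<otimes>\<^bsub>R \<Otimes> R,R \<Otimes> R\<^esub> (x2 \<otimes>\<^bsub>R,R\<^esub> y2)" for x1 a x2 y1 y2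
  define D where "D x y = sweedler R R (comult R x) (\<lambda>x1 x2. sweedler H R (coact R x2) (\<lambda>a x2'.
        sweedler R R (comult R y) (\<lambda>y1 y2. P x1 a x2' y1 y2)))" for x y
  have comult_RR: "comult RR = (\<lambda>z. sweedler R R z D)"
    by (simp add: yd_tensor_coalg_def D_def[abs_def] P_def[abs_def])
  have bil: "bilinear_on R R ((R \<Otimes> R) \<Otimes> (R \<Otimes> R)) D"
    unfolding D_def P_def by (assumption | rule yd_intros)+
  show "linear_on (R \<Otimes> R) ((R \<Otimes> R) \<Otimes> (R \<Otimes> R)) (comult RR)"
    unfolding comult_RR by (rule linear_on_sweedler_tensor[OF linear_on_id R.vspace vspace_tensor_space bil])
  show "sweedler (R \<Otimes> R) (R \<Otimes> R) (comult RR (x \<otimes>\<^bsub>R,R\<^esub> y)) F =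
      sweedler R R (comult R x) (\<lambda>x1 x2. sweedler H R (coact R x2) (\<lambda>a x2'.
        sweedler R R (comult R y) (\<lambda>y1 y2. F (x1 \<otimes>\<^bsub>R,R\<^esub> act R a y1) (x2' \<otimes>\<^bsub>R,R\<^esub> y2))))"
    if U: "vspace U" and F: "bilinear_on (R \<Otimes> R) (R \<Otimes> R) U F" and x: "x \<in> vecs R" and y: "y \<in> vecs R"
  proof -
    note cong = sweedler_cong[OF R.vspace R.comult_mem] sweedler_cong[OF H.vspace coact_mem]
    note push = sweedler_sweedler[OF R.vspace vspace_tensor_space U F R.comult_mem]
      sweedler_sweedler[OF H.vspace vspace_tensor_space U F coact_mem]
    have mem: "P x1 a x2 y1 y2 \<in> vecs ((R \<Otimes> R) \<Otimes> (R \<Otimes> R))"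
      if "x1 \<in> vecs R" "x2 \<in> vecs R" "y1 \<in> vecs R" "y2 \<in> vecs R" for x1 a x2 y1 y2
      unfolding P_def using that by (intro yd_intros)
    have mem': "sweedler R R (comult R y) (\<lambda>y1 y2. P x1 a x2 y1 y2) \<in> vecs ((R \<Otimes> R) \<Otimes> (R \<Otimes> R))"
      if "x1 \<in> vecs R" "x2 \<in> vecs R" for x1 a x2
      using that y by (intro sweedler_mem[OF R.vspace vspace_tensor_space] R.comult_mem mem)
    have mem'': "sweedler H R (coact R x2) (\<lambda>a x2'. sweedler R R (comult R y) (\<lambda>y1 y2. P x1 a x2' y1 y2))
        \<in> vecs ((R \<Otimes> R) \<Otimes> (R \<Otimes> R))" if "x1 \<in> vecs R" "x2 \<in> vecs R" for x1 x2
      using that by (intro sweedler_mem[OF H.vspace vspace_tensor_space] coact_mem mem')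
    have "comult RR (x \<otimes>\<^bsub>R,R\<^esub> y) = D x y"
      unfolding comult_RR by (rule sweedler_pure[OF R.vspace vspace_tensor_space bil x y])
    then have "sweedler (R \<Otimes> R) (R \<Otimes> R) (comult RR (x \<otimes>\<^bsub>R,R\<^esub> y)) F =
      sweedler R R (comult R x) (\<lambda>x1 x2. sweedler (R \<Otimes> R) (R \<Otimes> R) (sweedler H R (coact R x2) (\<lambda>a x2'.
        sweedler R R (comult R y) (\<lambda>y1 y2. P x1 a x2' y1 y2))) F)"
      unfolding D_def by (simp add: push(1)[OF x mem''])
    also have "\<dots> = sweedler R R (comult R x) (\<lambda>x1 x2. sweedler H R (coact R x2) (\<lambda>a x2'.
        sweedler R R (comult R y) (\<lambda>y1 y2. sweedler (R \<Otimes> R) (R \<Otimes> R) (P x1 a x2' y1 y2) F)))"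
      using x y by (intro cong) (auto simp: push(2) mem' push(1) mem intro!: cong)
    also have "\<dots> = sweedler R R (comult R x) (\<lambda>x1 x2. sweedler H R (coact R x2) (\<lambda>a x2'.
        sweedler R R (comult R y) (\<lambda>y1 y2. F (x1 \<otimes>\<^bsub>R,R\<^esub> act R a y1) (x2' \<otimes>\<^bsub>R,R\<^esub> y2))))"
      unfolding P_def using x y
      by (intro cong) (auto simp: sweedler_pure[OF vspace_tensor_space U F] pure_in_tensor_space act_mem)
    finally show ?thesis .
  qed
qed

lemma comult_RR_mem: "z \<in> vecs (R \<Otimes> R) \<Longrightarrow> comult RR z \<in> vecs ((R \<Otimes> R) \<Otimes> (R \<Otimes> R))"
  by (rule linear_on_mem[OF linear_comult_RR])

lemmas RR_intros = yd_intros linear_on_compose[OF linear_counit_RR] linear_on_compose[OF linear_comult_RR]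
  comult_RR_mem

text \<open>Linearity of the counit splits \<epsilon>(a y1) into \<epsilon>(a) \<epsilon>(y1); then
  the counit laws for y, for the coaction and for x apply from the inside out.\<close>

lemma counit_left_RR:
  assumes U: "vspace U" and G: "linear_on (R \<Otimes> R) U G" and z: "z \<in> vecs (R \<Otimes> R)"
  shows "sweedler (R \<Otimes> R) (R \<Otimes> R) (comult RR z) (\<lambda>z1 z2. scl U (counit RR z1) (G z2)) = G z"
proof -
  note lin = RR_intros linear_on_compose[OF G] linear_on_mem[OF G] U
  note cong = sweedler_cong[OF R.vspace R.comult_mem] sweedler_cong[OF H.vspace coact_mem]
  have bil: "bilinear_on (R \<Otimes> R) (R \<Otimes> R) U (\<lambda>z1 z2. scl U (counit RR z1) (G z2))"
    by (assumption | rule lin)+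
  show ?thesis
  proof (rule tensor_linear_ext[OF R.vspace _ G _ z])
    show "linear_on (R \<Otimes> R) U (\<lambda>z. sweedler (R \<Otimes> R) (R \<Otimes> R) (comult RR z) (\<lambda>z1 z2. scl U (counit RR z1) (G z2)))"
      by (rule linear_on_sweedler_tensor[OF linear_comult_RR vspace_tensor_space U bil])
    fix x y assume x: "x \<in> vecs R" and y: "y \<in> vecs R"
    have "sweedler (R \<Otimes> R) (R \<Otimes> R) (comult RR (x \<otimes>\<^bsub>R,R\<^esub> y)) (\<lambda>z1 z2. scl U (counit RR z1) (G z2)) =
      sweedler R R (comult R x) (\<lambda>x1 x2. sweedler H R (coact R x2) (\<lambda>a x2'. sweedler R R (comult R y) (\<lambda>y1 y2.
        scl U (counit R y1) (scl U (hcounit H a) (scl U (counit R x1) (G (x2' \<otimes>\<^bsub>R,R\<^esub> y2)))))))"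
      unfolding sweedler_comult_RR_pure[OF U bil x y] using x y
      by (intro cong) (auto simp: counit_RR_pure act_mem counit_act vspace_scale_distribs[OF U] mult_ac)
    also have "\<dots> = sweedler R R (comult R x) (\<lambda>x1 x2. sweedler H R (coact R x2) (\<lambda>a x2'.
        scl U (hcounit H a) (scl U (counit R x1) (G (x2' \<otimes>\<^bsub>R,R\<^esub> y)))))"
      using x y
      by (intro cong counit_left_apply[OF U, where g = "\<lambda>y. scl U _ (scl U _ (G (_ \<otimes>\<^bsub>R,R\<^esub> y)))"]) (assumption | rule lin)+
    also have "\<dots> = sweedler R R (comult R x) (\<lambda>x1 x2. scl U (counit R x1) (G (x2 \<otimes>\<^bsub>R,R\<^esub> y)))"
      using x y
      by (intro cong coact_counit_apply[OF U, where g = "\<lambda>x. scl U _ (G (x \<otimes>\<^bsub>R,R\<^esub> y))"]) (assumption | rule lin)+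
    also have "\<dots> = G (x \<otimes>\<^bsub>R,R\<^esub> y)"
      using x y by (intro counit_left_apply[OF U, where g = "\<lambda>x. G (x \<otimes>\<^bsub>R,R\<^esub> y)"]) (assumption | rule lin)+
    finally show "sweedler (R \<Otimes> R) (R \<Otimes> R) (comult RR (x \<otimes>\<^bsub>R,R\<^esub> y)) (\<lambda>z1 z2. scl U (counit RR z1) (G z2))
      = G (x \<otimes>\<^bsub>R,R\<^esub> y)" .
  qed
qed

text \<open>Colinearity of the counit removes the twist: summing against \<epsilon>(x2') replaces
  the acting element \<open>a\<close> by 1.\<close>

lemma counit_right_RR:
  assumes U: "vspace U" and G: "linear_on (R \<Otimes> R) U G" and z: "z \<in> vecs (R \<Otimes> R)"
  shows "sweedler (R \<Otimes> R) (R \<Otimes> R) (comult RR z) (\<lambda>z1 z2. scl U (counit RR z2) (G z1)) = G z"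
proof -
  note lin = RR_intros linear_on_compose[OF G] linear_on_mem[OF G] U
  note cong = sweedler_cong[OF R.vspace R.comult_mem] sweedler_cong[OF H.vspace coact_mem]
  have bil: "bilinear_on (R \<Otimes> R) (R \<Otimes> R) U (\<lambda>z1 z2. scl U (counit RR z2) (G z1))"
    by (assumption | rule lin)+
  show ?thesis
  proof (rule tensor_linear_ext[OF R.vspace _ G _ z])
    show "linear_on (R \<Otimes> R) U (\<lambda>z. sweedler (R \<Otimes> R) (R \<Otimes> R) (comult RR z) (\<lambda>z1 z2. scl U (counit RR z2) (G z1)))"
      by (rule linear_on_sweedler_tensor[OF linear_comult_RR vspace_tensor_space U bil])
    fix x y assume x: "x \<in> vecs R" and y: "y \<in> vecs R"
    have "sweedler (R \<Otimes> R) (R \<Otimes> R) (comult RR (x \<otimes>\<^bsub>R,R\<^esub> y)) (\<lambda>z1 z2. scl U (counit RR z2) (G z1)) =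
      sweedler R R (comult R x) (\<lambda>x1 x2. sweedler H R (coact R x2) (\<lambda>a x2'. sweedler R R (comult R y) (\<lambda>y1 y2.
        scl U (counit R y2) (scl U (counit R x2') (G (x1 \<otimes>\<^bsub>R,R\<^esub> act R a y1))))))"
      unfolding sweedler_comult_RR_pure[OF U bil x y] using x y
      by (intro cong) (auto simp: counit_RR_pure vspace_scale_distribs[OF U] mult_ac)
    also have "\<dots> = sweedler R R (comult R x) (\<lambda>x1 x2. sweedler H R (coact R x2) (\<lambda>a x2'.
        scl U (counit R x2') (G (x1 \<otimes>\<^bsub>R,R\<^esub> act R a y))))"
      using x y
      by (intro cong counit_right_apply[OF U, where g = "\<lambda>y. scl U _ (G (_ \<otimes>\<^bsub>R,R\<^esub> act R _ y))"]) (assumption | rule lin)+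
    also have "\<dots> = sweedler R R (comult R x) (\<lambda>x1 x2. scl U (counit R x2) (G (x1 \<otimes>\<^bsub>R,R\<^esub> act R 1 y)))"
      using x y
      by (intro cong counit_coact_apply[OF U, where g = "\<lambda>a. G (_ \<otimes>\<^bsub>R,R\<^esub> act R a y)"]) (assumption | rule lin)+
    also have "\<dots> = G (x \<otimes>\<^bsub>R,R\<^esub> act R 1 y)"
      using x y
      by (intro counit_right_apply[OF U, where g = "\<lambda>x. G (x \<otimes>\<^bsub>R,R\<^esub> act R 1 y)"]) (assumption | rule lin)+
    finally show "sweedler (R \<Otimes> R) (R \<Otimes> R) (comult RR (x \<otimes>\<^bsub>R,R\<^esub> y)) (\<lambda>z1 z2. scl U (counit RR z2) (G z1))
      = G (x \<otimes>\<^bsub>R,R\<^esub> y)" by (simp add: act_one y)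
  qed
qed

end

section \<open>Associativity and the cocycle\<close>

theorem theorem3p7:
  fixes H :: "('k::field_char_0, 'h::ring_1) hopf"
    and R :: "('k, 'h, 'r::ab_group_add) yd_coalg"
    and m :: "('k, 'r, 'r) tensor \<Rightarrow> 'r"
    and u :: "'k \<Rightarrow> 'r"
    and \<xi> :: "('k, 'r, 'r) tensor \<Rightarrow> 'h"
  assumes "hopf_algebra H"
    and "pre_bialgebra_with_cocycle H R m u \<xi>"
    and "connected_coalgebra R (comult R) u"
  defines "RR \<equiv> yd_tensor_coalg H R R"
  shows "(associative_mult R m \<longleftrightarrow>
           (\<forall>z\<in>vecs RR. \<forall>t\<in>vecs R. act R (\<xi> z) t = scl R (counit RR z) t)) \<and>
         ((\<forall>z\<in>vecs RR. \<forall>t\<in>vecs R. act R (\<xi> z) t = scl R (counit RR z) t) \<longleftrightarrow>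
           (\<forall>x\<in>vecs (RR \<Otimes> R). Phi H R \<xi> x = x))"
proof -
  have coaug: "coaugmented H R u"
    using assms(2) by (simp add: pre_bialgebra_with_cocycle_def pre_bialgebra_def Let_def)
  interpret yd_coalgebra_space H R
    using assms(1) coaug by unfold_locales (simp_all add: coaugmented_def)
  note RR_simps = RR_space linear_on_RR sweedler_RR pure_RR tensor_space_RR
  have m: "linear_on (R \<Otimes> R) R m" and \<xi>: "linear_on (R \<Otimes> R) H \<xi>"
    and unit: "\<And>r. r \<in> vecs R \<Longrightarrow> m (u 1 \<otimes>\<^bsub>R,R\<^esub> r) = r"
    and counit_m: "\<And>z. z \<in> vecs (R \<Otimes> R) \<Longrightarrow> counit R (m z) = counit RR z"
    and quasi_assoc: "\<And>r s t. r \<in> vecs R \<Longrightarrow> s \<in> vecs R \<Longrightarrow> t \<in> vecs R \<Longrightarrow>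
      m (r \<otimes>\<^bsub>R,R\<^esub> m (s \<otimes>\<^bsub>R,R\<^esub> t)) =
      sweedler (R \<Otimes> R) (R \<Otimes> R) (comult RR (r \<otimes>\<^bsub>R,R\<^esub> s)) (\<lambda>z1 z2. m (m z1 \<otimes>\<^bsub>R,R\<^esub> act R (\<xi> z2) t))"
    using assms(2) unfolding RR_def
    by (simp_all add: pre_bialgebra_with_cocycle_def pre_bialgebra_def Let_def RR_simps)
  define e where "e = u 1"
  have e: "e \<in> vecs R" "comult R e = e \<otimes>\<^bsub>R,R\<^esub> e" "counit R e = 1"
    "\<And>h. act R h e = scl R (hcounit H h) e" "coact R e = 1 \<otimes>\<^bsub>H,R\<^esub> e"
    using coaug linear_on_mem[of ground R u 1] by (simp_all add: coaugmented_def e_def)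
  have conn: "coradical R (comult R) = R.V.span {e}"
    using assms(3) by (simp add: connected_coalgebra_def e_def)
  note m_mem = linear_on_mem[OF m] and act_\<xi> = bilinear_on_left[OF bilinear_act _ linear_on_compose[OF \<xi>]]
  note lin = RR_intros[folded RR_def] linear_on_compose[OF m] act_\<xi> m_mem
  note cong = sweedler_cong[OF vspace_tensor_space comult_RR_mem[folded RR_def]]
  have trivial_iff: "(\<forall>z\<in>vecs RR. \<forall>t\<in>vecs R. act R (\<xi> z) t = scl R (counit RR z) t) \<longleftrightarrow>
      (\<forall>z\<in>vecs (R \<Otimes> R). \<forall>t\<in>vecs R. act R (\<xi> z) t = scl R (counit RR z) t)"
    unfolding RR_def by (simp add: RR_space)
  \<comment> \<open>The counit law splits \<open>z\<close> in m(m(z) \<otimes> t) into two legs, so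
    that it can be compared termwise with \<open>quasi_assoc\<close>.\<close>
  have assoc_conv: "sweedler (R \<Otimes> R) (R \<Otimes> R) (comult RR z) (\<lambda>z1 z2. scl R (counit RR z2) (m (m z1 \<otimes>\<^bsub>R,R\<^esub> t)))
      = m (m z \<otimes>\<^bsub>R,R\<^esub> t)" if "z \<in> vecs (R \<Otimes> R)" "t \<in> vecs R" for z t
    unfolding RR_def
    by (rule counit_right_RR[OF R.vspace _ that(1), where G = "\<lambda>z. m (m z \<otimes>\<^bsub>R,R\<^esub> t)"])
      (rule lin that(2))+
  have trivial_imp_assoc: "associative_mult R m"
    if triv: "\<forall>z\<in>vecs (R \<Otimes> R). \<forall>t\<in>vecs R. act R (\<xi> z) t = scl R (counit RR z) t"
    unfolding associative_mult_def
  proof (intro ballI)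
    fix r s t assume rst: "r \<in> vecs R" "s \<in> vecs R" "t \<in> vecs R"
    have scale: "m (x \<otimes>\<^bsub>R,R\<^esub> scl R c t) = scl R c (m (x \<otimes>\<^bsub>R,R\<^esub> t))" if "x \<in> vecs R" for x c
      by (rule linear_on_scale[OF _ rst(3), where f = "\<lambda>t. m (x \<otimes>\<^bsub>R,R\<^esub> t)"]) (rule lin that)+
    have "m (r \<otimes>\<^bsub>R,R\<^esub> m (s \<otimes>\<^bsub>R,R\<^esub> t)) = sweedler (R \<Otimes> R) (R \<Otimes> R) (comult RR (r \<otimes>\<^bsub>R,R\<^esub> s))
        (\<lambda>z1 z2. scl R (counit RR z2) (m (m z1 \<otimes>\<^bsub>R,R\<^esub> t)))"
      unfolding quasi_assoc[OF rst] using rst triv by (intro cong) (simp_all add: pure_in_tensor_space scale m_mem)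
    then show "m (m (r \<otimes>\<^bsub>R,R\<^esub> s) \<otimes>\<^bsub>R,R\<^esub> t) = m (r \<otimes>\<^bsub>R,R\<^esub> m (s \<otimes>\<^bsub>R,R\<^esub> t))"
      using rst by (simp add: assoc_conv pure_in_tensor_space)
  qed
  have assoc_imp_trivial: "act R (\<xi> z) t = scl R (counit RR z) t"
    if assoc: "associative_mult R m" and z: "z \<in> vecs (R \<Otimes> R)" and t: "t \<in> vecs R" for z t
  proof -
    define g where "g z = act R (\<xi> z) t - scl R (counit RR z) t" for z
    have g: "linear_on (R \<Otimes> R) R g"
      unfolding g_def using t by - (assumption | rule lin)+
    \<comment> \<open>The counit term makes \<open>F e\<close> vanish by the unit law, while the
      \<open>m\<close> term contributes only the associator after summation.\<close>
    define F where "F x v = scl R (counit R x) v - m (x \<otimes>\<^bsub>R,R\<^esub> v)" for x v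
    have F: "bilinear_on R R R F"
      unfolding F_def by (assumption | rule lin)+
    have F_eq: "F (m z1) (g z2) = scl R (counit RR z1) (g z2)
        - (m (m z1 \<otimes>\<^bsub>R,R\<^esub> act R (\<xi> z2) t) - scl R (counit RR z2) (m (m z1 \<otimes>\<^bsub>R,R\<^esub> t)))"
      if z12: "z1 \<in> vecs (R \<Otimes> R)" "z2 \<in> vecs (R \<Otimes> R)" for z1 z2
    proof -
      have lin_m: "linear_on R R (\<lambda>v. m (m z1 \<otimes>\<^bsub>R,R\<^esub> v))" by (rule lin z12)+
      have "m (m z1 \<otimes>\<^bsub>R,R\<^esub> g z2) = m (m z1 \<otimes>\<^bsub>R,R\<^esub> act R (\<xi> z2) t) - scl R (counit RR z2) (m (m z1 \<otimes>\<^bsub>R,R\<^esub> t))"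
        unfolding g_def using t
        by (simp add: linear_on_diff[OF R.vspace lin_m] linear_on_scale[OF lin_m] act_mem vspace_scale[OF R.vspace])
      then show ?thesis using z12 by (simp add: F_def counit_m)
    qed
    have conv: "g (r \<otimes>\<^bsub>R,R\<^esub> s) = sweedler (R \<Otimes> R) (R \<Otimes> R) (comult RR (r \<otimes>\<^bsub>R,R\<^esub> s)) (\<lambda>z1 z2. F (m z1) (g z2))"
      if rs: "r \<in> vecs R" "s \<in> vecs R" for r s
    proof -
      have rs': "r \<otimes>\<^bsub>R,R\<^esub> s \<in> vecs (R \<Otimes> R)" by (rule pure_in_tensor_space[OF rs])
      have "sweedler (R \<Otimes> R) (R \<Otimes> R) (comult RR (r \<otimes>\<^bsub>R,R\<^esub> s)) (\<lambda>z1 z2. F (m z1) (g z2))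
        = sweedler (R \<Otimes> R) (R \<Otimes> R) (comult RR (r \<otimes>\<^bsub>R,R\<^esub> s)) (\<lambda>z1 z2. scl R (counit RR z1) (g z2)
          - (m (m z1 \<otimes>\<^bsub>R,R\<^esub> act R (\<xi> z2) t) - scl R (counit RR z2) (m (m z1 \<otimes>\<^bsub>R,R\<^esub> t))))"
        by (intro cong rs' F_eq)
      \<comment> \<open>The first sum is the counit law for \<open>g\<close>; the others are the two
        bracketings of r, s, t.\<close>
      also have "\<dots> = g (r \<otimes>\<^bsub>R,R\<^esub> s) - (m (r \<otimes>\<^bsub>R,R\<^esub> m (s \<otimes>\<^bsub>R,R\<^esub> t)) - m (m (r \<otimes>\<^bsub>R,R\<^esub> s) \<otimes>\<^bsub>R,R\<^esub> t))"
        unfolding sweedler_diff_fun quasi_assoc[OF rs t, symmetric] assoc_conv[OF rs' t]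
        using counit_left_RR[OF R.vspace g rs', folded RR_def] by simp
      also have "\<dots> = g (r \<otimes>\<^bsub>R,R\<^esub> s)"
        using assoc rs t by (simp add: associative_mult_def)
      finally show ?thesis ..
    qed
    define T where "T x y v = F (m (x \<otimes>\<^bsub>R,R\<^esub> y)) v" for x y v
    note lin_F = lin bilinear_on_left[OF F] bilinear_on_right[OF F]
    have "g (r \<otimes>\<^bsub>R,R\<^esub> s) = 0" if rs: "r \<in> vecs R" "s \<in> vecs R" for r s
    proof (rule twisted_convolution_fixed_point_zero[OF conn e, where T = T and G = "\<lambda>r s. g (r \<otimes>\<^bsub>R,R\<^esub> s)"])
      show "bilinear_on R R R (\<lambda>r s. g (r \<otimes>\<^bsub>R,R\<^esub> s))"
        by (assumption | rule linear_on_compose[OF g] lin)+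
      show "linear_on R R (\<lambda>c. T a b c)" if "a \<in> vecs R" "b \<in> vecs R" for a b
        unfolding T_def using that by - (assumption | rule lin_F)+
      show "linear_on R R (\<lambda>b. T a b c)" if "a \<in> vecs R" "c \<in> vecs R" for a c
        unfolding T_def using that by - (assumption | rule lin_F)+
      show "linear_on R R (\<lambda>a. T a b c)" if "b \<in> vecs R" "c \<in> vecs R" for b c
        unfolding T_def using that by - (assumption | rule lin_F)+
      show "T e e v = 0" if "v \<in> vecs R" for v
        using that e unit[folded e_def] by (simp add: T_def F_def R.V.scale_one)
      have bil: "bilinear_on (R \<Otimes> R) (R \<Otimes> R) R (\<lambda>z1 z2. F (m z1) (g z2))"
        by (assumption | rule linear_on_compose[OF g] linear_on_mem[OF g] lin_F)+
      show "g (r \<otimes>\<^bsub>R,R\<^esub> s) = sweedler R R (comult R r) (\<lambda>r1 r2. sweedler H R (coact R r2) (\<lambda>a r2'.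
          sweedler R R (comult R s) (\<lambda>s1 s2. T r1 (act R a s1) (g (r2' \<otimes>\<^bsub>R,R\<^esub> s2)))))"
        if "r \<in> vecs R" "s \<in> vecs R" for r s
        unfolding T_def conv[OF that]
        using sweedler_comult_RR_pure[OF R.vspace bil that, folded RR_def] .
    qed (fact rs)+
    then have "g z = 0"
      by (intro tensor_linear_ext[OF R.vspace g _ _ z, where g = "\<lambda>z. 0"])
        (auto intro!: linear_onI simp: vspace_zero[OF R.vspace])
    then show ?thesis by (simp add: g_def)
  qed
  \<comment> \<open>The summand of \<open>Phi\<close> is isolated as a bilinear map, so that
    \<open>Phi\<close> can be evaluated on pure tensors.\<close>
  define \<Phi> where "\<Phi> z t = sweedler (R \<Otimes> R) (R \<Otimes> R) (comult RR z) (\<lambda>z1 z2. z1 \<otimes>\<^bsub>R \<Otimes> R,R\<^esub> act R (\<xi> z2) t)" for z t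
  have Phi_eq: "Phi H R \<xi> x = sweedler (R \<Otimes> R) R x \<Phi>" for x
    by (simp add: Phi_def RR_simps Let_def \<Phi>_def[abs_def] RR_def)
  have bil_\<Phi>: "bilinear_on (R \<Otimes> R) R ((R \<Otimes> R) \<Otimes> R) \<Phi>"
    unfolding \<Phi>_def by (assumption | rule lin bilinear_on_right[OF bilinear_act mem_H])+
  have trivial_imp_Phi: "Phi H R \<xi> x = x"
    if triv: "\<forall>z\<in>vecs (R \<Otimes> R). \<forall>t\<in>vecs R. act R (\<xi> z) t = scl R (counit RR z) t"
      and x: "x \<in> vecs ((R \<Otimes> R) \<Otimes> R)" for x
  proof -
    have "\<Phi> z t = z \<otimes>\<^bsub>R \<Otimes> R,R\<^esub> t" if zt: "z \<in> vecs (R \<Otimes> R)" "t \<in> vecs R" for z t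
    proof -
      have scale: "y \<otimes>\<^bsub>R \<Otimes> R,R\<^esub> scl R c t = scl ((R \<Otimes> R) \<Otimes> R) c (y \<otimes>\<^bsub>R \<Otimes> R,R\<^esub> t)"
        if "y \<in> vecs (R \<Otimes> R)" for y c
        by (rule linear_on_scale[OF _ zt(2), where f = "\<lambda>t. y \<otimes>\<^bsub>R \<Otimes> R,R\<^esub> t"]) (rule lin that)+
      have "\<Phi> z t = sweedler (R \<Otimes> R) (R \<Otimes> R) (comult RR z)
          (\<lambda>z1 z2. scl ((R \<Otimes> R) \<Otimes> R) (counit RR z2) (z1 \<otimes>\<^bsub>R \<Otimes> R,R\<^esub> t))"
        unfolding \<Phi>_def using zt triv by (intro cong) (simp_all add: scale)
      also have "\<dots> = z \<otimes>\<^bsub>R \<Otimes> R,R\<^esub> t"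
        unfolding RR_def
        by (rule counit_right_RR[OF vspace_tensor_space _ zt(1), where G = "\<lambda>z. z \<otimes>\<^bsub>R \<Otimes> R,R\<^esub> t"]) (rule lin zt(2))+
      finally show ?thesis .
    qed
    then have "Phi H R \<xi> x = sweedler (R \<Otimes> R) R x (pure (R \<Otimes> R) R)"
      unfolding Phi_eq by (intro sweedler_cong[OF vspace_tensor_space x])
    then show ?thesis by (simp add: sweedler_pure_id[OF vspace_tensor_space x])
  qed
  have Phi_imp_trivial: "act R (\<xi> z) t = scl R (counit RR z) t"
    if Phi: "\<forall>x\<in>vecs ((R \<Otimes> R) \<Otimes> R). Phi H R \<xi> x = x" and zt: "z \<in> vecs (R \<Otimes> R)" "t \<in> vecs R" for z t
  proof -
    have bil: "bilinear_on (R \<Otimes> R) R R (\<lambda>z t. scl R (counit RR z) t)"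
      by (assumption | rule lin)+
    have "\<Phi> z t = Phi H R \<xi> (z \<otimes>\<^bsub>R \<Otimes> R,R\<^esub> t)"
      unfolding Phi_eq by (rule sweedler_pure[OF vspace_tensor_space vspace_tensor_space bil_\<Phi> zt, symmetric])
    then have "\<Phi> z t = z \<otimes>\<^bsub>R \<Otimes> R,R\<^esub> t"
      using Phi zt by (simp add: pure_in_tensor_space)
    \<comment> \<open>Applying the counit to the first tensor factor collapses z1 \<otimes>
      \<xi>(z2)t to \<xi>(z)t and z \<otimes> t to \<epsilon>(z)t.\<close>
    then have "scl R (counit RR z) t = sweedler (R \<Otimes> R) R (\<Phi> z t) (\<lambda>z t. scl R (counit RR z) t)"
      by (simp add: sweedler_pure[OF vspace_tensor_space R.vspace bil zt])
    also have "\<dots> = sweedler (R \<Otimes> R) (R \<Otimes> R) (comult RR z) (\<lambda>z1 z2. scl R (counit RR z1) (act R (\<xi> z2) t))"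
      unfolding \<Phi>_def using zt
      by (subst sweedler_sweedler[OF vspace_tensor_space vspace_tensor_space R.vspace bil])
        (auto intro!: cong lin simp: sweedler_pure[OF vspace_tensor_space R.vspace bil] act_mem)
    also have "\<dots> = act R (\<xi> z) t"
      unfolding RR_def
      by (rule counit_left_RR[OF R.vspace _ zt(1), where G = "\<lambda>z. act R (\<xi> z) t"]) (rule lin zt(2))+
    finally show ?thesis ..
  qed
  have "vecs (RR \<Otimes> R) = vecs ((R \<Otimes> R) \<Otimes> R)"
    by (simp add: RR_def tensor_space_RR)
  then show ?thesis
    unfolding trivial_iff using trivial_imp_assoc assoc_imp_trivial trivial_imp_Phi Phi_imp_trivial by blast
qed

end
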